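(* Let $s>\frac12$. Then, for every $t\neq0$, the pushforward measure $\widetilde\Phi(t)_*\mu_s$ of the Gaussian measure $\mu_s$ under the solution map $\widetilde\Phi(t)$ of the dispersionless model $$ i\partial_tu=|u|^2u,\qquad u|_{t=0}=u_0,\qquad (x,t)\in\mathbb T\times\mathbb R, $$ is not absolutely continuous with respect to $\mu_s$. Namely, $\mu_s$ is not quasi-invariant under the dispersionless dynamics.
   Context: $\mathbb T=\mathbb R/(2\pi\mathbb Z)$, $\langle n\rangle=(1+n^2)^{1/2}$, and functions are complex-valued. For $s>\frac12$, $\mu_s$ is the law of the random Fourier series $$u^\omega(x)=\sum_{n\in\mathbb Z}\frac{g_n(\omega)}{\langle n\rangle^s}e^{inx},$$ where $\{g_n\}_{n\in\mathbb Z}$ are independent standard complex-valued Gaussian random variables with mean zero and $\mathrm{Var}(g_n)=\mathbb E|g_n|^2=2$ (real and imaginary parts independent, each of variance $1$). For $s>\frac12$ this series is almost surely a continuous function on $\mathbb T$. For continuous initial data $u_0$ the solution is given explicitly by $\widetilde\Phi(t)(u_0)(x)=e^{-it|u_0(x)|^2}u_0(x)$, so $\widetilde\Phi(t)$ is defined $\mu_s$-almost everywhere. A measure $\mu$ is quasi-invariant under a measurable map $T$ if $\mu$ and $T_*\mu=\mu\circ T^{-1}$ are mutually absolutely continuous. *)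

theory Defs
  imports "HOL-Probability.Probability"
begin

text \<open>
  \<open>C(\<T>)\<close> is represented by the closed subspace of \<open>2\<pi>\<close>-periodic functions of the space of bounded
  continuous functions on the real line with the supremum norm, with its Borel \<open>\<sigma>\<close>-algebra.
\<close>

definition periodic_functions :: "(real \<Rightarrow>\<^sub>C complex) set" where
  "periodic_functions = {u. \<forall>x. apply_bcontfun u (x + 2 * pi) = apply_bcontfun u x}"

definition CT :: "(real \<Rightarrow>\<^sub>C complex) measure" where
  "CT = restrict_space borel periodic_functions"

definition japanese_bracket :: "int \<Rightarrow> real" where
  "japanese_bracket n = (1 + (real_of_int n)\<^sup>2) powr (1/2)"

text \<open>
  Variance of the complex variable is 2, i.e.\ real and imaginary parts are standard normal.
\<close>

definition standard_complex_gaussian :: "'w measure \<Rightarrow> ('w \<Rightarrow> complex) \<Rightarrow> bool" where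
  "standard_complex_gaussian M X \<longleftrightarrow>
     distributed M lborel (\<lambda>\<omega>. Re (X \<omega>)) std_normal_density \<and>
     distributed M lborel (\<lambda>\<omega>. Im (X \<omega>)) std_normal_density \<and>
     prob_space.indep_var M borel (\<lambda>\<omega>. Re (X \<omega>)) borel (\<lambda>\<omega>. Im (X \<omega>))"

definition iid_complex_gaussians :: "'w measure \<Rightarrow> (int \<Rightarrow> 'w \<Rightarrow> complex) \<Rightarrow> bool" where
  "iid_complex_gaussians M g \<longleftrightarrow>
     prob_space.indep_vars M (\<lambda>_. borel) g UNIV \<and> (\<forall>n. standard_complex_gaussian M (g n))"

text \<open>Such families exist, so statements about all of them are not vacuous.\<close>

lemma iid_complex_gaussians_exist:
  "\<exists>(M :: (int \<Rightarrow> real \<times> real) measure) g. prob_space M \<and> iid_complex_gaussians M g"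
proof -
  define N where "N = density lborel (\<lambda>x. ennreal (std_normal_density x))"
  interpret N: prob_space N
    unfolding N_def by (rule prob_space_normal_density) simp
  have sN [measurable_cong]: "sets N = sets borel" by (simp add: N_def)
  define P where "P = N \<Otimes>\<^sub>M N"
  interpret P: pair_prob_space N N ..
  have pP: "prob_space P" unfolding P_def by (rule P.prob_space_axioms)
  have dP: "distr P N fst = N" "distr P N snd = N"
    unfolding P_def
  proof -
    show f: "distr (N \<Otimes>\<^sub>M N) N fst = N" by (rule N.distr_pair_fst)
    have "N = distr (distr (N \<Otimes>\<^sub>M N) (N \<Otimes>\<^sub>M N) (\<lambda>(x, y). (y, x))) N fst"
      by (subst P.distr_pair_swap[symmetric]) (rule f[symmetric])
    also have "\<dots> = distr (N \<Otimes>\<^sub>M N) N snd"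
      by (subst distr_distr) (auto simp: o_def split_def)
    finally show "distr (N \<Otimes>\<^sub>M N) N snd = N" by simp
  qed
  define M where "M = PiM (UNIV :: int set) (\<lambda>_. P)"
  interpret M: product_prob_space "\<lambda>_::int. P" UNIV
    by (rule product_prob_spaceI) (rule pP)
  have pM: "prob_space M" unfolding M_def by (rule M.prob_space_axioms)
  interpret Mp: prob_space M by (rule pM)
  define g where "g = (\<lambda>(n::int) \<omega>. Complex (fst (\<omega> n)) (snd (\<omega> n)))"
  have m [measurable]: "(\<lambda>\<omega>. \<omega> n) \<in> measurable M P" for n
    unfolding M_def by measurable
  have C: "(\<lambda>p. Complex (fst p) (snd p)) \<in> borel_measurable P"
    unfolding Complex_eq P_def by measurable
  have dM: "distr M P (\<lambda>\<omega>. \<omega> n) = P" for n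
    unfolding M_def by (rule M.PiM_component) simp
  have i0: "Mp.indep_vars (\<lambda>_. P) (\<lambda>n \<omega>. \<omega> n) UNIV"
  proof (subst Mp.indep_vars_iff_distr_eq_PiM)
    have "distr M (PiM UNIV (\<lambda>_. P)) (\<lambda>x. \<lambda>n\<in>UNIV. x n) = M"
      by (simp add: M_def restrict_UNIV distr_id2)
    then show "distr M (PiM UNIV (\<lambda>_. P)) (\<lambda>x. \<lambda>n\<in>UNIV. x n) =
        PiM UNIV (\<lambda>n. distr M P (\<lambda>\<omega>. \<omega> n))"
      unfolding dM by (simp add: M_def)
  qed simp_all
  have "Mp.indep_vars (\<lambda>_. borel) (\<lambda>n. (\<lambda>p. Complex (fst p) (snd p)) \<circ> (\<lambda>\<omega>. \<omega> n)) UNIV"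
    by (rule Mp.indep_vars_compose[OF i0]) (rule C)
  then have 1: "Mp.indep_vars (\<lambda>_. borel) g UNIV"
    by (simp add: g_def o_def)
  have f [measurable]: "fst \<in> measurable P N" "snd \<in> measurable P N"
    by (auto simp: P_def)
  have d1: "distr M N (\<lambda>\<omega>. fst (\<omega> n)) = N" for n
    using distr_distr[OF f(1) m[of n]] by (simp add: dM dP o_def)
  have d2: "distr M N (\<lambda>\<omega>. snd (\<omega> n)) = N" for n
    using distr_distr[OF f(2) m[of n]] by (simp add: dM dP o_def)
  have f': "fst \<in> borel_measurable P" "snd \<in> borel_measurable P"
    using f measurable_cong_sets[OF refl sN, of P] by auto
  have mc: "(\<lambda>\<omega>. fst (\<omega> n)) \<in> borel_measurable M" "(\<lambda>\<omega>. snd (\<omega> n)) \<in> borel_measurable M" for n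
    using measurable_compose[OF m f'(1)] measurable_compose[OF m f'(2)] by auto
  have "standard_complex_gaussian M (g n)" for n
  proof -
    have lb: "distr M lborel X = distr M N X" "distr M borel X = distr M N X"
      for X :: "_ \<Rightarrow> real"
      by (rule distr_cong; simp add: sN)+
    have a: "distributed M lborel (\<lambda>\<omega>. fst (\<omega> n)) std_normal_density"
      using mc lb[of "\<lambda>\<omega>. fst (\<omega> n)"] d1[of n] unfolding distributed_def
      by (auto simp: N_def)
    have b: "distributed M lborel (\<lambda>\<omega>. snd (\<omega> n)) std_normal_density"
      using mc lb[of "\<lambda>\<omega>. snd (\<omega> n)"] d2[of n] unfolding distributed_def
      by (auto simp: N_def)
    have da: "distr M borel (\<lambda>\<omega>. fst (\<omega> n)) = N" "distr M borel (\<lambda>\<omega>. snd (\<omega> n)) = N"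
      using d1[of n] d2[of n] by (simp_all add: lb)
    have "sets P = sets (borel \<Otimes>\<^sub>M borel)"
      unfolding P_def by (rule sets_pair_measure_cong) (simp_all add: sN)
    then have "distr M (borel \<Otimes>\<^sub>M borel) (\<lambda>\<omega>. (fst (\<omega> n), snd (\<omega> n))) = P"
      using dM[of n] distr_cong[of M M "borel \<Otimes>\<^sub>M borel" P "\<lambda>\<omega>. (fst (\<omega> n), snd (\<omega> n))" "\<lambda>\<omega>. \<omega> n"]
      by simp
    then have c: "Mp.indep_var borel (\<lambda>\<omega>. fst (\<omega> n)) borel (\<lambda>\<omega>. snd (\<omega> n))"
      by (subst Mp.indep_var_distribution_eq) (simp add: mc da P_def)
    show ?thesis
      using a b c by (simp add: standard_complex_gaussian_def g_def)
  qed
  with 1 pM show ?thesis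
    unfolding iid_complex_gaussians_def by blast
qed

unbundle bcontfun.lifting

lift_definition fourier_partial_sum :: "real \<Rightarrow> (int \<Rightarrow> complex) \<Rightarrow> nat \<Rightarrow> (real \<Rightarrow>\<^sub>C complex)"
  is "\<lambda>s a N x. \<Sum>n\<in>{- int N..int N}.
        a n / complex_of_real (japanese_bracket n powr s) * exp (\<i> * of_int n * of_real x)"
proof -
  fix s :: real and a :: "int \<Rightarrow> complex" and N :: nat
  let ?f = "\<lambda>x::real. \<Sum>n\<in>{- int N..int N}.
        a n / complex_of_real (japanese_bracket n powr s) * exp (\<i> * of_int n * of_real x)"
  let ?B = "\<Sum>n\<in>{- int N..int N}. cmod (a n / complex_of_real (japanese_bracket n powr s))"
  have "continuous_on UNIV ?f"
    by (intro continuous_intros)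
  moreover have "cmod (?f x) \<le> ?B" for x
    by (rule order_trans[OF norm_sum sum_mono])
       (simp add: norm_mult norm_divide norm_exp_eq_Re)
  hence "bounded (range ?f)"
    by (intro boundedI[where B = ?B]) auto
  ultimately show "?f \<in> bcontfun"
    by (simp add: bcontfun_def)
qed

text \<open>
  The sum of the series in \<open>C(\<T>)\<close>, i.e.\ the uniform limit of the symmetric partial sums. The value 0
  is used on the set where they diverge, which is a null set for the random coefficients when
  \<open>s > 1/2\<close>.
\<close>

definition fourier_series :: "real \<Rightarrow> (int \<Rightarrow> complex) \<Rightarrow> (real \<Rightarrow>\<^sub>C complex)" where
  "fourier_series s a =
     (if convergent (fourier_partial_sum s a) then lim (fourier_partial_sum s a) else 0)"

text \<open>The measure \<open>\<mu>\<^sub>s\<close>, for a given realisation \<open>g\<close> of the Gaussian coefficients.\<close>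

definition gaussian_law :: "'w measure \<Rightarrow> (int \<Rightarrow> 'w \<Rightarrow> complex) \<Rightarrow> real \<Rightarrow> (real \<Rightarrow>\<^sub>C complex) measure"
  where "gaussian_law M g s = distr M CT (\<lambda>\<omega>. fourier_series s (\<lambda>n. g n \<omega>))"

text \<open>
  Solutions of \<open>i \<partial>\<^sub>t u = |u|\<^sup>2 u\<close>, global in time, with the equation holding at every point \<open>(t, x)\<close>.
  Periodicity in \<open>x\<close> is inherited from the initial datum, see \<open>dispersionless_flow_periodic\<close>.
\<close>

definition dispersionless_solution ::
  "(real \<Rightarrow>\<^sub>C complex) \<Rightarrow> (real \<Rightarrow> (real \<Rightarrow>\<^sub>C complex)) \<Rightarrow> bool" where
  "dispersionless_solution u\<^sub>0 u \<longleftrightarrow> u 0 = u\<^sub>0 \<and>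
     (\<forall>x t. (\<lambda>\<tau>. u \<tau> x) differentiable (at t) \<and>
        \<i> * vector_derivative (\<lambda>\<tau>. u \<tau> x) (at t) = of_real ((cmod (u t x))\<^sup>2) * u t x)"

definition dispersionless_flow :: "real \<Rightarrow> (real \<Rightarrow>\<^sub>C complex) \<Rightarrow> (real \<Rightarrow>\<^sub>C complex)" where
  "dispersionless_flow t u\<^sub>0 = (THE u. dispersionless_solution u\<^sub>0 u) t"

lift_definition phase_rotation :: "real \<Rightarrow> (real \<Rightarrow>\<^sub>C complex) \<Rightarrow> (real \<Rightarrow>\<^sub>C complex)"
  is "\<lambda>t u x. exp (- \<i> * of_real t * of_real ((cmod (u x))\<^sup>2)) * u x"
proof -
  fix t :: real and u :: "real \<Rightarrow> complex"
  let ?f = "\<lambda>x. exp (- \<i> * of_real t * of_real ((cmod (u x))\<^sup>2)) * u x"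
  assume u: "u \<in> bcontfun"
  then have "continuous_on UNIV ?f"
    by (auto simp: bcontfun_def intro!: continuous_intros)
  moreover have "cmod (?f x) = cmod (u x)" for x
    by (simp add: norm_mult norm_exp_eq_Re)
  hence "bounded (range ?f)"
    using u unfolding bcontfun_def bounded_iff by simp
  ultimately show "?f \<in> bcontfun"
    by (simp add: bcontfun_def)
qed

lemma dispersionless_solution_phase_rotation:
  "dispersionless_solution u\<^sub>0 (\<lambda>t. phase_rotation t u\<^sub>0)"
proof -
  have d: "((\<lambda>\<tau>. phase_rotation \<tau> u\<^sub>0 x) has_vector_derivative
          - \<i> * of_real ((cmod (u\<^sub>0 x))\<^sup>2) * phase_rotation t u\<^sub>0 x) (at t)" for x t
  proof -
    have "((\<lambda>z. exp (- \<i> * z * of_real ((cmod (u\<^sub>0 x))\<^sup>2)) * u\<^sub>0 x) has_field_derivative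
          - \<i> * of_real ((cmod (u\<^sub>0 x))\<^sup>2) * phase_rotation t u\<^sub>0 x) (at (of_real t))"
      by (auto simp: phase_rotation.rep_eq intro!: derivative_eq_intros)
    from has_vector_derivative_real_field[OF this] show ?thesis
      by (simp add: phase_rotation.rep_eq)
  qed
  have n: "cmod (phase_rotation t u\<^sub>0 x) = cmod (u\<^sub>0 x)" for t x
    by (simp add: phase_rotation.rep_eq norm_mult norm_exp_eq_Re)
  have "phase_rotation 0 u\<^sub>0 = u\<^sub>0"
    by (rule bcontfun_eqI) (simp add: phase_rotation.rep_eq)
  then show ?thesis
    unfolding dispersionless_solution_def
    using d by (auto simp: n vector_derivative_at[OF d] mult.assoc[symmetric]
        intro: differentiableI_vector)
qed

lemma dispersionless_solution_unique:
  assumes "dispersionless_solution u\<^sub>0 u"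
  shows "u = (\<lambda>t. phase_rotation t u\<^sub>0)"
proof (intro ext bcontfun_eqI)
  fix t x
  define v where "v = (\<lambda>\<tau>. u \<tau> x)"
  have dv: "(v has_vector_derivative - \<i> * of_real ((cmod (v t))\<^sup>2) * v t) (at t)" for t
  proof -
    have "v differentiable (at t)"
      and e: "\<i> * vector_derivative v (at t) = of_real ((cmod (v t))\<^sup>2) * v t"
      using assms by (auto simp: dispersionless_solution_def v_def)
    then have h: "(v has_vector_derivative vector_derivative v (at t)) (at t)"
      by (simp add: vector_derivative_works)
    have "vector_derivative v (at t) = - \<i> * (\<i> * vector_derivative v (at t))"
      by (simp add: mult.assoc[symmetric])
    then have "vector_derivative v (at t) = - \<i> * of_real ((cmod (v t))\<^sup>2) * v t"
      by (simp only: e mult.assoc)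
    with h show ?thesis by simp
  qed
  have v0: "v 0 = u\<^sub>0 x"
    using assms by (auto simp: dispersionless_solution_def v_def)
  have c: "((\<lambda>t. v t * cnj (v t)) has_vector_derivative 0) (at t)" for t
    by (rule has_vector_derivative_eq_rhs,
        rule has_vector_derivative_mult[OF dv has_vector_derivative_cnj[OF dv]])
       (simp add: algebra_simps)
  obtain k where k: "\<And>t. v t * cnj (v t) = k"
    using has_vector_derivative_zero_constant[of UNIV "\<lambda>t. v t * cnj (v t)"] c by auto
  have "complex_of_real ((cmod (v t))\<^sup>2) = complex_of_real ((cmod (v 0))\<^sup>2)" for t
    by (simp only: complex_norm_square k)
  then have n: "(cmod (v t))\<^sup>2 = (cmod (v 0))\<^sup>2" for t
    using of_real_eq_iff by blast
  define r where "r = (cmod (v 0))\<^sup>2"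
  have nr: "(cmod (v t))\<^sup>2 = r" for t
    unfolding r_def by (rule n)
  have de: "((\<lambda>t. exp (\<i> * of_real t * of_real r)) has_vector_derivative
        \<i> * of_real r * exp (\<i> * of_real t * of_real r)) (at t)" for t
  proof -
    have "((\<lambda>z. exp (\<i> * z * of_real r)) has_field_derivative
        \<i> * of_real r * exp (\<i> * of_real t * of_real r)) (at (of_real t))"
      by (auto intro!: derivative_eq_intros)
    from has_vector_derivative_real_field[OF this] show ?thesis by simp
  qed
  have "((\<lambda>t. exp (\<i> * of_real t * of_real r) * v t) has_vector_derivative 0) (at t)" for t
    by (rule has_vector_derivative_eq_rhs, rule has_vector_derivative_mult[OF de dv])
       (simp add: nr)
  then obtain k' where k': "\<And>t. exp (\<i> * of_real t * of_real r) * v t = k'"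
    using has_vector_derivative_zero_constant[of UNIV "\<lambda>t. exp (\<i> * of_real t * of_real r) * v t"]
    by auto
  have "exp (\<i> * of_real t * of_real r) * v t = v 0"
    using k'[of t] k'[of 0] by simp
  then have "exp (- (\<i> * of_real t * of_real r)) * (exp (\<i> * of_real t * of_real r) * v t)
      = exp (- (\<i> * of_real t * of_real r)) * v 0"
    by simp
  then have "v t = exp (- (\<i> * of_real t * of_real r)) * v 0"
    by (simp add: mult.assoc[symmetric] exp_add[symmetric])
  then show "u t x = phase_rotation t u\<^sub>0 x"
    by (simp add: phase_rotation.rep_eq v0 r_def) (simp add: v_def)
qed

lemma dispersionless_flow_eq: "dispersionless_flow t u\<^sub>0 = phase_rotation t u\<^sub>0"
proof -
  have "(THE u. dispersionless_solution u\<^sub>0 u) = (\<lambda>t. phase_rotation t u\<^sub>0)"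
    by (rule the_equality) (fact dispersionless_solution_phase_rotation,
      rule dispersionless_solution_unique)
  then show ?thesis by (simp add: dispersionless_flow_def)
qed

lemma dispersionless_flow_apply:
  "dispersionless_flow t u\<^sub>0 x = exp (- \<i> * of_real t * of_real ((cmod (u\<^sub>0 x))\<^sup>2)) * u\<^sub>0 x"
  by (simp add: dispersionless_flow_eq phase_rotation.rep_eq)

lemma dispersionless_flow_periodic:
  "u\<^sub>0 \<in> periodic_functions \<Longrightarrow> dispersionless_flow t u\<^sub>0 \<in> periodic_functions"
  by (simp add: periodic_functions_def dispersionless_flow_apply)

text \<open>
  Only meaningful for measurable \<open>T\<close>. Recall that \<open>absolutely_continuous \<mu> \<nu>\<close> means that every
  \<open>\<mu>\<close>-null set is a \<open>\<nu>\<close>-null set.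
\<close>

definition quasi_invariant :: "'a measure \<Rightarrow> ('a \<Rightarrow> 'a) \<Rightarrow> bool" where
  "quasi_invariant \<mu> T \<longleftrightarrow>
     absolutely_continuous \<mu> (distr \<mu> \<mu> T) \<and> absolutely_continuous (distr \<mu> \<mu> T) \<mu>"

end

theory Submission
  imports Defs "HOL-Complex_Analysis.Cauchy_Integral_Formula"
begin

text \<open>
  Near a point the flow acts on the rough part of \<open>u\<close> through its derivative. With \<open>m > s\<close> and
  \<open>h \<rightarrow> 0\<close>, the \<open>m\<close>-th difference of \<open>u\<close> at \<open>0\<close>, normalised by its standard deviation
  (of order \<open>h powr (s - 1/2)\<close>), is a standard complex Gaussian \<open>Y\<close>. Writing \<open>u\<close> as a random
  Taylor polynomial plus a remainder that is \<open>O(h powr \<tau>)\<close> with \<open>2 * \<tau> > s - 1/2\<close> and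
  \<open>1 + \<tau> > s - 1/2\<close>, one finds that the same difference of \<open>exp (- \<i> t |u|\<^sup>2) u\<close> is
  \<open>a Y + b cnj Y + o(1)\<close>, where \<open>(a, b)\<close> is the derivative of the flow at \<open>u(0)\<close>, with
  \<open>|a|\<^sup>2 + |b|\<^sup>2 = 1 + 2 t\<^sup>2 |u(0)|^4\<close>. Along a sparse sequence of scales the \<open>Y\<close> are nearly
  independent, so the averages of \<open>|Y|\<^sup>2\<close> tend to \<open>2\<close> almost surely, while after the flow they
  tend to \<open>2 (1 + 2 t\<^sup>2 |u(0)|^4)\<close>, which differs from \<open>2\<close> unless \<open>u(0) = 0\<close>.
\<close>

section \<open>Linear combinations of complex Gaussians\<close>

text \<open>One-point laws cannot detect the flow: the law of \<open>u(x)\<close> is rotation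
  invariant and the flow rotates \<open>u(x)\<close> by an angle depending only on its modulus.
  Singularity has to be read from fine-scale differences. Since the flow is nonlinear, criteria for
  pairs of Gaussian measures do not apply directly to the image; instead a pathwise limit is
  evaluated before and after the flow. For s > 5/2, expanding around the constant
  \<open>u(0)\<close> would leave a quadratic error of order h^2, larger than the fluctuation h^(s -
  1/2). This is why a Taylor polynomial is split off: the flow of a polynomial is the restriction of
  an entire function to the real line, so its m-th difference is O(h^m). The two conditions on
  \<tau> come from the quadratic error h^(2\<tau>) and from the variation of the derivative of the
  flow between 0 and x, which costs h^(1+\<tau>). The cross term Re (a cnj b Y^2) averages out
  because the Gaussians are circular, E Y^2 = 0. At the end only one fact about \<open>u(0)\<close>
  is required: it is not almost surely 0.\<close>

lemma nn_integral_exp_std_normal: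
  "(\<integral>\<^sup>+x. ennreal (std_normal_density x) * ennreal (exp (a * x)) \<partial>lborel) = ennreal (exp (a\<^sup>2 / 2))"
proof -
  have "ennreal (std_normal_density x) * ennreal (exp (a * x))
      = ennreal (exp (a\<^sup>2 / 2)) * ennreal (normal_density a 1 x)" for x
    by (simp add: ennreal_mult[symmetric] normal_density_def exp_add[symmetric] field_simps power2_eq_square)
  then show ?thesis
    using prob_space.emeasure_space_1[OF prob_space_normal_density[of 1 a]]
    by (simp add: nn_integral_cmult emeasure_density)
qed

lemma borel_measurable_cosh [measurable]: "(cosh :: real \<Rightarrow> real) \<in> borel_measurable borel"
  by (intro borel_measurable_continuous_onI continuous_on_cosh continuous_on_id)

locale complex_gaussian_family = prob_space M
  for M :: "'w measure" and g :: "int \<Rightarrow> 'w \<Rightarrow> complex" +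
  assumes iid: "iid_complex_gaussians M g"
begin

lemma indep_g: "indep_vars (\<lambda>_. borel) g UNIV"
  and gaussian_g: "standard_complex_gaussian M (g n)"
  using iid by (auto simp: iid_complex_gaussians_def)

lemma measurable_g [measurable]: "g n \<in> borel_measurable M"
  using indep_g by (auto simp: indep_vars_def)

lemma distributed_Re: "distributed M lborel (\<lambda>\<omega>. Re (g n \<omega>)) std_normal_density"
  and distributed_Im: "distributed M lborel (\<lambda>\<omega>. Im (g n \<omega>)) std_normal_density"
  and indep_Re_Im: "indep_var borel (\<lambda>\<omega>. Re (g n \<omega>)) borel (\<lambda>\<omega>. Im (g n \<omega>))"
  using gaussian_g[of n] by (auto simp: standard_complex_gaussian_def)

text \<open>Re (c g) = Re c Re g - Im c Im g is a sum of two independent centred Gaussians of total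
  variance |c|^2, so only the modulus of \<open>c\<close> enters.\<close>

lemma nn_integral_exp_Re_mult:
  "(\<integral>\<^sup>+\<omega>. ennreal (exp (Re (c * g n \<omega>))) \<partial>M) = ennreal (exp ((cmod c)\<^sup>2 / 2))"
proof -
  \<comment> \<open>\<open>indep_var\<close> is independence of a family indexed by
    \<open>bool\<close>; arranging the two factors of the exponential in this way lets the product
    formula for nonnegative integrals be applied over \<open>UNIV\<close>.\<close>
  define X where "X b = (if b then (\<lambda>\<omega>. ennreal (exp (Re c * Re (g n \<omega>))))
    else (\<lambda>\<omega>. ennreal (exp (- Im c * Im (g n \<omega>)))))" for b
  have bb: "case_bool borel borel = (\<lambda>_. borel)"
    by (auto simp: fun_eq_iff split: bool.split)
  have "indep_vars (\<lambda>_. borel) X UNIV"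
  proof -
    have "indep_vars (\<lambda>_. borel) (case_bool (\<lambda>\<omega>. Re (g n \<omega>)) (\<lambda>\<omega>. Im (g n \<omega>))) UNIV"
      using indep_Re_Im[of n] by (simp add: indep_var_def bb)
    from indep_vars_compose2[OF this, where N = "\<lambda>_. borel" and
        Y = "\<lambda>b x. if b then ennreal (exp (Re c * x)) else ennreal (exp (- Im c * x))"]
    have "indep_vars (\<lambda>_. borel) (\<lambda>b \<omega>. if b then ennreal (exp (Re c * case_bool (\<lambda>\<omega>. Re (g n \<omega>)) (\<lambda>\<omega>. Im (g n \<omega>)) b \<omega>))
       else ennreal (exp (- Im c * case_bool (\<lambda>\<omega>. Re (g n \<omega>)) (\<lambda>\<omega>. Im (g n \<omega>)) b \<omega>))) UNIV"
      by auto
    then show ?thesis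
      by (rule indep_vars_cong[THEN iffD1, rotated -1]) (auto simp: X_def fun_eq_iff split: bool.split)
  qed
  from indep_vars_nn_integral[OF _ this]
  have "(\<integral>\<^sup>+\<omega>. (\<Prod>b\<in>UNIV. X b \<omega>) \<partial>M) = (\<Prod>b\<in>UNIV. \<integral>\<^sup>+\<omega>. X b \<omega> \<partial>M)" by simp
  then have "(\<integral>\<^sup>+\<omega>. ennreal (exp (Re c * Re (g n \<omega>))) * ennreal (exp (- Im c * Im (g n \<omega>))) \<partial>M)
     = (\<integral>\<^sup>+\<omega>. ennreal (exp (Re c * Re (g n \<omega>))) \<partial>M) * (\<integral>\<^sup>+\<omega>. ennreal (exp (- Im c * Im (g n \<omega>))) \<partial>M)"
    by (simp add: UNIV_bool X_def mult.commute)
  also have "(\<integral>\<^sup>+\<omega>. ennreal (exp (Re c * Re (g n \<omega>))) \<partial>M) = ennreal (exp ((Re c)\<^sup>2 / 2))"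
    using distributed_nn_integral[OF distributed_Re[of n], of "\<lambda>x. ennreal (exp (Re c * x))"]
    by (simp add: nn_integral_exp_std_normal)
  also have "(\<integral>\<^sup>+\<omega>. ennreal (exp (- Im c * Im (g n \<omega>))) \<partial>M) = ennreal (exp ((Im c)\<^sup>2 / 2))"
    using distributed_nn_integral[OF distributed_Im[of n], of "\<lambda>x. ennreal (exp (- Im c * x))"]
      nn_integral_exp_std_normal[of "- Im c"]
    by simp
  finally show ?thesis
    by (simp add: ennreal_mult[symmetric] exp_add[symmetric] cmod_power2 add_divide_distrib)
qed

lemma nn_integral_exp_Re_sum:
  assumes "finite I"
  shows "(\<integral>\<^sup>+\<omega>. ennreal (exp (Re (\<Sum>n\<in>I. c n * g n \<omega>))) \<partial>M) = ennreal (exp ((\<Sum>n\<in>I. (cmod (c n))\<^sup>2) / 2))"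
proof -
  have "indep_vars (\<lambda>_. borel) (\<lambda>n \<omega>. ennreal (exp (Re (c n * g n \<omega>)))) I"
    by (rule indep_vars_compose2[OF indep_vars_subset[OF indep_g subset_UNIV]]) simp
  from indep_vars_nn_integral[OF assms this]
  have "(\<integral>\<^sup>+\<omega>. (\<Prod>n\<in>I. ennreal (exp (Re (c n * g n \<omega>)))) \<partial>M)
      = (\<Prod>n\<in>I. ennreal (exp ((cmod (c n))\<^sup>2 / 2)))"
    by (simp only: nn_integral_exp_Re_mult zero_le)
  then show ?thesis
    using assms by (simp add: prod_ennreal exp_sum[symmetric] sum_divide_distrib del: Re_sum)
       (simp add: exp_sum)
qed

text \<open>The case n = m of E (g_n g_m) = 0 is circularity: real and imaginary parts are
  uncorrelated and have equal variance. It is the source of E Y^2 = 0 for every linear combination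
  Y.\<close>

lemma integrable_g: "integrable M (g n)" and integral_g: "(\<integral>\<omega>. g n \<omega> \<partial>M) = 0"
  and integrable_g_mult: "integrable M (\<lambda>\<omega>. g n \<omega> * g m \<omega>)"
  and integral_g_mult: "(\<integral>\<omega>. g n \<omega> * g m \<omega> \<partial>M) = 0"
  and integrable_g_cnj: "integrable M (\<lambda>\<omega>. g n \<omega> * cnj (g m \<omega>))"
  and integral_g_cnj: "(\<integral>\<omega>. g n \<omega> * cnj (g m \<omega>) \<partial>M) = (if n = m then 2 else 0)"
proof -
  have iR: "integrable M (\<lambda>\<omega>. Re (g n \<omega>) ^ k)" and iI: "integrable M (\<lambda>\<omega>. Im (g n \<omega>) ^ k)" for n k
    using distributed_integrable[OF distributed_Re[of n], of "\<lambda>x. x ^ k"]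
      distributed_integrable[OF distributed_Im[of n], of "\<lambda>x. x ^ k"]
      integrable_std_normal_moment[of k] by auto
  have eR: "(\<integral>\<omega>. Re (g n \<omega>) ^ k \<partial>M) = integral\<^sup>L lborel (\<lambda>x. std_normal_density x * x ^ k)"
    and eI: "(\<integral>\<omega>. Im (g n \<omega>) ^ k \<partial>M) = integral\<^sup>L lborel (\<lambda>x. std_normal_density x * x ^ k)" for n k
    using distributed_integral[OF distributed_Re[of n], of "\<lambda>x. x ^ k"]
      distributed_integral[OF distributed_Im[of n], of "\<lambda>x. x ^ k"] by auto
  have e1: "(\<integral>\<omega>. Re (g n \<omega>) \<partial>M) = 0" "(\<integral>\<omega>. Im (g n \<omega>) \<partial>M) = 0" for n
    using eR[of n 1] eI[of n 1] integral_std_normal_moment_odd[of 0] by auto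
  have e2: "(\<integral>\<omega>. (Re (g n \<omega>))\<^sup>2 \<partial>M) = 1" "(\<integral>\<omega>. (Im (g n \<omega>))\<^sup>2 \<partial>M) = 1" for n
    using eR[of n 2] eI[of n 2] integral_std_normal_moment_even[of 1] by auto
  have i1: "integrable M (\<lambda>\<omega>. Re (g n \<omega>))" "integrable M (\<lambda>\<omega>. Im (g n \<omega>))" for n
    using iR[of n 1] iI[of n 1] by auto
  note i2 = iR[of _ 2] iI[of _ 2]
  have i3: "integrable M (\<lambda>\<omega>. Re (g n \<omega>) * Im (g n \<omega>))" for n
    by (rule indep_var_integrable[OF indep_Re_Im i1])
  have e3: "(\<integral>\<omega>. Re (g n \<omega>) * Im (g n \<omega>) \<partial>M) = 0" for n
    by (subst indep_var_lebesgue_integral[OF indep_Re_Im i1]) (simp add: e1)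
  have eq: "g n = (\<lambda>\<omega>. complex_of_real (Re (g n \<omega>)) + \<i> * complex_of_real (Im (g n \<omega>)))" for n
    by (auto simp: fun_eq_iff complex_eq_iff)
  show ig: "integrable M (g n)" for n
    by (subst eq) (intro Bochner_Integration.integrable_add integrable_mult_right integrable_of_real i1)
  show eg: "(\<integral>\<omega>. g n \<omega> \<partial>M) = 0" for n
    by (subst eq, subst Bochner_Integration.integral_add) (auto simp: i1 e1)
  have sq: "(\<lambda>\<omega>. g n \<omega> * g n \<omega>) = (\<lambda>\<omega>. complex_of_real ((Re (g n \<omega>))\<^sup>2 - (Im (g n \<omega>))\<^sup>2)
       + 2 * \<i> * complex_of_real (Re (g n \<omega>) * Im (g n \<omega>)))" for n
    by (auto simp: fun_eq_iff complex_eq_iff power2_eq_square)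
  have ab: "(\<lambda>\<omega>. g n \<omega> * cnj (g n \<omega>)) = (\<lambda>\<omega>. complex_of_real ((Re (g n \<omega>))\<^sup>2 + (Im (g n \<omega>))\<^sup>2))" for n
    by (auto simp: fun_eq_iff complex_eq_iff power2_eq_square)
  have prs: "indep_var borel (g n) borel (g m)" if "n \<noteq> m" for n m
    using indep_var_compose[OF indep_var_restrict[OF indep_g, of "{n}" "{m}"],
        of "\<lambda>f. f n" borel "\<lambda>f. f m" borel] that
    by (simp add: comp_def)
  have prc: "indep_var borel (g n) borel (\<lambda>\<omega>. cnj (g m \<omega>))" if "n \<noteq> m" for n m
    using indep_var_compose[OF prs[OF that], of "\<lambda>x. x" borel cnj borel]
      borel_measurable_continuous_onI[OF continuous_on_cnj[OF continuous_on_id]]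
    by (simp add: comp_def)
  have icg: "integrable M (\<lambda>\<omega>. cnj (g n \<omega>))" "(\<integral>\<omega>. cnj (g n \<omega>) \<partial>M) = 0" for n
    by (simp_all add: ig eg)
  show "integrable M (\<lambda>\<omega>. g n \<omega> * g m \<omega>)"
    by (cases "n = m") (auto simp del: of_real_mult of_real_diff simp: sq i3 i2 intro: indep_var_integrable[OF prs ig ig])
  show "(\<integral>\<omega>. g n \<omega> * g m \<omega> \<partial>M) = 0"
  proof (cases "n = m")
    case True
    then show ?thesis
      by (simp add: sq del: of_real_mult of_real_diff, subst Bochner_Integration.integral_add)
         (auto simp: i3 i2 e3 e2 simp del: of_real_mult of_real_diff)
  next
    case False
    then show ?thesis by (simp add: indep_var_lebesgue_integral[OF prs ig ig] eg)
  qed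
  show "integrable M (\<lambda>\<omega>. g n \<omega> * cnj (g m \<omega>))"
    by (cases "n = m") (auto simp del: of_real_add simp: ab i2 intro: indep_var_integrable[OF prc ig icg(1)])
  show "(\<integral>\<omega>. g n \<omega> * cnj (g m \<omega>) \<partial>M) = (if n = m then 2 else 0)"
  proof (cases "n = m")
    case True
    then show ?thesis
      by (simp add: ab i2 e2 del: of_real_add)
  next
    case False
    then show ?thesis by (simp add: indep_var_lebesgue_integral[OF prc ig icg(1)] eg)
  qed
qed

lemma integrable_norm_sum: "integrable M (\<lambda>\<omega>. (cmod (\<Sum>n\<in>I. c n * g n \<omega>))\<^sup>2)"
  and integral_norm_sum:
    "finite I \<Longrightarrow> (\<integral>\<omega>. (cmod (\<Sum>n\<in>I. c n * g n \<omega>))\<^sup>2 \<partial>M) = 2 * (\<Sum>n\<in>I. (cmod (c n))\<^sup>2)"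
  and integrable_sum_square: "integrable M (\<lambda>\<omega>. (\<Sum>n\<in>I. c n * g n \<omega>)\<^sup>2)"
  and integral_sum_square: "(\<integral>\<omega>. (\<Sum>n\<in>I. c n * g n \<omega>)\<^sup>2 \<partial>M) = 0"
proof -
  have e: "complex_of_real ((cmod (\<Sum>n\<in>I. c n * g n \<omega>))\<^sup>2)
      = (\<Sum>n\<in>I. \<Sum>m\<in>I. c n * cnj (c m) * (g n \<omega> * cnj (g m \<omega>)))" for \<omega>
    unfolding complex_norm_square cnj_sum sum_product by (simp add: mult_ac)
  have i: "integrable M (\<lambda>\<omega>. complex_of_real ((cmod (\<Sum>n\<in>I. c n * g n \<omega>))\<^sup>2))"
    unfolding e by (intro Bochner_Integration.integrable_sum integrable_mult_right integrable_g_cnj)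
  then show "integrable M (\<lambda>\<omega>. (cmod (\<Sum>n\<in>I. c n * g n \<omega>))\<^sup>2)"
    using integrable_Re[OF i] by simp
  show "(\<integral>\<omega>. (cmod (\<Sum>n\<in>I. c n * g n \<omega>))\<^sup>2 \<partial>M) = 2 * (\<Sum>n\<in>I. (cmod (c n))\<^sup>2)" if "finite I"
  proof -
    have "complex_of_real (\<integral>\<omega>. (cmod (\<Sum>n\<in>I. c n * g n \<omega>))\<^sup>2 \<partial>M)
       = (\<integral>\<omega>. complex_of_real ((cmod (\<Sum>n\<in>I. c n * g n \<omega>))\<^sup>2) \<partial>M)"
      by (rule integral_complex_of_real[symmetric])
    also have "\<dots> = (\<Sum>n\<in>I. \<Sum>m\<in>I. c n * cnj (c m) * (if n = m then 2 else 0))"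
      unfolding e by (simp add: Bochner_Integration.integral_sum integrable_g_cnj integral_g_cnj)
    also have "\<dots> = (\<Sum>n\<in>I. c n * cnj (c n) * 2)"
      using that by (simp add: if_distrib[of "\<lambda>x. _ * x"] cong: if_cong)
    also have "\<dots> = complex_of_real (2 * (\<Sum>n\<in>I. (cmod (c n))\<^sup>2))"
      by (simp add: complex_norm_square sum_distrib_left mult_ac del: of_real_power)
    finally show ?thesis by (simp only: of_real_eq_iff)
  qed
  have e: "(\<Sum>n\<in>I. c n * g n \<omega>)\<^sup>2 = (\<Sum>n\<in>I. \<Sum>m\<in>I. c n * c m * (g n \<omega> * g m \<omega>))" for \<omega>
    unfolding power2_eq_square sum_product by (simp add: mult_ac)
  show "integrable M (\<lambda>\<omega>. (\<Sum>n\<in>I. c n * g n \<omega>)\<^sup>2)"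
    unfolding e by (intro Bochner_Integration.integrable_sum integrable_mult_right integrable_g_mult)
  show "(\<integral>\<omega>. (\<Sum>n\<in>I. c n * g n \<omega>)\<^sup>2 \<partial>M) = 0"
    unfolding e by (simp add: Bochner_Integration.integral_sum integrable_g_mult integral_g_mult)
qed

lemma nn_integral_norm_sum:
  "finite I \<Longrightarrow> (\<integral>\<^sup>+\<omega>. ennreal ((cmod (\<Sum>n\<in>I. c n * g n \<omega>))\<^sup>2) \<partial>M) = ennreal (2 * (\<Sum>n\<in>I. (cmod (c n))\<^sup>2))"
  by (simp add: nn_integral_eq_integral[OF integrable_norm_sum] integral_norm_sum)

text \<open>Fatou's lemma carries a uniform second-moment bound from the partial sums to their
  almost sure limit; the factor 2 is E |g_n|^2. Both the Taylor remainder and the part of a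
  difference outside a frequency block are estimated in this way.\<close>

lemma nn_integral_norm_limit_le:
  assumes "AE \<omega> in M. (\<lambda>N. \<Sum>n\<in>I N. c n * g n \<omega>) \<longlonglongrightarrow> X \<omega>"
    and "\<And>N. finite (I N)" and "\<And>N. (\<Sum>n\<in>I N. (cmod (c n))\<^sup>2) \<le> B"
  shows "(\<integral>\<^sup>+\<omega>. ennreal ((cmod (X \<omega>))\<^sup>2) \<partial>M) \<le> ennreal (2 * B)"
proof -
  have "(\<integral>\<^sup>+\<omega>. ennreal ((cmod (X \<omega>))\<^sup>2) \<partial>M)
      \<le> (\<integral>\<^sup>+\<omega>. liminf (\<lambda>N. ennreal ((cmod (\<Sum>n\<in>I N. c n * g n \<omega>))\<^sup>2)) \<partial>M)"
    using assms(1)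
  proof (intro nn_integral_mono_AE, eventually_elim)
    case (elim \<omega>)
    then have "(\<lambda>N. ennreal ((cmod (\<Sum>n\<in>I N. c n * g n \<omega>))\<^sup>2)) \<longlonglongrightarrow> ennreal ((cmod (X \<omega>))\<^sup>2)"
      by (intro tendsto_ennrealI tendsto_intros)
    then show ?case
      using lim_imp_Liminf[OF sequentially_bot] eq_refl by metis
  qed
  also have "\<dots> \<le> liminf (\<lambda>N. \<integral>\<^sup>+\<omega>. ennreal ((cmod (\<Sum>n\<in>I N. c n * g n \<omega>))\<^sup>2) \<partial>M)"
    by (rule nn_integral_liminf) measurable
  also have "\<dots> \<le> ennreal (2 * B)"
    by (intro Liminf_le eventually_sequentiallyI[of 0])
       (use assms in \<open>auto simp: nn_integral_norm_sum intro!: ennreal_leI\<close>)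
  finally show ?thesis .
qed

text \<open>Averaging the exponential moments of the sum and of its negative. Since cosh dominates
  both half exponentials, this one bound controls both tails, and later also the fourth
  moments.\<close>

lemma nn_integral_cosh_Re_le:
  assumes "finite I" "(\<Sum>n\<in>I. (cmod (c n))\<^sup>2) \<le> v"
  shows "(\<integral>\<^sup>+\<omega>. ennreal (cosh (Re (\<Sum>n\<in>I. c n * g n \<omega>))) \<partial>M) \<le> ennreal (exp (v / 2))"
proof -
  let ?S = "\<lambda>c \<omega>. \<Sum>n\<in>I. c n * g n \<omega>"
  have half: "ennreal (1/2) * (ennreal a + ennreal b) = ennreal ((a + b) / 2)" if "0 \<le> a" "0 \<le> b" for a b
    using that by (simp only: ennreal_plus[symmetric] ennreal_mult'[symmetric]) simp
  have cosh_eq: "ennreal (cosh y) = ennreal (1/2) * (ennreal (exp y) + ennreal (exp (- y)))" for y :: real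
    by (subst half) (simp_all add: cosh_field_def)
  have "(\<integral>\<^sup>+\<omega>. ennreal (cosh (Re (?S c \<omega>))) \<partial>M)
     = (\<integral>\<^sup>+\<omega>. ennreal (1/2) * (ennreal (exp (Re (?S c \<omega>))) + ennreal (exp (Re (?S (\<lambda>n. - c n) \<omega>)))) \<partial>M)"
    by (simp add: cosh_eq sum_negf del: Re_sum)
  also have "\<dots> = ennreal (1/2) * (ennreal (exp ((\<Sum>n\<in>I. (cmod (c n))\<^sup>2) / 2)) + ennreal (exp ((\<Sum>n\<in>I. (cmod (c n))\<^sup>2) / 2)))"
    using nn_integral_exp_Re_sum[OF assms(1), of c] nn_integral_exp_Re_sum[OF assms(1), of "\<lambda>n. - c n"]
    by (simp add: nn_integral_cmult nn_integral_add del: Re_sum)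
  also have "\<dots> = ennreal (exp ((\<Sum>n\<in>I. (cmod (c n))\<^sup>2) / 2))"
    by (subst half) simp_all
  also have "\<dots> \<le> ennreal (exp (v / 2))"
    using assms(2) by (intro ennreal_leI) simp
  finally show ?thesis .
qed

end

section \<open>Uniform convergence of random Fourier series\<close>

lemma japanese_bracket_ge_1: "1 \<le> japanese_bracket n"
  unfolding japanese_bracket_def by (rule ge_one_powr_ge_zero) auto

lemma japanese_bracket_sqrt: "japanese_bracket n = sqrt (1 + (real_of_int n)\<^sup>2)"
  unfolding japanese_bracket_def by (simp add: powr_half_sqrt)

lemma japanese_bracket_ge_abs: "\<bar>real_of_int n\<bar> \<le> japanese_bracket n"
  unfolding japanese_bracket_sqrt by (rule real_le_rsqrt) simp

lemma japanese_bracket_le: "japanese_bracket n \<le> 1 + \<bar>real_of_int n\<bar>"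
  unfolding japanese_bracket_sqrt by (rule real_le_lsqrt) (auto simp: power2_sum)

lemma japanese_bracket_pos [simp]: "0 < japanese_bracket n"
  using japanese_bracket_ge_1[of n] by linarith

lemma japanese_bracket_neq_0 [simp]: "japanese_bracket n \<noteq> 0"
  using japanese_bracket_pos[of n] by linarith

lemma japanese_bracket_minus [simp]: "japanese_bracket (- n) = japanese_bracket n"
  by (simp add: japanese_bracket_def)

lemma japanese_bracket_mono: "\<bar>n\<bar> \<le> \<bar>m\<bar> \<Longrightarrow> japanese_bracket n \<le> japanese_bracket m"
  unfolding japanese_bracket_sqrt by (simp add: abs_le_square_iff[symmetric] flip: of_int_abs)

lemma sum_symmetric_Suc:
  fixes f :: "int \<Rightarrow> 'a :: comm_monoid_add"
  shows "(\<Sum>n\<in>{- int (Suc N)..int (Suc N)}. f n)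
    = (\<Sum>n\<in>{- int N..int N}. f n) + (f (int (Suc N)) + f (- int (Suc N)))"
proof -
  have "{- int (Suc N)..int (Suc N)} = insert (int (Suc N)) (insert (- int (Suc N)) {- int N..int N})"
    by auto
  then show ?thesis by (simp add: add_ac)
qed

lemma finite_int_subset_symmetric:
  assumes "finite (I :: int set)"
  shows "\<exists>N. I \<subseteq> {- int N..int N}"
proof -
  obtain N where "\<And>n. n \<in> (\<lambda>n. nat \<bar>n\<bar>) ` I \<Longrightarrow> n \<le> N"
    using assms finite_nat_set_iff_bounded_le[of "(\<lambda>n. nat \<bar>n\<bar>) ` I"] by auto
  then have "I \<subseteq> {- int N..int N}"
    by force
  then show ?thesis by blast
qed

lemma summable_on_japanese_bracket:
  assumes "1 < p"
  shows "(\<lambda>n. japanese_bracket n powr (- p)) summable_on UNIV"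
proof -
  have s: "summable (\<lambda>n. real n powr (- p))"
    using assms by (simp add: summable_real_powr_iff)
  let ?B = "1 + 2 * (\<Sum>n. real n powr (- p))"
  have le: "japanese_bracket n powr (- p) \<le> real (nat \<bar>n\<bar>) powr (- p)" if "n \<noteq> 0" for n
    using japanese_bracket_ge_abs[of n] that assms by (intro powr_mono2') auto
  have "(\<Sum>n\<in>{- int N..int N}. japanese_bracket n powr (- p))
      \<le> 1 + 2 * (\<Sum>n\<in>{..N}. real n powr (- p))" for N
  proof (induction N)
    case 0
    then show ?case by (simp add: japanese_bracket_def)
  next
    case (Suc N)
    then show ?case
      using le[of "int (Suc N)"] unfolding sum_symmetric_Suc japanese_bracket_minus by auto
  qed
  moreover have "(\<Sum>n\<in>{..N}. real n powr (- p)) \<le> (\<Sum>n. real n powr (- p))" for N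
    by (rule sum_le_suminf[OF s]) auto
  ultimately have bound: "(\<Sum>n\<in>{- int N..int N}. japanese_bracket n powr (- p)) \<le> ?B" for N
    by (rule order_trans[OF _ add_left_mono[OF mult_left_mono]]) auto
  show ?thesis
  proof (rule nonneg_bdd_above_summable_on)
    show "bdd_above (sum (\<lambda>n. japanese_bracket n powr (- p)) ` {F. F \<subseteq> UNIV \<and> finite F})"
    proof (rule bdd_aboveI2[where M = ?B], safe)
      fix F :: "int set" assume "finite F"
      then obtain N where "F \<subseteq> {- int N..int N}" using finite_int_subset_symmetric by blast
      then have "sum (\<lambda>n. japanese_bracket n powr (- p)) F
          \<le> (\<Sum>n\<in>{- int N..int N}. japanese_bracket n powr (- p))"
        by (intro sum_mono2) auto
      with bound[of N] show "sum (\<lambda>n. japanese_bracket n powr (- p)) F \<le> ?B" by linarith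
    qed
  qed simp
qed

section \<open>Reduction of a supremum over the circle to a finite grid\<close>

lemma norm_exp_i_diff_le: "cmod (exp (\<i> * of_int n * of_real x) - exp (\<i> * of_int n * of_real y)) \<le> \<bar>real_of_int n\<bar> * \<bar>x - y\<bar>"
proof -
  have "exp (\<i> * of_int n * of_real x) = exp (\<i> * of_int n * of_real y) * exp (\<i> * of_real (of_int n * (x - y)))"
    unfolding exp_add[symmetric] by (rule arg_cong[where f = exp]) (simp add: algebra_simps)
  then have "exp (\<i> * of_int n * of_real x) - exp (\<i> * of_int n * of_real y)
      = exp (\<i> * of_int n * of_real y) * (exp (\<i> * of_real (of_int n * (x - y))) - 1)"
    by (simp add: algebra_simps)
  then have "cmod (exp (\<i> * of_int n * of_real x) - exp (\<i> * of_int n * of_real y))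
      = cmod (exp (\<i> * of_real (of_int n * (x - y))) - 1)"
    by (simp add: norm_mult norm_exp_eq_Re)
  also have "\<dots> \<le> \<bar>of_int n * (x - y)\<bar>"
    using iexp_approx1[of "of_int n * (x - y)" 0] by simp
  finally show ?thesis by (simp add: abs_mult)
qed

lemma exp_i_periodic: "exp (\<i> * of_int n * of_real (x + 2 * pi * of_int k)) = exp (\<i> * of_int n * of_real x)"
proof -
  have "exp (2 * of_int (n * k) * of_real pi * \<i>) = (1 :: complex)"
    using exp_integer_2pi[of "of_int (n * k)"] by (simp add: mult_ac)
  moreover have "exp (\<i> * of_int n * of_real (x + 2 * pi * of_int k))
      = exp (\<i> * of_int n * of_real x) * exp (2 * of_int (n * k) * of_real pi * \<i>)"
    unfolding exp_add[symmetric] by (rule arg_cong[where f = exp]) (simp add: algebra_simps)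
  ultimately show ?thesis by simp
qed

text \<open>By periodicity x may be moved into [0, 2 pi), and rounding down to the grid then moves
  it by at most 2 pi / G, which changes the n-th exponential by at most |n| times that. A maximum
  over finitely many points can be handled by summing exponential moments, a supremum over the
  circle cannot.\<close>

lemma trig_sum_grid:
  assumes "0 < (G :: nat)" "finite I"
  shows "\<exists>j<G. cmod (\<Sum>n\<in>I. b n * exp (\<i> * of_int n * of_real x))
    \<le> cmod (\<Sum>n\<in>I. b n * exp (\<i> * of_int n * of_real (2 * pi * real j / real G)))
      + 2 * pi / real G * (\<Sum>n\<in>I. \<bar>real_of_int n\<bar> * cmod (b n))"
proof -
  have pi2: "0 < 2 * pi" by simp
  define x' where "x' = x - 2 * pi * of_int \<lfloor>x / (2 * pi)\<rfloor>"
  have x': "0 \<le> x'" "x' < 2 * pi"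
  proof -
    have "of_int \<lfloor>x / (2 * pi)\<rfloor> \<le> x / (2 * pi)" "x / (2 * pi) < of_int \<lfloor>x / (2 * pi)\<rfloor> + 1"
      by linarith+
    then have "of_int \<lfloor>x / (2 * pi)\<rfloor> * (2 * pi) \<le> x" "x < (of_int \<lfloor>x / (2 * pi)\<rfloor> + 1) * (2 * pi)"
      by (simp_all only: pos_le_divide_eq pos_divide_less_eq pi2)
    then show "0 \<le> x'" "x' < 2 * pi" by (auto simp: x'_def algebra_simps)
  qed
  have ex: "exp (\<i> * of_int n * of_real x) = exp (\<i> * of_int n * of_real x')" for n
    using exp_i_periodic[of n x' "\<lfloor>x / (2 * pi)\<rfloor>"] by (simp add: x'_def)
  define j where "j = nat \<lfloor>x' * G / (2 * pi)\<rfloor>"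
  have j: "real j \<le> x' * G / (2 * pi)" "x' * G / (2 * pi) < real j + 1"
    using x' by (auto simp: j_def)
  have "x' * G / (2 * pi) < G" using x' assms(1) by (simp add: field_simps)
  with j have "j < G" by linarith
  have d: "\<bar>x' - 2 * pi * real j / real G\<bar> \<le> 2 * pi / G"
  proof -
    have "x' - 2 * pi * real j / real G = (2 * pi / G) * (x' * G / (2 * pi) - real j)"
      using assms(1) by (simp add: field_simps)
    moreover have "\<bar>x' * G / (2 * pi) - real j\<bar> \<le> 1" using j by linarith
    ultimately show ?thesis
      using mult_left_mono[of "\<bar>x' * G / (2 * pi) - real j\<bar>" 1 "2 * pi / G"] by (simp add: abs_mult)
  qed
  have "cmod (\<Sum>n\<in>I. b n * (exp (\<i> * of_int n * of_real x') - exp (\<i> * of_int n * of_real (2 * pi * real j / real G))))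
    \<le> (\<Sum>n\<in>I. cmod (b n) * (\<bar>real_of_int n\<bar> * (2 * pi / G)))"
    unfolding norm_mult[symmetric]
    by (intro sum_norm_le order_trans[OF norm_mult_ineq] mult_left_mono order_trans[OF norm_exp_i_diff_le] d) auto
  also have "\<dots> = 2 * pi / real G * (\<Sum>n\<in>I. \<bar>real_of_int n\<bar> * cmod (b n))"
    by (simp add: sum_distrib_left mult_ac)
  finally have le: "cmod (\<Sum>n\<in>I. b n * (exp (\<i> * of_int n * of_real x') - exp (\<i> * of_int n * of_real (2 * pi * real j / real G))))
    \<le> \<dots>" .
  have "cmod (\<Sum>n\<in>I. b n * exp (\<i> * of_int n * of_real x))
    \<le> cmod (\<Sum>n\<in>I. b n * exp (\<i> * of_int n * of_real (2 * pi * real j / real G)))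
      + cmod (\<Sum>n\<in>I. b n * (exp (\<i> * of_int n * of_real x') - exp (\<i> * of_int n * of_real (2 * pi * real j / real G))))"
    unfolding ex right_diff_distrib sum_subtractf by (rule norm_triangle_sub)
  note order_trans[OF this add_left_mono[OF le]]
  then show ?thesis using \<open>j < G\<close> by (intro exI[of _ j] conjI)
qed

text \<open>Summation by parts against the weights y^2. Partial sums may grow like 1 / y, because
  the boundary term is then at most K y N, and the k-th remaining term is at most K (y k^2 - y
  (k+1)^2) / y k, which telescopes up to a factor 2.\<close>

lemma Abel_uniformly_convergent:
  fixes a :: "nat \<Rightarrow> 'a \<Rightarrow> complex" and y :: "nat \<Rightarrow> real"
  assumes bound: "\<And>N x. x \<in> A \<Longrightarrow> cmod (\<Sum>k\<le>N. a k x) \<le> K / y N"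
    and y: "\<And>k. 0 < y k" "decseq y" "y \<longlonglongrightarrow> 0"
  shows "uniformly_convergent_on A (\<lambda>N x. \<Sum>k\<le>N. of_real ((y k)\<^sup>2) * a k x)"
proof -
  define W where "W N x = (\<Sum>k\<le>N. a k x)" for N x
  have Abel: "(\<Sum>k\<le>N. of_real ((y k)\<^sup>2) * a k x)
      = of_real ((y N)\<^sup>2) * W N x + (\<Sum>k<N. of_real ((y k)\<^sup>2 - (y (Suc k))\<^sup>2) * W k x)" for N x
  proof (induction N)
    case (Suc N)
    then show ?case by (simp add: W_def algebra_simps)
  qed (simp add: W_def)
  have "uniform_limit A (\<lambda>N x. of_real ((y N)\<^sup>2) * W N x) (\<lambda>_. 0) sequentially"
  proof (rule uniform_limitI)
    fix e :: real assume e: "0 < e"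
    have "(\<lambda>N. K * y N) \<longlonglongrightarrow> K * 0" by (intro tendsto_intros y)
    then have "\<forall>\<^sub>F N in sequentially. K * y N < e" using e by (auto dest: order_tendstoD)
    then show "\<forall>\<^sub>F N in sequentially. \<forall>x\<in>A. dist (of_real ((y N)\<^sup>2) * W N x) 0 < e"
    proof eventually_elim
      case (elim N)
      show ?case
      proof
        fix x assume "x \<in> A"
        have "cmod (of_real ((y N)\<^sup>2) * W N x) = (y N)\<^sup>2 * cmod (W N x)"
          by (simp add: norm_mult norm_power)
        also have "\<dots> \<le> (y N)\<^sup>2 * (K / y N)"
          unfolding W_def by (intro mult_left_mono bound \<open>x \<in> A\<close>) simp
        also have "\<dots> = K * y N" using y(1)[of N] by (simp add: power2_eq_square)
        finally show "dist (of_real ((y N)\<^sup>2) * W N x) 0 < e" using elim by (simp add: dist_norm)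
      qed
    qed
  qed
  then have 1: "uniformly_convergent_on A (\<lambda>N x. of_real ((y N)\<^sup>2) * W N x)"
    by (rule uniformly_convergentI)
  have "uniformly_convergent_on A (\<lambda>N x. \<Sum>k<N. of_real ((y k)\<^sup>2 - (y (Suc k))\<^sup>2) * W k x)"
  proof (cases "A = {}")
    case False
    then obtain x0 where "x0 \<in> A" by auto
    then have "0 \<le> K / y 0" using bound[of x0 0] norm_ge_zero order_trans by blast
    then have K: "0 \<le> K" using y(1)[of 0] by (simp add: zero_le_divide_iff)
    show ?thesis
    proof (rule Weierstrass_m_test')
      fix k x assume "x \<in> A"
      have le: "y (Suc k) \<le> y k" using y(2) by (simp add: decseq_Suc_iff)
      have nn: "0 \<le> (y k)\<^sup>2 - (y (Suc k))\<^sup>2" using le y(1) by (simp add: power_mono less_imp_le)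
      then have "cmod (of_real ((y k)\<^sup>2 - (y (Suc k))\<^sup>2) * W k x) = ((y k)\<^sup>2 - (y (Suc k))\<^sup>2) * cmod (W k x)"
        unfolding norm_mult norm_of_real by simp
      also have "\<dots> \<le> ((y k)\<^sup>2 - (y (Suc k))\<^sup>2) * (K / y k)"
        unfolding W_def by (intro mult_left_mono bound \<open>x \<in> A\<close> nn)
      \<comment> \<open>The last factor is at most 2 since \<open>y\<close> decreases; what is left
        is a telescoping series.\<close>
      also have "\<dots> = K * (y k - y (Suc k)) * ((y k + y (Suc k)) / y k)"
        by (simp add: power2_eq_square field_simps)
      also have "\<dots> \<le> K * (y k - y (Suc k)) * 2"
        using le y(1)[of k] K by (intro mult_left_mono mult_nonneg_nonneg) (auto simp: field_simps)
      finally show "cmod (of_real ((y k)\<^sup>2 - (y (Suc k))\<^sup>2) * W k x) \<le> K * (y k - y (Suc k)) * 2" .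
    next
      show "summable (\<lambda>k. K * (y k - y (Suc k)) * 2)"
        using telescope_summable'[OF y(3)] by (intro summable_mult summable_mult2)
    qed
  qed (simp add: uniformly_convergent_on_def)
  from uniformly_convergent_add[OF 1 this] show ?thesis
    by (simp only: Abel)
qed

text \<open>A nonnegative series with finite expectation is finite almost surely. This takes the
  place of Borel-Cantelli arguments: summability gives boundedness of the terms, or their
  convergence to 0, along almost every path.\<close>

lemma AE_summable_if_nn_integral_le:
  fixes X :: "nat \<Rightarrow> 'a \<Rightarrow> real"
  assumes [measurable]: "\<And>n. X n \<in> borel_measurable M"
    and nn: "\<And>n \<omega>. 0 \<le> X n \<omega>"
    and le: "\<And>n. (\<integral>\<^sup>+\<omega>. ennreal (X n \<omega>) \<partial>M) \<le> ennreal (B n)"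
    and B: "summable B" "\<And>n. 0 \<le> B n"
  shows "AE \<omega> in M. summable (\<lambda>n. X n \<omega>)"
proof -
  have "(\<integral>\<^sup>+\<omega>. (\<Sum>n. ennreal (X n \<omega>)) \<partial>M) = (\<Sum>n. \<integral>\<^sup>+\<omega>. ennreal (X n \<omega>) \<partial>M)"
    by (rule nn_integral_suminf) measurable
  also have "\<dots> \<le> (\<Sum>n. ennreal (B n))"
    by (intro suminf_le le) auto
  also have "\<dots> < \<infinity>"
    using B by (simp add: suminf_ennreal2 less_top)
  finally have "AE \<omega> in M. (\<Sum>n. ennreal (X n \<omega>)) \<noteq> \<infinity>"
    by (intro nn_integral_PInf_AE) auto
  then show ?thesis
    by eventually_elim (auto intro: summable_suminf_not_top nn)
qed

lemma summable_imp_bounded_above: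
  fixes X :: "nat \<Rightarrow> real"
  assumes "summable X"
  shows "\<exists>K>0. \<forall>n. X n \<le> K"
proof -
  have "Bseq X" using summable_LIMSEQ_zero[OF assms] by (intro convergent_imp_Bseq convergentI)
  then obtain K where "K > 0" "\<forall>n. norm (X n) \<le> K" by (rule BseqE)
  then show ?thesis by (intro exI[of _ K]) (auto simp: abs_le_iff)
qed

lemma abs_le_ln_cosh:
  assumes "cosh (y :: real) \<le> C"
  shows "\<bar>y\<bar> \<le> ln (2 * C)"
proof -
  have "exp \<bar>y\<bar> / 2 \<le> cosh y"
    by (simp add: cosh_field_def abs_if)
  with assms have "exp \<bar>y\<bar> \<le> 2 * C" by simp
  moreover from this have "0 < 2 * C" using exp_gt_zero[of "\<bar>y\<bar>"] by linarith
  ultimately show ?thesis by (simp add: ln_ge_iff)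
qed

lemma summable_inverse_Suc_square: "summable (\<lambda>N. 1 / real (Suc N) ^ 2)"
  using inverse_power_summable[of 2, where 'a = real] summable_Suc_iff[of "\<lambda>n. inverse (real n ^ 2)"]
  by (simp add: inverse_eq_divide)

context complex_gaussian_family
begin

text \<open>Each value of the N-th sum has exponential moments bounded independently of N, so the
  maximum over polynomially many grid points grows only logarithmically.\<close>

lemma trig_sum_growth:
  assumes v: "\<And>N. (\<Sum>n\<in>{- int N..int N}. (cmod (d n))\<^sup>2) \<le> 1"
  shows "AE \<omega> in M. \<exists>K. \<forall>N x.
    cmod (\<Sum>n\<in>{- int N..int N}. d n * g n \<omega> * exp (\<i> * of_int n * of_real x)) \<le> K + 14 * ln (real (Suc N))"
proof -
  define I where "I N = {- int N..int N}" for N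
  \<comment> \<open>The grid must be fine enough to absorb the sum of |n| |d_n g_n|, which is found
    below to be at most a constant times (N+1)^4.\<close>
  define G where "G N = Suc N ^ 5" for N
  define x where "x N j = 2 * pi * real j / real (G N)" for N j
  define W where "W N y \<omega> = (\<Sum>n\<in>I N. d n * g n \<omega> * exp (\<i> * of_int n * of_real y))" for N y \<omega>
  \<comment> \<open>The exponent 7 is 5 for the number of grid points plus 2 for a summable 1 /
    (N+1)^2. After taking logarithms it becomes 7 ln (N+1) for each of the real and imaginary parts,
    hence 14.\<close>
  define X where "X N \<omega> = (\<Sum>j<G N. cosh (Re (W N (x N j) \<omega>)) + cosh (Im (W N (x N j) \<omega>))) / real (Suc N) ^ 7" for N \<omega>
  \<comment> \<open>The sum has expectation at most 4 (N+1), so the exponent 3 again leaves 1 /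
    (N+1)^2.\<close>
  define T where "T N \<omega> = (\<Sum>n\<in>I N. 1 + (cmod (d n * g n \<omega>))\<^sup>2) / real (Suc N) ^ 3" for N \<omega>
  have G0: "0 < G N" for N by (simp add: G_def)
  have [measurable]: "W N y \<in> borel_measurable M" for N y
    unfolding W_def by measurable
  have [measurable]: "X N \<in> borel_measurable M" "T N \<in> borel_measurable M" for N
    unfolding X_def T_def by measurable
  have expW: "(\<integral>\<^sup>+\<omega>. ennreal (cosh (Re (W N y \<omega>))) \<partial>M) \<le> ennreal (exp (1/2))"
    "(\<integral>\<^sup>+\<omega>. ennreal (cosh (Im (W N y \<omega>))) \<partial>M) \<le> ennreal (exp (1/2))" for N y
  proof -
    have 1: "W N y \<omega> = (\<Sum>n\<in>I N. (d n * exp (\<i> * of_int n * of_real y)) * g n \<omega>)" for \<omega>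
      unfolding W_def by (intro sum.cong) (simp_all add: mult_ac)
    \<comment> \<open>Multiplying all coefficients by -i turns the imaginary part into a real part
      without changing their moduli.\<close>
    have 2: "Im (W N y \<omega>) = Re (\<Sum>n\<in>I N. (- \<i> * d n * exp (\<i> * of_int n * of_real y)) * g n \<omega>)" for \<omega>
    proof -
      have "(\<Sum>n\<in>I N. (- \<i> * d n * exp (\<i> * of_int n * of_real y)) * g n \<omega>) = - \<i> * W N y \<omega>"
        unfolding 1 sum_distrib_left by (intro sum.cong) (simp_all add: mult_ac)
      then show ?thesis by simp
    qed
    have 3: "(\<Sum>n\<in>I N. (cmod (d n * exp (\<i> * of_int n * of_real y)))\<^sup>2) \<le> 1"
      "(\<Sum>n\<in>I N. (cmod (- \<i> * d n * exp (\<i> * of_int n * of_real y)))\<^sup>2) \<le> 1"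
      using v[of N] by (simp_all add: norm_mult norm_exp_eq_Re I_def)
    show "(\<integral>\<^sup>+\<omega>. ennreal (cosh (Re (W N y \<omega>))) \<partial>M) \<le> ennreal (exp (1/2))"
      unfolding 1 by (rule nn_integral_cosh_Re_le[OF _ 3(1)]) (simp add: I_def)
    show "(\<integral>\<^sup>+\<omega>. ennreal (cosh (Im (W N y \<omega>))) \<partial>M) \<le> ennreal (exp (1/2))"
      unfolding 2 by (rule nn_integral_cosh_Re_le[OF _ 3(2)]) (simp add: I_def)
  qed
  have "(\<integral>\<^sup>+\<omega>. ennreal (X N \<omega>) \<partial>M) \<le> ennreal (2 * exp (1/2) * (1 / real (Suc N) ^ 2))" for N
  proof -
    have "(\<integral>\<^sup>+\<omega>. ennreal (X N \<omega>) \<partial>M)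
        = (\<integral>\<^sup>+\<omega>. ennreal (1 / real (Suc N) ^ 7) * (\<Sum>j<G N. ennreal (cosh (Re (W N (x N j) \<omega>))) + ennreal (cosh (Im (W N (x N j) \<omega>)))) \<partial>M)"
      by (intro nn_integral_cong)
         (simp add: X_def ennreal_mult'[symmetric] ennreal_plus[symmetric] sum_ennreal del: ennreal_plus)
    also have "\<dots> = ennreal (1 / real (Suc N) ^ 7) * (\<Sum>j<G N. (\<integral>\<^sup>+\<omega>. ennreal (cosh (Re (W N (x N j) \<omega>))) \<partial>M) + (\<integral>\<^sup>+\<omega>. ennreal (cosh (Im (W N (x N j) \<omega>))) \<partial>M))"
      by (subst nn_integral_cmult, measurable, subst nn_integral_sum, measurable, subst nn_integral_add) auto
    also have "\<dots> \<le> ennreal (1 / real (Suc N) ^ 7) * (\<Sum>j<G N. ennreal (exp (1/2)) + ennreal (exp (1/2)))"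
      by (intro mult_left_mono sum_mono add_mono expW) auto
    also have "\<dots> = ennreal (1 / real (Suc N) ^ 7) * ennreal (\<Sum>j<G N. exp (1/2) + exp (1/2))"
      by (simp only: ennreal_plus[symmetric] exp_ge_zero) (subst sum_ennreal, auto)
    also have "\<dots> = ennreal (1 / real (Suc N) ^ 7 * (\<Sum>j<G N. exp (1/2) + exp (1/2)))"
      by (rule ennreal_mult'[symmetric]) simp
    also have "1 / real (Suc N) ^ 7 * (\<Sum>j<G N. exp (1/2) + exp (1/2)) = 2 * exp (1/2) * (real (Suc N) ^ 5 / real (Suc N) ^ 7)"
      by (simp add: G_def)
    also have "real (Suc N) ^ 5 / real (Suc N) ^ 7 = 1 / real (Suc N) ^ 2"
      by (simp add: field_simps del: of_nat_Suc flip: power_add)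
    finally show ?thesis .
  qed
  then have AX: "AE \<omega> in M. summable (\<lambda>N. X N \<omega>)"
    by (intro AE_summable_if_nn_integral_le[where B = "\<lambda>N. 2 * exp (1/2) * (1 / real (Suc N) ^ 2)"]
         summable_mult summable_inverse_Suc_square)
       (auto simp: X_def intro!: divide_nonneg_nonneg sum_nonneg add_nonneg_nonneg)
  have "(\<integral>\<^sup>+\<omega>. ennreal (T N \<omega>) \<partial>M) \<le> ennreal (4 * (1 / real (Suc N) ^ 2))" for N
  proof -
    have i: "integrable M (\<lambda>\<omega>. (cmod (d n * g n \<omega>))\<^sup>2)" and e: "(\<integral>\<omega>. (cmod (d n * g n \<omega>))\<^sup>2 \<partial>M) = 2 * (cmod (d n))\<^sup>2" for n
      using integrable_norm_sum[where c = d and I = "{n}"] integral_norm_sum[where c = d and I = "{n}"] by auto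
    have iT: "integrable M (\<lambda>\<omega>. \<Sum>n\<in>I N. 1 + (cmod (d n * g n \<omega>))\<^sup>2)"
      by (intro Bochner_Integration.integrable_sum Bochner_Integration.integrable_add i) simp
    have "(\<integral>\<omega>. T N \<omega> \<partial>M) = (\<Sum>n\<in>I N. 1 + 2 * (cmod (d n))\<^sup>2) / real (Suc N) ^ 3"
      by (simp add: T_def Bochner_Integration.integral_sum i e prob_space)
    also have "\<dots> \<le> (4 * real (Suc N)) / real (Suc N) ^ 3"
      using v[of N] by (intro divide_right_mono) (simp_all add: sum.distrib I_def flip: sum_distrib_left)
    also have "\<dots> = 4 * (1 / real (Suc N) ^ 2)"
      by (simp add: power2_eq_square power3_eq_cube del: of_nat_Suc)
    finally have le: "(\<integral>\<omega>. T N \<omega> \<partial>M) \<le> 4 * (1 / real (Suc N) ^ 2)" .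
    have "(\<integral>\<^sup>+\<omega>. ennreal (T N \<omega>) \<partial>M) = ennreal (\<integral>\<omega>. T N \<omega> \<partial>M)"
      using iT by (intro nn_integral_eq_integral) (auto simp: T_def intro!: divide_nonneg_nonneg sum_nonneg)
    with le show ?thesis by (simp add: ennreal_leI)
  qed
  then have AT: "AE \<omega> in M. summable (\<lambda>N. T N \<omega>)"
    by (intro AE_summable_if_nn_integral_le[where B = "\<lambda>N. 4 * (1 / real (Suc N) ^ 2)"]
         summable_mult summable_inverse_Suc_square)
       (auto simp: T_def intro!: divide_nonneg_nonneg sum_nonneg add_nonneg_nonneg)
  from AX AT show ?thesis
  proof eventually_elim
    case (elim \<omega>)
    obtain K1 where K1: "K1 > 0" "\<And>N. X N \<omega> \<le> K1" using summable_imp_bounded_above[OF elim(1)] by blast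
    obtain K2 where K2: "K2 > 0" "\<And>N. T N \<omega> \<le> K2" using summable_imp_bounded_above[OF elim(2)] by blast
    have "cmod (W N y \<omega>) \<le> (2 * ln (2 * K1) + 2 * pi * K2) + 14 * ln (real (Suc N))" for N y
    proof -
      have Re_Im: "\<bar>Re (W N (x N j) \<omega>)\<bar> \<le> ln (2 * K1) + 7 * ln (real (Suc N))"
        "\<bar>Im (W N (x N j) \<omega>)\<bar> \<le> ln (2 * K1) + 7 * ln (real (Suc N))" if j: "j < G N" for j
      proof -
        let ?f = "\<lambda>j. cosh (Re (W N (x N j) \<omega>)) + cosh (Im (W N (x N j) \<omega>))"
        have "?f j \<le> (\<Sum>j<G N. ?f j)"
          using j by (intro member_le_sum) (auto intro!: add_nonneg_nonneg)
        also have "\<dots> \<le> K1 * real (Suc N) ^ 7"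
          using K1(2)[of N] by (simp add: X_def field_simps del: of_nat_Suc)
        finally have "?f j \<le> K1 * real (Suc N) ^ 7" .
        then have c: "cosh (Re (W N (x N j) \<omega>)) \<le> K1 * real (Suc N) ^ 7" "cosh (Im (W N (x N j) \<omega>)) \<le> K1 * real (Suc N) ^ 7"
          using cosh_real_nonneg[of "Re (W N (x N j) \<omega>)"] cosh_real_nonneg[of "Im (W N (x N j) \<omega>)"] by linarith+
        have "ln (2 * (K1 * real (Suc N) ^ 7)) = ln (2 * K1) + 7 * ln (real (Suc N))"
          using K1(1) by (simp add: ln_mult ln_realpow del: of_nat_Suc)
        with abs_le_ln_cosh[OF c(1)] abs_le_ln_cosh[OF c(2)] show
          "\<bar>Re (W N (x N j) \<omega>)\<bar> \<le> ln (2 * K1) + 7 * ln (real (Suc N))"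
          "\<bar>Im (W N (x N j) \<omega>)\<bar> \<le> ln (2 * K1) + 7 * ln (real (Suc N))" by simp_all
      qed
      have "finite (I N)" by (simp add: I_def)
      from trig_sum_grid[OF G0[of N] this, of "\<lambda>n. d n * g n \<omega>" y]
      obtain j where j: "j < G N" and le: "cmod (W N y \<omega>) \<le> cmod (W N (x N j) \<omega>)
          + 2 * pi / real (G N) * (\<Sum>n\<in>I N. \<bar>real_of_int n\<bar> * cmod (d n * g n \<omega>))"
        by (auto simp: W_def x_def)
      have "(\<Sum>n\<in>I N. \<bar>real_of_int n\<bar> * cmod (d n * g n \<omega>)) \<le> (\<Sum>n\<in>I N. real (Suc N) * (1 + (cmod (d n * g n \<omega>))\<^sup>2))"
      proof (intro sum_mono mult_mono)
        \<comment> \<open>Trades the first powers for the second moments collected in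
          \<open>T\<close>.\<close>
        show "cmod z \<le> 1 + (cmod z)\<^sup>2" for z
          using zero_le_power2[of "cmod z - 1/2"] by (simp add: power2_diff field_simps power2_eq_square)
      qed (auto simp: I_def)
      also have "\<dots> = real (Suc N) * (T N \<omega> * real (Suc N) ^ 3)"
        by (simp add: T_def sum_distrib_left del: of_nat_Suc)
      also have "\<dots> \<le> real (Suc N) * (K2 * real (Suc N) ^ 3)"
        by (intro mult_left_mono mult_right_mono K2) auto
      also have "\<dots> = K2 * real (Suc N) ^ 4" by (simp add: eval_nat_numeral)
      also have "\<dots> \<le> K2 * real (Suc N) ^ 5"
        using K2 by (intro mult_left_mono power_increasing) auto
      also have "\<dots> = K2 * real (G N)" by (simp add: G_def)
      finally have "2 * pi / real (G N) * (\<Sum>n\<in>I N. \<bar>real_of_int n\<bar> * cmod (d n * g n \<omega>)) \<le> 2 * pi / real (G N) * (K2 * real (G N))"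
        by (intro mult_left_mono) auto
      also have "\<dots> = 2 * pi * K2" using G0[of N] by simp
      finally show ?thesis
        using le Re_Im[OF j] cmod_le[of "W N (x N j) \<omega>"] by linarith
    qed
    then show ?case unfolding W_def I_def by blast
  qed
qed

end

lemma sum_symmetric_eq:
  fixes f :: "int \<Rightarrow> 'a :: comm_monoid_add"
  shows "(\<Sum>k\<le>N. if k = 0 then f 0 else f (int k) + f (- int k)) = (\<Sum>n\<in>{- int N..int N}. f n)"
proof (induction N)
  case (Suc N)
  then show ?case unfolding sum_symmetric_Suc by simp
qed simp

lemma sum_powr_japanese_bracket_bounded:
  assumes "1 < p"
  shows "\<exists>V>0. \<forall>I. finite I \<longrightarrow> (\<Sum>n\<in>I. japanese_bracket n powr (- p)) \<le> V"
proof -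
  have "(\<Sum>n\<in>I. japanese_bracket n powr (- p)) \<le> infsum (\<lambda>n. japanese_bracket n powr (- p)) UNIV" if "finite I" for I
    using that by (intro finite_sum_le_infsum summable_on_japanese_bracket assms) auto
  then show ?thesis
    by (intro exI[of _ "max 1 (infsum (\<lambda>n. japanese_bracket n powr (- p)) UNIV)"]) force
qed

context complex_gaussian_family
begin

text \<open>The spare decay \<sigma> - 1/2 is spent in two places. Coefficients amplified by
  <n>^(2p) are still square summable, so their trigonometric sums grow at most logarithmically,
  hence at most like <N>^p; Abel summation with the weights <n>^(-2p) then restores the original
  coefficients and yields uniform convergence.\<close>

lemma AE_uniformly_convergent:
  assumes \<sigma>: "1/2 < \<sigma>" and c: "\<And>n. cmod (c n) \<le> C * japanese_bracket n powr (- \<sigma>)"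
  shows "AE \<omega> in M. uniformly_convergent_on UNIV
    (\<lambda>N x. \<Sum>n\<in>{- int N..int N}. c n * g n \<omega> * exp (\<i> * of_int n * of_real x))"
proof -
  \<comment> \<open>With this choice 2 (\<sigma> - 2p) = \<sigma> + 1/2 > 1.\<close>
  define p where "p = (\<sigma> - 1/2) / 4"
  have p: "0 < p" "1 < 2 * (\<sigma> - 2 * p)" using \<sigma> by (auto simp: p_def field_simps)
  define y where "y k = japanese_bracket (int k) powr (- p)" for k
  obtain V where V: "0 < V" "\<And>I. finite I \<Longrightarrow> (\<Sum>n\<in>I. japanese_bracket n powr (- (2 * (\<sigma> - 2 * p)))) \<le> V"
    using sum_powr_japanese_bracket_bounded[OF p(2)] by blast
  \<comment> \<open>Normalises the amplified coefficients to a sum of squares at most 1; the summand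
    1 keeps \<open>D\<close> positive.\<close>
  define D where "D = (\<bar>C\<bar> + 1) * sqrt V"
  have D: "0 < D" using V(1) by (simp add: D_def)
  define d where "d n = c n * of_real (japanese_bracket n powr (2 * p))" for n
  have dle: "(cmod (d n / of_real D))\<^sup>2 \<le> japanese_bracket n powr (- (2 * (\<sigma> - 2 * p))) / V" for n
  proof -
    have "cmod (d n) = cmod (c n) * japanese_bracket n powr (2 * p)"
      by (simp add: d_def norm_mult)
    also have "\<dots> \<le> (\<bar>C\<bar> + 1) * japanese_bracket n powr (- \<sigma>) * japanese_bracket n powr (2 * p)"
      by (intro mult_right_mono order_trans[OF c]) auto
    also have "\<dots> = (\<bar>C\<bar> + 1) * japanese_bracket n powr (- (\<sigma> - 2 * p))"
      by (simp add: powr_add[symmetric])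
    finally have "cmod (d n) / D \<le> (\<bar>C\<bar> + 1) * japanese_bracket n powr (- (\<sigma> - 2 * p)) / D"
      using D by (intro divide_right_mono) auto
    moreover have "cmod (d n / of_real D) = cmod (d n) / D" using D by (simp add: norm_divide)
    moreover have "(\<bar>C\<bar> + 1) * X / D = X / sqrt V" for X by (simp add: D_def)
    ultimately have "cmod (d n / of_real D) \<le> japanese_bracket n powr (- (\<sigma> - 2 * p)) / sqrt V"
      by simp
    then have "(cmod (d n / of_real D))\<^sup>2 \<le> (japanese_bracket n powr (- (\<sigma> - 2 * p)) / sqrt V)\<^sup>2"
      by (intro power_mono) auto
    also have "\<dots> = japanese_bracket n powr (- (2 * (\<sigma> - 2 * p))) / V"
      using V(1) by (simp add: power_divide) (simp add: power2_eq_square powr_add[symmetric])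
    finally show ?thesis .
  qed
  have "(\<Sum>n\<in>{- int N..int N}. (cmod (d n / of_real D))\<^sup>2) \<le> 1" for N
  proof -
    have "(\<Sum>n\<in>{- int N..int N}. (cmod (d n / of_real D))\<^sup>2)
      \<le> (\<Sum>n\<in>{- int N..int N}. japanese_bracket n powr (- (2 * (\<sigma> - 2 * p))) / V)"
      by (intro sum_mono dle)
    also have "\<dots> \<le> 1"
      using V(2)[of "{- int N..int N}"] V(1) by (simp add: sum_divide_distrib[symmetric])
    finally show ?thesis .
  qed
  from trig_sum_growth[OF this] show ?thesis
  proof eventually_elim
    case (elim \<omega>)
    then obtain K where K: "\<And>N x. cmod (\<Sum>n\<in>{- int N..int N}. d n / of_real D * g n \<omega> * exp (\<i> * of_int n * of_real x))
        \<le> K + 14 * ln (real (Suc N))" by blast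
    define f where "f x n = d n * g n \<omega> * exp (\<i> * of_int n * of_real x)" for x n
    \<comment> \<open>The frequencies k and -k are grouped, with 0 on its own, so that symmetric
      partial sums become ordinary ones over the naturals. The weight \<open>y\<close> suits both
      members of a pair, since the bracket is even.\<close>
    define a where "a k x = (if k = 0 then f x 0 else f x (int k) + f x (- int k))" for k x
    have bound: "cmod (\<Sum>k\<le>N. a k x) \<le> D * (\<bar>K\<bar> + 14 * (2 powr p / p)) / y N" for N x
    proof -
      have "(\<Sum>k\<le>N. a k x) = of_real D * (\<Sum>n\<in>{- int N..int N}. d n / of_real D * g n \<omega> * exp (\<i> * of_int n * of_real x))"
        using D unfolding a_def sum_symmetric_eq[of "f x"] sum_distrib_left
        by (intro sum.cong) (auto simp: f_def)
      then have "cmod (\<Sum>k\<le>N. a k x) \<le> D * (K + 14 * ln (real (Suc N)))"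
        using K[of x N] D by (simp add: norm_mult del: of_nat_Suc)
      also have "\<dots> \<le> D * (\<bar>K\<bar> * japanese_bracket (int N) powr p + 14 * ((2 * japanese_bracket (int N)) powr p / p))"
      proof (intro mult_left_mono add_mono)
        have "1 \<le> japanese_bracket (int N) powr p"
          using japanese_bracket_ge_1 p by (intro ge_one_powr_ge_zero) auto
        then show "K \<le> \<bar>K\<bar> * japanese_bracket (int N) powr p"
          using mult_left_mono[of 1 "japanese_bracket (int N) powr p" "\<bar>K\<bar>"] by linarith
        have "ln (real (Suc N)) \<le> real (Suc N) powr p / p"
          using p by (intro ln_powr_bound) auto
        also have "\<dots> \<le> (2 * japanese_bracket (int N)) powr p / p"
          using p japanese_bracket_ge_1[of "int N"] japanese_bracket_ge_abs[of "int N"]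
          by (intro divide_right_mono powr_mono2) auto
        finally show "ln (real (Suc N)) \<le> (2 * japanese_bracket (int N)) powr p / p" .
      qed (use D in auto)
      also have "\<dots> = D * (\<bar>K\<bar> + 14 * (2 powr p / p)) / y N"
        by (simp add: y_def powr_minus powr_mult field_simps less_imp_le)
      finally show ?thesis .
    qed
    have "filterlim (\<lambda>k. japanese_bracket (int k)) at_top sequentially"
      by (rule filterlim_at_top_mono[OF filterlim_real_sequentially])
         (auto intro!: always_eventually order_trans[OF _ japanese_bracket_ge_abs])
    then have y0: "y \<longlonglongrightarrow> 0"
      unfolding y_def using p by (intro tendsto_neg_powr) auto
    have ydec: "decseq y"
      unfolding y_def decseq_def using p
      by (auto intro!: powr_mono2' japanese_bracket_mono)
    have "uniformly_convergent_on UNIV (\<lambda>N x. \<Sum>k\<le>N. of_real ((y k)\<^sup>2) * a k x)"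
      by (rule Abel_uniformly_convergent[OF bound _ ydec y0]) (simp add: y_def)
    also have "(\<lambda>N x. \<Sum>k\<le>N. of_real ((y k)\<^sup>2) * a k x)
       = (\<lambda>N x. \<Sum>n\<in>{- int N..int N}. c n * g n \<omega> * exp (\<i> * of_int n * of_real x))"
    proof (intro ext)
      fix N x
      have cancel: "complex_of_real (japanese_bracket n powr (- (p * 2))) * of_real (japanese_bracket n powr (p * 2)) = 1" for n
        using japanese_bracket_pos[of n] by (simp add: of_real_mult[symmetric] powr_add[symmetric] del: of_real_mult)
      have "of_real ((y k)\<^sup>2) * a k x = (if k = 0 then c 0 * g 0 \<omega> * exp (\<i> * of_int 0 * of_real x)
         else c (int k) * g (int k) \<omega> * exp (\<i> * of_int (int k) * of_real x)
            + c (- int k) * g (- int k) \<omega> * exp (\<i> * of_int (- int k) * of_real x))" for k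
        using cancel[of "int k"] cancel[of "- int k"] cancel[of 0]
        by (auto simp: a_def f_def d_def y_def powr_power distrib_left mult_ac
             mult.left_commute[of "complex_of_real (japanese_bracket _ powr (- (p * 2)))"])
      then show "(\<Sum>k\<le>N. of_real ((y k)\<^sup>2) * a k x)
         = (\<Sum>n\<in>{- int N..int N}. c n * g n \<omega> * exp (\<i> * of_int n * of_real x))"
        by (subst sum_symmetric_eq[symmetric]) (rule sum.cong, auto)
    qed
    finally show ?case .
  qed
qed

end

section \<open>The random series as an element of the space of continuous periodic functions\<close>

lemma convergent_fourier_partial_sum:
  assumes "uniformly_convergent_on UNIV (\<lambda>N x. apply_bcontfun (fourier_partial_sum s a N) x)"
  shows "convergent (fourier_partial_sum s a)"
proof -
  have C: "uniformly_Cauchy_on UNIV (\<lambda>N x. apply_bcontfun (fourier_partial_sum s a N) x)"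
    using assms by (rule uniformly_convergent_Cauchy)
  have "Cauchy (fourier_partial_sum s a)"
  proof (rule metric_CauchyI)
    fix e :: real assume "0 < e"
    then obtain N where N: "dist (fourier_partial_sum s a m x) (fourier_partial_sum s a n x) < e / 2"
      if "m \<ge> N" "n \<ge> N" for x m n
      using C half_gt_zero[OF \<open>0 < e\<close>] unfolding uniformly_Cauchy_on_def by blast
    have "dist (fourier_partial_sum s a m) (fourier_partial_sum s a n) < e" if "m \<ge> N" "n \<ge> N" for m n
    proof -
      have "dist (fourier_partial_sum s a m) (fourier_partial_sum s a n) \<le> e / 2"
        by (rule dist_bound, rule less_imp_le, rule N[OF that])
      with \<open>0 < e\<close> show ?thesis by simp
    qed
    then show "\<exists>N. \<forall>m\<ge>N. \<forall>n\<ge>N. dist (fourier_partial_sum s a m) (fourier_partial_sum s a n) < e"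
      by blast
  qed
  then show ?thesis by (simp add: Cauchy_convergent_iff)
qed

lemma fourier_series_LIMSEQ:
  "convergent (fourier_partial_sum s a) \<Longrightarrow> fourier_partial_sum s a \<longlonglongrightarrow> fourier_series s a"
  by (simp add: fourier_series_def convergent_LIMSEQ_iff)

lemma tendsto_apply_bcontfun:
  fixes u :: "'b \<Rightarrow> ('a :: topological_space \<Rightarrow>\<^sub>C 'c :: metric_space)"
  assumes "(u \<longlongrightarrow> v) F"
  shows "((\<lambda>i. apply_bcontfun (u i) x) \<longlongrightarrow> apply_bcontfun v x) F"
  using assms unfolding tendsto_iff by (auto elim!: eventually_mono intro: order_le_less_trans[OF dist_bounded])

lemma continuous_on_apply_bcontfun:
  "continuous_on UNIV (\<lambda>u :: 'a :: topological_space \<Rightarrow>\<^sub>C 'c :: metric_space. apply_bcontfun u x)"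
  unfolding continuous_on_def by (auto intro: tendsto_apply_bcontfun tendsto_ident_at)

lemma closed_periodic_functions: "closed periodic_functions"
  unfolding periodic_functions_def
  by (intro closed_Collect_all closed_Collect_eq continuous_on_apply_bcontfun)

lemma fourier_partial_sum_periodic: "fourier_partial_sum s a N \<in> periodic_functions"
proof -
  have "exp (\<i> * of_int n * of_real (x + 2 * pi)) = exp (\<i> * of_int n * of_real x)" for n x
    using exp_i_periodic[of n x 1] by simp
  then show ?thesis
    by (simp add: periodic_functions_def fourier_partial_sum.rep_eq)
qed

lemma fourier_series_periodic: "fourier_series s a \<in> periodic_functions"
proof (cases "convergent (fourier_partial_sum s a)")
  case True
  show ?thesis
    by (rule closed_sequentially[OF closed_periodic_functions _ fourier_series_LIMSEQ[OF True]])
       (rule fourier_partial_sum_periodic)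
next
  case False
  then show ?thesis by (simp add: fourier_series_def periodic_functions_def zero_bcontfun.rep_eq)
qed

section \<open>Finite differences and the pointwise flow\<close>

text \<open>This is (-1)^m times the m-th forward difference at 0 with step h, i.e. the alternating
  binomial sum of f(j h) for j = 0, ..., m. With this sign e^(inx) is sent to (1 -
  e^(inh))^m.\<close>

primrec fdiff :: "nat \<Rightarrow> real \<Rightarrow> (real \<Rightarrow> complex) \<Rightarrow> complex" where
  "fdiff 0 h f = f 0"
| "fdiff (Suc m) h f = fdiff m h f - fdiff m h (\<lambda>x. f (x + h))"

lemma fdiff_add: "fdiff m h (\<lambda>x. f x + f' x) = fdiff m h f + fdiff m h f'"
  by (induction m arbitrary: f f') simp_all

lemma fdiff_diff: "fdiff m h (\<lambda>x. f x - f' x) = fdiff m h f - fdiff m h f'"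
  by (induction m arbitrary: f f') simp_all

lemma fdiff_cmult: "fdiff m h (\<lambda>x. c * f x) = c * fdiff m h f"
  by (induction m arbitrary: f) (simp_all add: right_diff_distrib)

lemma fdiff_cnj: "fdiff m h (\<lambda>x. cnj (f x)) = cnj (fdiff m h f)"
  by (induction m arbitrary: f) simp_all

lemma fdiff_0: "fdiff m h (\<lambda>x. 0) = 0"
  by (induction m) simp_all

lemma fdiff_sum: "fdiff m h (\<lambda>x. \<Sum>i\<in>I. f i x) = (\<Sum>i\<in>I. fdiff m h (f i))"
  by (induction I rule: infinite_finite_induct) (simp_all add: fdiff_add fdiff_0)

lemma fdiff_exp:
  "fdiff m h (\<lambda>x. exp (\<i> * of_int n * of_real x)) = (1 - exp (\<i> * of_int n * of_real h)) ^ m"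
proof (induction m)
  case (Suc m)
  have "exp (\<i> * of_int n * of_real (x + h)) = exp (\<i> * of_int n * of_real h) * exp (\<i> * of_int n * of_real x)" for x
    by (simp add: exp_add[symmetric] algebra_simps)
  then show ?case using Suc by (simp only: fdiff.simps fdiff_cmult) (simp add: algebra_simps)
qed simp

lemma fdiff_norm_le:
  assumes "\<And>j. j \<le> m \<Longrightarrow> cmod (f (real j * h)) \<le> B"
  shows "cmod (fdiff m h f) \<le> 2 ^ m * B"
proof -
  have "\<forall>j\<le>m. cmod (f (real j * h)) \<le> B \<Longrightarrow> ?thesis"
  proof (induction m arbitrary: f)
    case (Suc m)
    have "cmod (fdiff m h f) \<le> 2 ^ m * B" using Suc by simp
    moreover have "cmod (fdiff m h (\<lambda>x. f (x + h))) \<le> 2 ^ m * B"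
    proof (rule Suc.IH, safe)
      fix j assume "j \<le> m"
      then have "cmod (f (real (Suc j) * h)) \<le> B" using Suc.prems by blast
      then show "cmod (f (real j * h + h)) \<le> B" by (simp add: algebra_simps)
    qed
    ultimately show ?case
      using norm_triangle_ineq4[of "fdiff m h f" "fdiff m h (\<lambda>x. f (x + h))"] by simp
  qed simp
  with assms show ?thesis by blast
qed

lemma fdiff_tendsto:
  assumes "\<And>x. ((\<lambda>i. f i x) \<longlongrightarrow> l x) F"
  shows "((\<lambda>i. fdiff m h (f i)) \<longlongrightarrow> fdiff m h l) F"
  using assms
proof (induction m arbitrary: f l)
  case (Suc m)
  have "((\<lambda>i. fdiff m h (f i)) \<longlongrightarrow> fdiff m h l) F" by (rule Suc.IH, rule Suc.prems)
  moreover have "((\<lambda>i. fdiff m h (\<lambda>x. f i (x + h))) \<longlongrightarrow> fdiff m h (\<lambda>x. l (x + h))) F"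
    by (rule Suc.IH, rule Suc.prems)
  ultimately show ?case by (auto intro: tendsto_diff)
qed simp

text \<open>By the binomial theorem a shift changes x^i only by terms of degree below i, so each
  difference lowers the degree.\<close>

lemma fdiff_power: "i < m \<Longrightarrow> fdiff m h (\<lambda>x. of_real x ^ i) = 0"
proof (induction m arbitrary: i)
  case (Suc m)
  have "complex_of_real (x + h) ^ i = of_real x ^ i + (\<Sum>l<i. of_nat (i choose l) * of_real h ^ (i - l) * of_real x ^ l)" for x
  proof -
    have "complex_of_real (x + h) ^ i = (of_real h + of_real x) ^ i"
      by (simp add: add.commute)
    also have "\<dots> = (\<Sum>l\<le>i. of_nat (i choose l) * of_real x ^ l * of_real h ^ (i - l))"
      by (subst add.commute) (rule binomial_ring)
    also have "{..i} = insert i {..<i}" by auto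
    finally show ?thesis by (simp add: mult.assoc mult.commute[of "of_real h ^ _"])
  qed
  then have "fdiff (Suc m) h (\<lambda>x. of_real x ^ i)
      = - (\<Sum>l<i. of_nat (i choose l) * of_real h ^ (i - l) * fdiff m h (\<lambda>x. of_real x ^ l))"
    by (simp only: fdiff.simps fdiff_add fdiff_sum fdiff_cmult) simp
  also have "\<dots> = 0" using Suc by (auto intro!: sum.neutral)
  finally show ?case .
qed simp

lemma fdiff_poly: "d < m \<Longrightarrow> fdiff m h (\<lambda>x. \<Sum>i\<le>d. p i * of_real x ^ i) = 0"
  unfolding fdiff_sum fdiff_cmult by (auto simp: fdiff_power intro!: sum.neutral)

text \<open>Each step splits off the value at 0 and divides by z, the quotient being entire after
  filling in the removable singularity. With the remainder in the form z^m H(z), continuity of H on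
  a compact disc is all that is needed for a bound.\<close>

lemma holomorphic_Taylor_remainder:
  fixes f :: "complex \<Rightarrow> complex"
  assumes "f holomorphic_on UNIV"
  shows "\<exists>a H. H holomorphic_on UNIV \<and> (\<forall>z. f z = (\<Sum>i<m. a i * z ^ i) + z ^ m * H z)"
proof (induction m)
  case 0
  then show ?case using assms by auto
next
  case (Suc m)
  then obtain a H where H: "H holomorphic_on UNIV" and f: "\<And>z. f z = (\<Sum>i<m. a i * z ^ i) + z ^ m * H z"
    by blast
  define H' where "H' z = (if z = 0 then deriv H 0 else (H z - H 0) / (z - 0))" for z
  have "H' holomorphic_on UNIV" unfolding H'_def by (rule pole_lemma_open[OF H]) simp
  moreover have Hz: "H z = H 0 + z * H' z" for z by (simp add: H'_def)
  have "f z = (\<Sum>i<Suc m. (a(m := H 0)) i * z ^ i) + z ^ Suc m * H' z" for z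
    unfolding f[of z] by (subst Hz[of z]) (simp add: algebra_simps)
  ultimately show ?case by blast
qed

text \<open>The Taylor polynomial of degree below m is annihilated. The remainder is evaluated only
  at the points j h with j \<le> m, which lie in the disc of radius m and have modulus at most m
  h.\<close>

lemma fdiff_holomorphic:
  assumes "f holomorphic_on UNIV"
  shows "\<exists>C\<ge>0. \<forall>h. 0 < h \<longrightarrow> h \<le> 1 \<longrightarrow> cmod (fdiff m h (\<lambda>x. f (of_real x))) \<le> C * h ^ m"
proof -
  obtain a H where H: "H holomorphic_on UNIV" and f: "\<And>z. f z = (\<Sum>i<m. a i * z ^ i) + z ^ m * H z"
    using holomorphic_Taylor_remainder[OF assms] by blast
  have "compact (H ` cball 0 (real m))"
    using H by (intro compact_continuous_image holomorphic_on_imp_continuous_on) (auto intro: holomorphic_on_subset)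
  then have "bounded (H ` cball 0 (real m))" by (rule compact_imp_bounded)
  then obtain B where "\<forall>y\<in>H ` cball 0 (real m). cmod y \<le> B" unfolding bounded_iff by blast
  then have B: "cmod (H z) \<le> B" if "z \<in> cball 0 (real m)" for z using that by blast
  have B0: "0 \<le> B" using B[of 0] norm_ge_zero order_trans by (simp, blast)
  have "cmod (fdiff m h (\<lambda>x. f (of_real x))) \<le> 2 ^ m * (real m ^ m * B) * h ^ m" if "0 < h" "h \<le> 1" for h
  proof -
    have "fdiff m h (\<lambda>x. f (of_real x)) = fdiff m h (\<lambda>x. of_real x ^ m * H (of_real x))"
      unfolding f fdiff_add fdiff_sum fdiff_cmult by (simp add: fdiff_power)
    also have "cmod \<dots> \<le> 2 ^ m * ((real m * h) ^ m * B)"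
    proof (rule fdiff_norm_le)
      fix j assume j: "j \<le> m"
      have le: "real j * h \<le> real m * h" using j that by (intro mult_right_mono) auto
      have "real m * h \<le> real m" using that by (simp add: mult_left_le)
      moreover have "cmod (of_real (real j * h)) = real j * h" using that by (simp add: norm_mult)
      ultimately show "cmod (of_real (real j * h) ^ m * H (of_real (real j * h))) \<le> (real m * h) ^ m * B"
        unfolding norm_mult[of "of_real (real j * h) ^ m"] norm_power using le that
        by (intro mult_mono power_mono B) (auto intro: order_trans[OF le])
    qed
    finally show ?thesis by (simp add: power_mult_distrib mult_ac)
  qed
  then show ?thesis using B0 by (intro exI[of _ "2 ^ m * (real m ^ m * B)"]) auto
qed

text \<open>
  The map \<open>rotF t\<close> is the flow acting on a single value; its real derivative at \<open>a\<close> sends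
  \<open>b\<close> to \<open>rotA t a * b + rotB t a * cnj b\<close>.
\<close>

definition rotF :: "real \<Rightarrow> complex \<Rightarrow> complex" where
  "rotF t w = exp (- \<i> * of_real t * of_real ((cmod w)\<^sup>2)) * w"

definition rotA :: "real \<Rightarrow> complex \<Rightarrow> complex" where
  "rotA t a = exp (- \<i> * of_real t * of_real ((cmod a)\<^sup>2)) * (1 - \<i> * of_real t * of_real ((cmod a)\<^sup>2))"

definition rotB :: "real \<Rightarrow> complex \<Rightarrow> complex" where
  "rotB t a = exp (- \<i> * of_real t * of_real ((cmod a)\<^sup>2)) * (- \<i> * of_real t * a\<^sup>2)"

lemma cmod_rot: "cmod (exp (- \<i> * of_real t * of_real x) * w) = cmod w"
  by (simp add: norm_mult norm_exp_eq_Re)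

text \<open>With r = t |a|^2 the two moduli are |1 - i r| and |r|. The left side is half the squared
  Hilbert-Schmidt norm of the real derivative; it exceeds 1 for r \<noteq> 0 because circles of
  different radius rotate at different speeds, so that the flow shears. This excess separates the
  two measures.\<close>

lemma rotA_rotB_norm: "(cmod (rotA t a))\<^sup>2 + (cmod (rotB t a))\<^sup>2 = 1 + 2 * t\<^sup>2 * (cmod a) ^ 4"
proof -
  have "(cmod (rotA t a))\<^sup>2 = 1 + (t * (cmod a)\<^sup>2)\<^sup>2"
    unfolding rotA_def cmod_rot by (simp add: cmod_power2)
  moreover have "(cmod (rotB t a))\<^sup>2 = (t * (cmod a)\<^sup>2)\<^sup>2"
    unfolding rotB_def cmod_rot by (simp add: norm_mult norm_power power_mult_distrib)
  ultimately show ?thesis by (simp add: power_mult_distrib)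
qed

lemma iexp_diff_le: "cmod (exp (- \<i> * of_real t * of_real x) - exp (- \<i> * of_real t * of_real y)) \<le> \<bar>t\<bar> * \<bar>x - y\<bar>"
proof -
  have "exp (- \<i> * of_real t * of_real x) - exp (- \<i> * of_real t * of_real y)
      = exp (- \<i> * of_real t * of_real y) * (exp (\<i> * of_real (- t * (x - y))) - 1)"
    unfolding right_diff_distrib exp_add[symmetric] by (simp add: algebra_simps)
  then have "cmod (exp (- \<i> * of_real t * of_real x) - exp (- \<i> * of_real t * of_real y))
      = cmod (exp (\<i> * of_real (- t * (x - y))) - 1)"
    by (simp only: cmod_rot)
  also have "\<dots> \<le> \<bar>- t * (x - y)\<bar>"
    using iexp_approx1[of "- t * (x - y)" 0] by simp
  finally show ?thesis by (simp add: abs_mult)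
qed

lemma cmod_square_diff_le:
  assumes "cmod a \<le> R" "cmod b \<le> R"
  shows "\<bar>(cmod a)\<^sup>2 - (cmod b)\<^sup>2\<bar> \<le> 2 * R * cmod (a - b)"
proof -
  have "\<bar>(cmod a)\<^sup>2 - (cmod b)\<^sup>2\<bar> = \<bar>cmod a + cmod b\<bar> * \<bar>cmod a - cmod b\<bar>"
    unfolding abs_mult[symmetric] by (simp add: power2_eq_square algebra_simps)
  also have "\<dots> \<le> (2 * R) * cmod (a - b)"
    using assms order_trans[OF norm_ge_zero assms(1)] by (intro mult_mono norm_triangle_ineq3) auto
  finally show ?thesis .
qed

lemma rotF_lipschitz:
  assumes "cmod a \<le> R" "cmod b \<le> R"
  shows "cmod (rotF t a - rotF t b) \<le> (1 + 2 * \<bar>t\<bar> * R\<^sup>2) * cmod (a - b)"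
proof -
  have R: "0 \<le> R" using assms(1) norm_ge_zero order_trans by blast
  let ?e = "\<lambda>w. exp (- \<i> * of_real t * of_real ((cmod w)\<^sup>2))"
  have "rotF t a - rotF t b = ?e a * (a - b) + (?e a - ?e b) * b"
    by (simp add: rotF_def algebra_simps)
  then have "cmod (rotF t a - rotF t b) \<le> cmod (a - b) + cmod (?e a - ?e b) * cmod b"
    using norm_triangle_ineq[of "?e a * (a - b)" "(?e a - ?e b) * b"] by (simp only: cmod_rot norm_mult[of "?e a - ?e b"])
  also have "cmod (?e a - ?e b) * cmod b \<le> (\<bar>t\<bar> * (2 * R * cmod (a - b))) * R"
    using assms R by (intro mult_mono order_trans[OF iexp_diff_le] mult_left_mono cmod_square_diff_le mult_nonneg_nonneg) auto
  finally show ?thesis by (simp add: algebra_simps power2_eq_square)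
qed

text \<open>Allows the derivative of the flow at a nearby value to be replaced by the one at the
  base value. Both coefficients are a common phase times a polynomial in a and its conjugate, and
  \<open>key\<close> treats the phase and the other factor separately.\<close>

lemma rot_coeff_lipschitz:
  assumes "cmod a \<le> R" "cmod b \<le> R"
  shows "cmod (rotA t a - rotA t b) \<le> (4 * \<bar>t\<bar> * R * (1 + \<bar>t\<bar> * R\<^sup>2)) * cmod (a - b)"
    and "cmod (rotB t a - rotB t b) \<le> (4 * \<bar>t\<bar> * R * (1 + \<bar>t\<bar> * R\<^sup>2)) * cmod (a - b)"
proof -
  have R: "0 \<le> R" using assms(1) norm_ge_zero order_trans by blast
  let ?e = "\<lambda>w. exp (- \<i> * of_real t * of_real ((cmod w)\<^sup>2))"
  let ?d = "cmod (a - b)"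
  note sq = cmod_square_diff_le[OF assms]
  have ee: "cmod (?e a - ?e b) \<le> \<bar>t\<bar> * (2 * R * ?d)"
    by (intro order_trans[OF iexp_diff_le] mult_left_mono sq) auto
  have key: "cmod (?e a * x - ?e b * y) \<le> (4 * \<bar>t\<bar> * R * (1 + \<bar>t\<bar> * R\<^sup>2)) * ?d"
    if "cmod (x - y) \<le> \<bar>t\<bar> * (2 * R * ?d)" "cmod y \<le> 1 + \<bar>t\<bar> * R\<^sup>2" for x y
  proof -
    have "cmod (?e a * x - ?e b * y) \<le> cmod (x - y) + cmod (?e a - ?e b) * cmod y"
      using norm_triangle_ineq[of "?e a * (x - y)" "(?e a - ?e b) * y"]
      by (simp only: cmod_rot norm_mult[of "?e a - ?e b"]) (simp add: algebra_simps)
    also have "\<dots> \<le> \<bar>t\<bar> * (2 * R * ?d) * 1 + \<bar>t\<bar> * (2 * R * ?d) * (1 + \<bar>t\<bar> * R\<^sup>2)"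
      using that ee R by (intro add_mono mult_mono) auto
    also have "\<dots> \<le> \<bar>t\<bar> * (2 * R * ?d) * (1 + \<bar>t\<bar> * R\<^sup>2) + \<bar>t\<bar> * (2 * R * ?d) * (1 + \<bar>t\<bar> * R\<^sup>2)"
      using R by (intro add_mono mult_left_mono order_refl) auto
    finally show ?thesis by (simp add: algebra_simps)
  qed
  have b2: "(cmod b)\<^sup>2 \<le> R\<^sup>2" using assms by (intro power_mono) auto
  show "cmod (rotA t a - rotA t b) \<le> (4 * \<bar>t\<bar> * R * (1 + \<bar>t\<bar> * R\<^sup>2)) * ?d"
    unfolding rotA_def
  proof (rule key)
    have "(1 - \<i> * of_real t * of_real ((cmod a)\<^sup>2)) - (1 - \<i> * of_real t * of_real ((cmod b)\<^sup>2))
      = - \<i> * of_real (t * ((cmod a)\<^sup>2 - (cmod b)\<^sup>2))" by (simp add: algebra_simps)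
    then have "cmod ((1 - \<i> * of_real t * of_real ((cmod a)\<^sup>2)) - (1 - \<i> * of_real t * of_real ((cmod b)\<^sup>2)))
      = \<bar>t\<bar> * \<bar>(cmod a)\<^sup>2 - (cmod b)\<^sup>2\<bar>" by (simp only: norm_mult norm_of_real abs_mult) simp
    then show "cmod ((1 - \<i> * of_real t * of_real ((cmod a)\<^sup>2)) - (1 - \<i> * of_real t * of_real ((cmod b)\<^sup>2)))
      \<le> \<bar>t\<bar> * (2 * R * ?d)" using sq by (simp add: mult_left_mono)
    have "cmod (1 - \<i> * of_real t * of_real ((cmod b)\<^sup>2)) \<le> 1 + \<bar>t\<bar> * (cmod b)\<^sup>2"
      using norm_triangle_ineq4[of 1 "\<i> * of_real t * of_real ((cmod b)\<^sup>2)"] by (simp add: norm_mult norm_power)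
    also have "\<dots> \<le> 1 + \<bar>t\<bar> * R\<^sup>2" using b2 by (simp add: mult_left_mono)
    finally show "cmod (1 - \<i> * of_real t * of_real ((cmod b)\<^sup>2)) \<le> 1 + \<bar>t\<bar> * R\<^sup>2" .
  qed
  show "cmod (rotB t a - rotB t b) \<le> (4 * \<bar>t\<bar> * R * (1 + \<bar>t\<bar> * R\<^sup>2)) * ?d"
    unfolding rotB_def
  proof (rule key)
    have "- \<i> * of_real t * a\<^sup>2 - - \<i> * of_real t * b\<^sup>2 = - \<i> * of_real t * (a + b) * (a - b)"
      by (simp add: algebra_simps power2_eq_square)
    then have "cmod (- \<i> * of_real t * a\<^sup>2 - - \<i> * of_real t * b\<^sup>2) = \<bar>t\<bar> * (cmod (a + b) * ?d)"
      by (simp only: norm_mult norm_of_real) simp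
    also have "\<dots> \<le> \<bar>t\<bar> * (2 * R * ?d)"
      using assms by (intro mult_left_mono mult_right_mono norm_triangle_le) auto
    finally show "cmod (- \<i> * of_real t * a\<^sup>2 - - \<i> * of_real t * b\<^sup>2) \<le> \<bar>t\<bar> * (2 * R * ?d)" .
    have "cmod (- \<i> * of_real t * b\<^sup>2) = \<bar>t\<bar> * (cmod b)\<^sup>2" by (simp add: norm_mult norm_power)
    also have "\<dots> \<le> 1 + \<bar>t\<bar> * R\<^sup>2" using b2 by (simp add: mult_left_mono add_increasing)
    finally show "cmod (- \<i> * of_real t * b\<^sup>2) \<le> 1 + \<bar>t\<bar> * R\<^sup>2" .
  qed
qed

text \<open>The change \<delta> of the squared modulus is exactly 2 Re (cnj a b) + |b|^2. Expanding
  the phase to first order in \<delta> produces the linear terms of \<open>rotA\<close> and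
  \<open>rotB\<close>. What remains is -i t a |b|^2 - i t b \<delta> + \<rho> (a + b), and
  |\<delta>| \<le> 3 R |b| gives 4 = 1 + 3 from the first two terms and 9 R^3 from the last.\<close>

lemma rotF_expansion:
  assumes R: "cmod a \<le> R" "cmod b \<le> R"
  shows "cmod (rotF t (a + b) - rotF t a - (rotA t a * b + rotB t a * cnj b))
    \<le> (4 * \<bar>t\<bar> * R + 9 * t\<^sup>2 * R ^ 3) * (cmod b)\<^sup>2"
proof -
  have R0: "0 \<le> R" using assms(1) norm_ge_zero order_trans by blast
  define \<delta> where "\<delta> = (cmod (a + b))\<^sup>2 - (cmod a)\<^sup>2"
  define \<rho> where "\<rho> = exp (\<i> * of_real (- t * \<delta>)) - (1 - \<i> * of_real t * of_real \<delta>)"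
  let ?e = "exp (- \<i> * of_real t * of_real ((cmod a)\<^sup>2))"
  have \<delta>: "complex_of_real \<delta> = cnj a * b + a * cnj b + of_real ((cmod b)\<^sup>2)"
    unfolding \<delta>_def of_real_diff complex_norm_square by (simp add: algebra_simps)
  have "cmod (complex_of_real \<delta>) \<le> cmod (cnj a * b) + cmod (a * cnj b) + cmod (of_real ((cmod b)\<^sup>2) :: complex)"
    unfolding \<delta> by (intro norm_triangle_mono order_refl)
  then have "\<bar>\<delta>\<bar> \<le> 2 * (cmod a * cmod b) + cmod b * cmod b"
    by (simp add: norm_mult norm_power power2_eq_square)
  also have "\<dots> \<le> 2 * (R * cmod b) + R * cmod b"
    using R by (intro add_mono mult_left_mono mult_right_mono) auto
  finally have \<delta>le: "\<bar>\<delta>\<bar> \<le> 3 * R * cmod b" by simp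
  have "cmod \<rho> \<le> (t * \<delta>)\<^sup>2 / 2"
    using iexp_approx1[of "- t * \<delta>" 1] by (simp add: \<rho>_def power2_eq_square abs_mult mult.assoc)
  also have "\<dots> \<le> t\<^sup>2 * (3 * R * cmod b)\<^sup>2 / 2"
    unfolding power_mult_distrib[of t] using power_mono[OF \<delta>le, of 2] by (intro divide_right_mono mult_left_mono) auto
  finally have \<rho>le: "cmod \<rho> \<le> t\<^sup>2 * (3 * R * cmod b)\<^sup>2 / 2" .
  have "exp (- \<i> * of_real t * of_real ((cmod (a + b))\<^sup>2)) = ?e * exp (\<i> * of_real (- t * \<delta>))"
    unfolding exp_add[symmetric] \<delta>_def by (rule arg_cong[where f = exp]) (simp add: algebra_simps)
  then have "rotF t (a + b) = ?e * ((1 - \<i> * of_real t * of_real \<delta> + \<rho>) * (a + b))"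
    by (simp add: rotF_def \<rho>_def)
  then have "rotF t (a + b) - rotF t a - (rotA t a * b + rotB t a * cnj b)
    = ?e * ((1 - \<i> * of_real t * of_real \<delta> + \<rho>) * (a + b) - a
        - ((1 - \<i> * of_real t * of_real ((cmod a)\<^sup>2)) * b + (- \<i> * of_real t * a\<^sup>2) * cnj b))"
    by (simp add: rotF_def rotA_def rotB_def algebra_simps)
  also have "(1 - \<i> * of_real t * of_real \<delta> + \<rho>) * (a + b) - a
        - ((1 - \<i> * of_real t * of_real ((cmod a)\<^sup>2)) * b + (- \<i> * of_real t * a\<^sup>2) * cnj b)
      = - \<i> * of_real t * a * of_real ((cmod b)\<^sup>2) - \<i> * of_real t * b * of_real \<delta> + \<rho> * (a + b)"
    unfolding \<delta> complex_norm_square by (simp add: algebra_simps power2_eq_square)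
  finally have "cmod (rotF t (a + b) - rotF t a - (rotA t a * b + rotB t a * cnj b))
    = cmod (- \<i> * of_real t * a * of_real ((cmod b)\<^sup>2) - \<i> * of_real t * b * of_real \<delta> + \<rho> * (a + b))"
    by (simp only: cmod_rot)
  also have "\<dots> \<le> cmod (- \<i> * of_real t * a * of_real ((cmod b)\<^sup>2)) + cmod (\<i> * of_real t * b * of_real \<delta>) + cmod (\<rho> * (a + b))"
    by (intro order_trans[OF norm_triangle_ineq] add_mono norm_triangle_ineq4 order_refl)
  also have "\<dots> = \<bar>t\<bar> * cmod a * (cmod b)\<^sup>2 + \<bar>t\<bar> * cmod b * \<bar>\<delta>\<bar> + cmod \<rho> * cmod (a + b)"
    by (simp add: norm_mult norm_power)
  also have "\<dots> \<le> \<bar>t\<bar> * R * (cmod b)\<^sup>2 + \<bar>t\<bar> * cmod b * (3 * R * cmod b) + t\<^sup>2 * (3 * R * cmod b)\<^sup>2 / 2 * (2 * R)"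
    using R R0 norm_triangle_ineq[of a b] by (intro add_mono mult_mono \<rho>le \<delta>le) auto
  also have "\<dots> = (4 * \<bar>t\<bar> * R + 9 * t\<^sup>2 * R ^ 3) * (cmod b)\<^sup>2"
    by (simp add: algebra_simps power2_eq_square power3_eq_cube)
  finally show ?thesis .
qed

text \<open>The modulus squared is not holomorphic, but for real x it equals P(x) Q(x), where Q has
  the conjugated coefficients. Hence the flow of a polynomial extends to an entire function.\<close>

lemma rotF_poly_fdiff:
  "\<exists>C\<ge>0. \<forall>h. 0 < h \<longrightarrow> h \<le> 1 \<longrightarrow> cmod (fdiff m h (\<lambda>x. rotF t (\<Sum>i\<le>d. p i * of_real x ^ i))) \<le> C * h ^ m"
proof -
  define P where "P z = (\<Sum>i\<le>d. p i * z ^ i)" for z :: complex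
  define Q where "Q z = (\<Sum>i\<le>d. cnj (p i) * z ^ i)" for z :: complex
  have "(\<lambda>z. exp (- \<i> * of_real t * (P z * Q z)) * P z) holomorphic_on UNIV"
    unfolding P_def Q_def by (intro holomorphic_intros)
  from fdiff_holomorphic[OF this, of m] show ?thesis
    by (simp only: rotF_def complex_norm_square P_def[symmetric]) (simp add: P_def Q_def cnj_sum)
qed

text \<open>Write U = P + r. The term h^m is the difference of the flow of P, the term h^(2\<tau>)
  is the quadratic error in r, and h^(1+\<tau>) arises from using the derivative at P(0) in place of
  P(x), where |P(x) - P(0)| = O(h). In the linear term r may be replaced by U, because the m-th
  difference of P vanishes.\<close>

lemma rotF_fdiff_expansion:
  fixes U :: "real \<Rightarrow> complex" and h :: "nat \<Rightarrow> real"
  assumes "d < m" and h: "\<And>k. 0 < h k" "\<And>k. h k \<le> 1" and \<tau>: "0 < \<tau>"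
    and r: "\<And>k j. j \<le> m \<Longrightarrow> cmod (U (real j * h k) - (\<Sum>i\<le>d. p i * of_real (real j * h k) ^ i)) \<le> K * h k powr \<tau>"
  shows "\<exists>C. \<forall>k. cmod (fdiff m (h k) (\<lambda>x. rotF t (U x))
      - (rotA t (p 0) * fdiff m (h k) U + rotB t (p 0) * cnj (fdiff m (h k) U)))
    \<le> C * (h k ^ m + h k powr (2 * \<tau>) + h k powr (1 + \<tau>))"
proof -
  define P where "P x = (\<Sum>i\<le>d. p i * of_real x ^ i)" for x :: real
  define R0 where "R0 = (\<Sum>i\<le>d. cmod (p i) * real m ^ i)"
  \<comment> \<open>A common bound for |P| on [0, m] and for |r| at the sample points, as the
    expansion and the Lipschitz estimates require.\<close>
  define R where "R = R0 + \<bar>K\<bar>"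
  define C1 where "C1 = 4 * \<bar>t\<bar> * R + 9 * t\<^sup>2 * R ^ 3"
  define C2 where "C2 = 4 * \<bar>t\<bar> * R * (1 + \<bar>t\<bar> * R\<^sup>2)"
  define E where "E x = rotF t (U x) - rotF t (P x)
    - (rotA t (p 0) * (U x - P x) + rotB t (p 0) * cnj (U x - P x))" for x
  have R0: "0 \<le> R0" unfolding R0_def by (intro sum_nonneg) auto
  have R: "0 \<le> R" using R0 by (simp add: R_def)
  have C: "0 \<le> C1" "0 \<le> C2" using R by (auto simp: C1_def C2_def)
  obtain C3 where C3: "C3 \<ge> 0" "\<And>h. 0 < h \<Longrightarrow> h \<le> 1 \<Longrightarrow> cmod (fdiff m h (\<lambda>x. rotF t (P x))) \<le> C3 * h ^ m"
    using rotF_poly_fdiff[of m t p d] unfolding P_def by blast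
  have P0: "P 0 = p 0" unfolding P_def by (simp add: power_0_left if_distrib[of "\<lambda>x. _ * x"] cong: if_cong)
  have Pb: "cmod (P x) \<le> R" and Pd: "cmod (P x - P 0) \<le> R0 * x" if "0 \<le> x" "x \<le> real m" for x
  proof -
    have m1: "1 \<le> real m" using assms(1) by simp
    have "cmod (P x) \<le> R0"
      unfolding P_def R0_def
      by (intro sum_norm_le) (use that in \<open>auto simp: norm_mult norm_power intro!: mult_left_mono power_mono\<close>)
    then show "cmod (P x) \<le> R" by (simp add: R_def)
    have "cmod (p i * of_real x ^ i - p i * of_real 0 ^ i) \<le> cmod (p i) * real m ^ i * x" for i
    proof (cases i)
      case (Suc l)
      have "x ^ Suc l \<le> real m ^ Suc l * x"
        using that m1 mult_left_mono[of 1 "real m" "real m ^ l"]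
        by (auto intro!: mult_right_mono order_trans[OF power_mono[of x "real m" l]] simp: mult.commute[of x])
      then have "cmod (p i) * x ^ Suc l \<le> cmod (p i) * (real m ^ Suc l * x)"
        by (rule mult_left_mono) simp
      with Suc that show ?thesis by (simp add: norm_mult norm_power mult_ac)
    qed (use that in simp)
    then show "cmod (P x - P 0) \<le> R0 * x"
      unfolding P_def R0_def sum_distrib_right sum_subtractf[symmetric] by (intro sum_norm_le)
  qed
  have Eb: "cmod (E (real j * h k)) \<le> C1 * K\<^sup>2 * h k powr (2 * \<tau>) + 2 * C2 * R0 * real m * \<bar>K\<bar> * h k powr (1 + \<tau>)"
    if j: "j \<le> m" for j k
  proof -
    define x where "x = real j * h k"
    define r where "r = U x - P x"
    have "real j * h k \<le> real m * 1" using j h[of k] by (intro mult_mono) auto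
    then have x: "0 \<le> x" "x \<le> real m" using h(1)[of k] by (auto simp: x_def)
    have xh: "x \<le> real m * h k" unfolding x_def using j h(1)[of k] by (intro mult_right_mono) auto
    have rK: "cmod r \<le> \<bar>K\<bar> * h k powr \<tau>"
    proof -
      have "cmod r \<le> K * h k powr \<tau>" using assms(5)[OF j, of k] by (simp add: r_def P_def x_def)
      also have "\<dots> \<le> \<bar>K\<bar> * h k powr \<tau>" by (intro mult_right_mono) auto
      finally show ?thesis .
    qed
    have "h k powr \<tau> \<le> 1" using h[of k] \<tau> by (intro powr_le1) auto
    then have rR: "cmod r \<le> R"
      using order_trans[OF rK, of R] mult_left_mono[of "h k powr \<tau>" 1 "\<bar>K\<bar>"] R0 by (simp add: R_def)
    have "E x = (rotF t (P x + r) - rotF t (P x) - (rotA t (P x) * r + rotB t (P x) * cnj r))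
        + ((rotA t (P x) - rotA t (P 0)) * r + (rotB t (P x) - rotB t (P 0)) * cnj r)"
      by (simp add: E_def r_def P0 algebra_simps)
    then have "cmod (E x) \<le> cmod (rotF t (P x + r) - rotF t (P x) - (rotA t (P x) * r + rotB t (P x) * cnj r))
        + (cmod ((rotA t (P x) - rotA t (P 0)) * r) + cmod ((rotB t (P x) - rotB t (P 0)) * cnj r))"
      by (simp only:) (intro norm_triangle_mono order_refl norm_triangle_ineq)
    also have "\<dots> \<le> C1 * (cmod r)\<^sup>2 + (C2 * cmod (P x - P 0) * cmod r + C2 * cmod (P x - P 0) * cmod r)"
      unfolding norm_mult complex_mod_cnj C1_def C2_def
      by (intro add_mono mult_right_mono rot_coeff_lipschitz rotF_expansion Pb x rR norm_ge_zero) auto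
    also have "\<dots> \<le> C1 * (\<bar>K\<bar> * h k powr \<tau>)\<^sup>2 + (C2 * (R0 * (real m * h k)) * (\<bar>K\<bar> * h k powr \<tau>) + C2 * (R0 * (real m * h k)) * (\<bar>K\<bar> * h k powr \<tau>))"
    proof -
      have "cmod (P x - P 0) \<le> R0 * (real m * h k)"
        using Pd[OF x] mult_left_mono[OF xh R0] by linarith
      with rK show ?thesis
        using C h(1)[of k] R0 by (intro add_mono mult_mono power_mono mult_left_mono) auto
    qed
    also have "\<dots> = C1 * K\<^sup>2 * h k powr (2 * \<tau>) + 2 * C2 * R0 * real m * \<bar>K\<bar> * h k powr (1 + \<tau>)"
    proof -
      have "h k powr (1 + \<tau>) = h k * h k powr \<tau>" using h(1)[of k] by (simp add: powr_add)
      moreover have "h k powr (2 * \<tau>) = (h k powr \<tau>)\<^sup>2" by (simp add: power2_eq_square powr_add[symmetric])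
      ultimately show ?thesis by (simp add: power_mult_distrib)
    qed
    finally show ?thesis unfolding x_def .
  qed
  have split: "fdiff m h (\<lambda>x. rotF t (U x))
      - (rotA t (p 0) * fdiff m h U + rotB t (p 0) * cnj (fdiff m h U))
     = fdiff m h (\<lambda>x. rotF t (P x)) + fdiff m h E" for h
  proof -
    have P_zero: "fdiff m h P = 0" unfolding P_def by (rule fdiff_poly[OF assms(1)])
    have "(\<lambda>x. rotF t (U x)) = (\<lambda>x. rotF t (P x) + ((rotA t (p 0) * (U x - P x) + rotB t (p 0) * cnj (U x - P x)) + E x))"
      by (simp add: E_def fun_eq_iff)
    then have "fdiff m h (\<lambda>x. rotF t (U x)) = fdiff m h (\<lambda>x. rotF t (P x))
        + ((rotA t (p 0) * fdiff m h (\<lambda>x. U x - P x) + rotB t (p 0) * cnj (fdiff m h (\<lambda>x. U x - P x))) + fdiff m h E)"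
      by (simp only: fdiff_add fdiff_cmult fdiff_cnj)
    then show ?thesis by (simp add: fdiff_diff P_zero)
  qed
  define c1 where "c1 = C1 * K\<^sup>2"
  define c2 where "c2 = 2 * C2 * R0 * real m * \<bar>K\<bar>"
  have c: "0 \<le> c1" "0 \<le> c2" using C R0 by (auto simp: c1_def c2_def)
  let ?C = "C3 + 2 ^ m * c1 + 2 ^ m * c2"
  have "cmod (fdiff m (h k) (\<lambda>x. rotF t (U x))
      - (rotA t (p 0) * fdiff m (h k) U + rotB t (p 0) * cnj (fdiff m (h k) U)))
    \<le> ?C * (h k ^ m + h k powr (2 * \<tau>) + h k powr (1 + \<tau>))" for k
  proof -
    have "cmod (fdiff m (h k) E) \<le> 2 ^ m * (c1 * h k powr (2 * \<tau>) + c2 * h k powr (1 + \<tau>))"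
      using fdiff_norm_le[of m E "h k", OF Eb] unfolding c1_def c2_def by blast
    moreover have "cmod (fdiff m (h k) (\<lambda>x. rotF t (P x))) \<le> C3 * h k ^ m"
      using C3(2) h by blast
    ultimately have "cmod (fdiff m (h k) (\<lambda>x. rotF t (P x)) + fdiff m (h k) E)
        \<le> C3 * h k ^ m + 2 ^ m * c1 * h k powr (2 * \<tau>) + 2 ^ m * c2 * h k powr (1 + \<tau>)"
      using norm_triangle_ineq[of "fdiff m (h k) (\<lambda>x. rotF t (P x))" "fdiff m (h k) E"] by (simp add: algebra_simps)
    also have "\<dots> \<le> ?C * h k ^ m + ?C * h k powr (2 * \<tau>) + ?C * h k powr (1 + \<tau>)"
      using C3(1) c h(1)[of k] by (intro add_mono mult_right_mono) auto
    finally show ?thesis unfolding split by (simp add: distrib_left)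
  qed
  then show ?thesis by blast
qed

section \<open>Averages over disjoint frequency blocks\<close>

text \<open>The constant is 2 * 4^4, from |x|/4 \<le> e^(|x|/4) raised to the fourth power and e^|x|
  \<le> 2 cosh x.\<close>

lemma power4_le_cosh: "(x :: real) ^ 4 \<le> 512 * cosh x"
proof -
  have "\<bar>x\<bar> / 4 \<le> exp (\<bar>x\<bar> / 4)" using exp_ge_add_one_self[of "\<bar>x\<bar> / 4"] by linarith
  then have "(\<bar>x\<bar> / 4) ^ 4 \<le> exp (\<bar>x\<bar> / 4) ^ 4" by (intro power_mono) auto
  also have "\<dots> = exp \<bar>x\<bar>" by (simp add: exp_of_nat_mult[symmetric])
  also have "\<dots> \<le> 2 * cosh x" by (simp add: cosh_field_def abs_if)
  finally show ?thesis by (simp add: power_divide)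
qed

lemma cmod_power4_le: "cmod z ^ 4 \<le> 1024 * (cosh (Re z) + cosh (Im z))"
proof -
  have "cmod z ^ 4 = ((cmod z)\<^sup>2)\<^sup>2" by (simp flip: power_mult)
  also have "\<dots> = ((Re z)\<^sup>2 + (Im z)\<^sup>2)\<^sup>2" by (simp add: cmod_power2)
  also have "\<dots> \<le> 2 * (Re z ^ 4 + Im z ^ 4)"
    using zero_le_power2[of "(Re z)\<^sup>2 - (Im z)\<^sup>2"]
    by (simp add: power2_eq_square eval_nat_numeral algebra_simps)
  also have "\<dots> \<le> 2 * (512 * cosh (Re z) + 512 * cosh (Im z))"
    by (intro mult_left_mono add_mono power4_le_cosh) auto
  finally show ?thesis by simp
qed

context prob_space
begin

text \<open>Averaging over \<open>J\<^sup>2\<close> terms makes the mean square of the averages summable in \<open>J\<close>.\<close>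

lemma AE_square_averages_tendsto_0:
  fixes Z :: "nat \<Rightarrow> 'a \<Rightarrow> complex"
  assumes [measurable]: "\<And>k. Z k \<in> borel_measurable M"
    and int: "\<And>k. integrable M (\<lambda>\<omega>. (cmod (Z k \<omega>))\<^sup>2)" "\<And>k. (\<integral>\<omega>. (cmod (Z k \<omega>))\<^sup>2 \<partial>M) \<le> C"
    and orth: "\<And>j k. j \<noteq> k \<Longrightarrow> integrable M (\<lambda>\<omega>. Z j \<omega> * cnj (Z k \<omega>))"
      "\<And>j k. j \<noteq> k \<Longrightarrow> (\<integral>\<omega>. Z j \<omega> * cnj (Z k \<omega>) \<partial>M) = 0"
  shows "AE \<omega> in M. (\<lambda>J. (\<Sum>k<(Suc J)\<^sup>2. Z k \<omega>) / of_nat ((Suc J)\<^sup>2)) \<longlonglongrightarrow> 0"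
proof -
  define A where "A J \<omega> = (\<Sum>k<(Suc J)\<^sup>2. Z k \<omega>) / of_nat ((Suc J)\<^sup>2)" for J \<omega>
  have C: "0 \<le> C" using order_trans[OF Bochner_Integration.integral_nonneg int(2)[of 0]] by simp
  have sq: "complex_of_real ((cmod (Z k \<omega>))\<^sup>2) = Z k \<omega> * cnj (Z k \<omega>)" for k \<omega>
    by (rule complex_norm_square)
  have iZ: "integrable M (\<lambda>\<omega>. Z j \<omega> * cnj (Z k \<omega>))" for j k
  proof (cases "j = k")
    case True
    have "integrable M (\<lambda>\<omega>. complex_of_real ((cmod (Z k \<omega>))\<^sup>2))"
      by (rule integrable_of_real[OF int(1)])
    with True show ?thesis by (simp only: sq)
  qed (rule orth(1))
  have eZ: "(\<integral>\<omega>. Z j \<omega> * cnj (Z k \<omega>) \<partial>M) = (if j = k then of_real (\<integral>\<omega>. (cmod (Z k \<omega>))\<^sup>2 \<partial>M) else 0)" for j k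
    using orth(2)[of j k] by (simp add: sq[symmetric] del: of_real_power)
  have e: "complex_of_real ((cmod (\<Sum>k<n. Z k \<omega>))\<^sup>2) = (\<Sum>j<n. \<Sum>k<n. Z j \<omega> * cnj (Z k \<omega>))" for n \<omega>
    unfolding complex_norm_square cnj_sum sum_product ..
  have iS: "integrable M (\<lambda>\<omega>. (cmod (\<Sum>k<n. Z k \<omega>))\<^sup>2)" for n
  proof -
    have "integrable M (\<lambda>\<omega>. complex_of_real ((cmod (\<Sum>k<n. Z k \<omega>))\<^sup>2))"
      unfolding e by (intro Bochner_Integration.integrable_sum iZ)
    from integrable_Re[OF this] show ?thesis by simp
  qed
  \<comment> \<open>Orthogonality leaves only the diagonal, so the second moment of the sum grows at
    most linearly in \<open>n\<close>.\<close>
  have eS: "(\<integral>\<omega>. (cmod (\<Sum>k<n. Z k \<omega>))\<^sup>2 \<partial>M) = (\<Sum>k<n. \<integral>\<omega>. (cmod (Z k \<omega>))\<^sup>2 \<partial>M)" for n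
  proof -
    have "complex_of_real (\<integral>\<omega>. (cmod (\<Sum>k<n. Z k \<omega>))\<^sup>2 \<partial>M) = (\<integral>\<omega>. complex_of_real ((cmod (\<Sum>k<n. Z k \<omega>))\<^sup>2) \<partial>M)"
      by (rule integral_complex_of_real[symmetric])
    also have "\<dots> = (\<Sum>j<n. \<Sum>k<n. if j = k then of_real (\<integral>\<omega>. (cmod (Z k \<omega>))\<^sup>2 \<partial>M) else 0)"
      unfolding e by (simp add: Bochner_Integration.integral_sum iZ eZ)
    also have "\<dots> = complex_of_real (\<Sum>k<n. \<integral>\<omega>. (cmod (Z k \<omega>))\<^sup>2 \<partial>M)"
      by simp
    finally show ?thesis by (simp only: of_real_eq_iff)
  qed
  have "AE \<omega> in M. summable (\<lambda>J. (cmod (A J \<omega>))\<^sup>2)"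
  proof (rule AE_summable_if_nn_integral_le)
    show "(\<lambda>\<omega>. (cmod (A J \<omega>))\<^sup>2) \<in> borel_measurable M" for J unfolding A_def by measurable
    show "summable (\<lambda>J. C * (1 / real (Suc J) ^ 2))" by (intro summable_mult summable_inverse_Suc_square)
    fix J
    have A2: "(cmod (A J \<omega>))\<^sup>2 = (cmod (\<Sum>k<(Suc J)\<^sup>2. Z k \<omega>))\<^sup>2 / (real ((Suc J)\<^sup>2))\<^sup>2" for \<omega>
      unfolding A_def norm_divide power_divide norm_of_nat ..
    have "(\<integral>\<^sup>+\<omega>. ennreal ((cmod (A J \<omega>))\<^sup>2) \<partial>M) = ennreal (\<integral>\<omega>. (cmod (A J \<omega>))\<^sup>2 \<partial>M)"
      unfolding A2 by (intro nn_integral_eq_integral Bochner_Integration.integrable_divide iS) auto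
    also have "(\<integral>\<omega>. (cmod (A J \<omega>))\<^sup>2 \<partial>M) = (\<Sum>k<(Suc J)\<^sup>2. \<integral>\<omega>. (cmod (Z k \<omega>))\<^sup>2 \<partial>M) / (real ((Suc J)\<^sup>2))\<^sup>2"
      unfolding A2 by (simp add: eS)
    also have "\<dots> \<le> (\<Sum>k<(Suc J)\<^sup>2. C) / (real ((Suc J)\<^sup>2))\<^sup>2"
      by (intro divide_right_mono sum_mono int(2)) auto
    also have "\<dots> = C * (1 / real (Suc J) ^ 2)"
      unfolding sum_constant card_lessThan of_nat_power
      by (simp add: power2_eq_square del: of_nat_Suc)
    finally show "(\<integral>\<^sup>+\<omega>. ennreal ((cmod (A J \<omega>))\<^sup>2) \<partial>M) \<le> ennreal (C * (1 / real (Suc J) ^ 2))"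
      by (simp add: ennreal_leI)
  qed (use C in auto)
  then show ?thesis
  proof eventually_elim
    case (elim \<omega>)
    then have "(\<lambda>J. sqrt ((cmod (A J \<omega>))\<^sup>2)) \<longlonglongrightarrow> sqrt 0"
      by (intro tendsto_real_sqrt summable_LIMSEQ_zero)
    then show ?case unfolding A_def[symmetric] by (simp add: tendsto_norm_zero_iff)
  qed
qed

end

context complex_gaussian_family
begin

lemma fourth_moment:
  assumes "finite I" "(\<Sum>n\<in>I. (cmod (c n))\<^sup>2) \<le> 1"
  shows "integrable M (\<lambda>\<omega>. cmod (\<Sum>n\<in>I. c n * g n \<omega>) ^ 4)"
    and "(\<integral>\<omega>. cmod (\<Sum>n\<in>I. c n * g n \<omega>) ^ 4 \<partial>M) \<le> 2048 * exp (1/2)"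
proof -
  let ?S = "\<lambda>c \<omega>. \<Sum>n\<in>I. c n * g n \<omega>"
  have Im: "Im (?S c \<omega>) = Re (?S (\<lambda>n. - \<i> * c n) \<omega>)" for \<omega>
  proof -
    have "?S (\<lambda>n. - \<i> * c n) \<omega> = - \<i> * ?S c \<omega>"
      unfolding sum_distrib_left by (simp add: mult_ac)
    then show ?thesis by simp
  qed
  have m: "(\<lambda>\<omega>. Re (?S c \<omega>)) \<in> borel_measurable M" "(\<lambda>\<omega>. Im (?S c \<omega>)) \<in> borel_measurable M"
    by measurable
  have "(\<integral>\<^sup>+\<omega>. ennreal (cmod (?S c \<omega>) ^ 4) \<partial>M)
      \<le> (\<integral>\<^sup>+\<omega>. ennreal 1024 * (ennreal (cosh (Re (?S c \<omega>))) + ennreal (cosh (Im (?S c \<omega>)))) \<partial>M)"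
  proof (intro nn_integral_mono)
    fix \<omega>
    have "ennreal (cmod (?S c \<omega>) ^ 4) \<le> ennreal (1024 * (cosh (Re (?S c \<omega>)) + cosh (Im (?S c \<omega>))))"
      by (intro ennreal_leI cmod_power4_le)
    also have "\<dots> = ennreal 1024 * (ennreal (cosh (Re (?S c \<omega>))) + ennreal (cosh (Im (?S c \<omega>))))"
      by (subst ennreal_mult) (simp_all only: ennreal_plus cosh_real_nonneg add_nonneg_nonneg zero_le_numeral)
    finally show "ennreal (cmod (?S c \<omega>) ^ 4) \<le> \<dots>" .
  qed
  also have "\<dots> = ennreal 1024 * ((\<integral>\<^sup>+\<omega>. ennreal (cosh (Re (?S c \<omega>))) \<partial>M) + (\<integral>\<^sup>+\<omega>. ennreal (cosh (Im (?S c \<omega>))) \<partial>M))"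
    using m by (subst nn_integral_cmult, measurable, subst nn_integral_add, measurable)
  also have "\<dots> \<le> ennreal 1024 * (ennreal (exp (1/2)) + ennreal (exp (1/2)))"
    unfolding Im using assms by (intro mult_left_mono add_mono nn_integral_cosh_Re_le) (auto simp: norm_mult)
  also have "\<dots> = ennreal (2048 * exp (1/2))"
    by (simp only: ennreal_plus[symmetric] ennreal_mult'[symmetric] exp_ge_zero zero_le_numeral) simp
  finally have le: "(\<integral>\<^sup>+\<omega>. ennreal (cmod (?S c \<omega>) ^ 4) \<partial>M) \<le> ennreal (2048 * exp (1/2))" .
  show i: "integrable M (\<lambda>\<omega>. cmod (?S c \<omega>) ^ 4)"
    using le_less_trans[OF le ennreal_less_top] by (intro integrableI_nonneg) auto
  show "(\<integral>\<omega>. cmod (?S c \<omega>) ^ 4 \<partial>M) \<le> 2048 * exp (1/2)"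
    using le nn_integral_eq_integral[OF i] by simp
qed

text \<open>Disjoint blocks use disjoint sets of the g_n, so the block sums are independent. Applied
  to |Y|^2 - 2 and to Y^2, which are both centred and have second moments controlled by the uniform
  fourth-moment bound, the law of large numbers above gives the two limits.\<close>

lemma AE_block_averages:
  fixes B :: "nat \<Rightarrow> int set" and c :: "nat \<Rightarrow> int \<Rightarrow> complex"
  assumes B: "\<And>k. finite (B k)" "\<And>j k. j \<noteq> k \<Longrightarrow> B j \<inter> B k = {}"
    and c: "\<And>k. (\<Sum>n\<in>B k. (cmod (c k n))\<^sup>2) = 1"
  shows "AE \<omega> in M. (\<lambda>J. (\<Sum>k<(Suc J)\<^sup>2. (cmod (\<Sum>n\<in>B k. c k n * g n \<omega>))\<^sup>2) / real ((Suc J)\<^sup>2)) \<longlonglongrightarrow> 2"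
    and "AE \<omega> in M. (\<lambda>J. (\<Sum>k<(Suc J)\<^sup>2. (\<Sum>n\<in>B k. c k n * g n \<omega>)\<^sup>2) / of_nat ((Suc J)\<^sup>2)) \<longlonglongrightarrow> 0"
proof -
  define Y where "Y k \<omega> = (\<Sum>n\<in>B k. c k n * g n \<omega>)" for k \<omega>
  have [measurable]: "Y k \<in> borel_measurable M" for k unfolding Y_def by measurable
  have indep: "indep_var borel (Y j) borel (Y k)" if "j \<noteq> k" for j k
  proof -
    have *: "(\<lambda>f. \<Sum>n\<in>B k. c k n * f n) \<in> borel_measurable (PiM (B k) (\<lambda>_. borel))" for k
      by measurable
    show ?thesis
      using indep_var_compose[OF indep_var_restrict[OF indep_g, of "B j" "B k"] *[of j] *[of k]] B(2)[OF that]
      by (simp add: comp_def Y_def[abs_def])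
  qed
  have i2: "integrable M (\<lambda>\<omega>. (cmod (Y k \<omega>))\<^sup>2)" "(\<integral>\<omega>. (cmod (Y k \<omega>))\<^sup>2 \<partial>M) = 2" for k
    using integrable_norm_sum[where I = "B k" and c = "c k"] integral_norm_sum[OF B(1), where c = "c k"] c[of k]
    by (simp_all add: Y_def)
  have iS: "integrable M (\<lambda>\<omega>. (Y k \<omega>)\<^sup>2)" "(\<integral>\<omega>. (Y k \<omega>)\<^sup>2 \<partial>M) = 0" for k
    using integrable_sum_square[where I = "B k" and c = "c k"] integral_sum_square[where I = "B k" and c = "c k"]
    by (simp_all add: Y_def)
  have i4: "integrable M (\<lambda>\<omega>. cmod (Y k \<omega>) ^ 4)" "(\<integral>\<omega>. cmod (Y k \<omega>) ^ 4 \<partial>M) \<le> 2048 * exp (1/2)" for k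
    using fourth_moment[OF B(1)[of k], of "c k"] c[of k] by (simp_all add: Y_def)
  have avg: "AE \<omega> in M. (\<lambda>J. (\<Sum>k<(Suc J)\<^sup>2. f (Y k \<omega>)) / of_nat ((Suc J)\<^sup>2)) \<longlonglongrightarrow> 0"
    if f [measurable]: "f \<in> borel_measurable borel" and "\<And>k. integrable M (\<lambda>\<omega>. f (Y k \<omega>))" "\<And>k. (\<integral>\<omega>. f (Y k \<omega>) \<partial>M) = 0"
      and "\<And>k. integrable M (\<lambda>\<omega>. (cmod (f (Y k \<omega>)))\<^sup>2)" "\<And>k. (\<integral>\<omega>. (cmod (f (Y k \<omega>)))\<^sup>2 \<partial>M) \<le> C"
    for f :: "complex \<Rightarrow> complex" and C
  proof (rule AE_square_averages_tendsto_0)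
    fix j k :: nat assume jk: "j \<noteq> k"
    have "continuous_on UNIV cnj" by (intro continuous_intros)
    then have "(\<lambda>z. cnj (f z)) \<in> borel_measurable borel"
      by (rule measurable_compose[OF f borel_measurable_continuous_onI])
    from indep_var_compose[OF indep[OF jk] f this]
    have ind: "indep_var borel (\<lambda>\<omega>. f (Y j \<omega>)) borel (\<lambda>\<omega>. cnj (f (Y k \<omega>)))"
      by (simp add: comp_def)
    have "integrable M (\<lambda>\<omega>. cnj (f (Y k \<omega>)))" using that(2) by simp
    note i = indep_var_integrable[OF ind that(2) this] indep_var_lebesgue_integral[OF ind that(2) this]
    show "integrable M (\<lambda>\<omega>. f (Y j \<omega>) * cnj (f (Y k \<omega>)))" by (rule i)
    show "(\<integral>\<omega>. f (Y j \<omega>) * cnj (f (Y k \<omega>)) \<partial>M) = 0" by (simp add: i(2) that(3))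
  qed (use that in auto)
  have "AE \<omega> in M. (\<lambda>J. (\<Sum>k<(Suc J)\<^sup>2. (Y k \<omega>)\<^sup>2) / of_nat ((Suc J)\<^sup>2)) \<longlonglongrightarrow> 0"
    using iS i4 by (intro avg[of _ "2048 * exp (1/2)"]) (auto simp: norm_power simp flip: power_mult)
  then show "AE \<omega> in M. (\<lambda>J. (\<Sum>k<(Suc J)\<^sup>2. (\<Sum>n\<in>B k. c k n * g n \<omega>)\<^sup>2) / of_nat ((Suc J)\<^sup>2)) \<longlonglongrightarrow> 0"
    by (simp only: Y_def)
  have "AE \<omega> in M. (\<lambda>J. (\<Sum>k<(Suc J)\<^sup>2. complex_of_real ((cmod (Y k \<omega>))\<^sup>2 - 2)) / of_nat ((Suc J)\<^sup>2)) \<longlonglongrightarrow> 0"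
  proof (rule avg[of _ "2048 * exp (1/2)"])
    \<comment> \<open>As E |Y|^2 = 2, the last two terms contribute -8 + 4 < 0, and the
      fourth-moment bound can be reused unchanged.\<close>
    have sq: "(cmod (complex_of_real ((cmod z)\<^sup>2 - 2)))\<^sup>2 = cmod z ^ 4 - 4 * (cmod z)\<^sup>2 + 4" for z
      unfolding norm_of_real power2_abs by (simp add: power2_diff flip: power_mult)
    show "integrable M (\<lambda>\<omega>. complex_of_real ((cmod (Y k \<omega>))\<^sup>2 - 2))" for k
      by (intro integrable_of_real Bochner_Integration.integrable_diff i2) simp
    show "(\<integral>\<omega>. complex_of_real ((cmod (Y k \<omega>))\<^sup>2 - 2) \<partial>M) = 0" for k
      using i2[of k] by (simp add: prob_space del: of_real_diff)
    show "integrable M (\<lambda>\<omega>. (cmod (complex_of_real ((cmod (Y k \<omega>))\<^sup>2 - 2)))\<^sup>2)" for k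
      unfolding sq using i2[of k] i4[of k] by simp
    show "(\<integral>\<omega>. (cmod (complex_of_real ((cmod (Y k \<omega>))\<^sup>2 - 2)))\<^sup>2 \<partial>M) \<le> 2048 * exp (1/2)" for k
      unfolding sq using i2[of k] i4[of k] by (simp add: prob_space)
  qed measurable
  then show "AE \<omega> in M. (\<lambda>J. (\<Sum>k<(Suc J)\<^sup>2. (cmod (\<Sum>n\<in>B k. c k n * g n \<omega>))\<^sup>2) / real ((Suc J)\<^sup>2)) \<longlonglongrightarrow> 2"
  proof eventually_elim
    case (elim \<omega>)
    have "(\<Sum>k<n. complex_of_real ((cmod (Y k \<omega>))\<^sup>2 - 2)) / of_nat n
      = complex_of_real ((\<Sum>k<n. (cmod (Y k \<omega>))\<^sup>2) / real n - 2)" if "n > 0" for n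
      using that by (simp add: sum_subtractf diff_divide_distrib)
    then have "(\<lambda>J. complex_of_real ((\<Sum>k<(Suc J)\<^sup>2. (cmod (Y k \<omega>))\<^sup>2) / real ((Suc J)\<^sup>2) - 2)) \<longlonglongrightarrow> of_real 0"
      using elim by (simp del: of_real_diff of_real_divide of_nat_power of_nat_Suc)
    then have "(\<lambda>J. (\<Sum>k<(Suc J)\<^sup>2. (cmod (Y k \<omega>))\<^sup>2) / real ((Suc J)\<^sup>2) - 2) \<longlonglongrightarrow> 0"
      by (simp only: tendsto_of_real_iff)
    from tendsto_add[OF this tendsto_const[of 2]] show ?case by (simp add: Y_def)
  qed
qed

end

section \<open>Frequency content of a difference, and the choice of sparse scales\<close>

lemma power2_le_if_abs_le: "\<bar>x\<bar> \<le> (y :: real) \<Longrightarrow> x\<^sup>2 \<le> y\<^sup>2"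
  using power_mono[of "\<bar>x\<bar>" y 2] by simp

text \<open>The coefficient of g_n in the m-th difference at 0 of the random series: the eigenvalue
  of the difference operator on e^(inx) times <n>^(-s).\<close>

definition fdiff_symbol :: "nat \<Rightarrow> real \<Rightarrow> real \<Rightarrow> int \<Rightarrow> complex" where
  "fdiff_symbol m s h n = (1 - exp (\<i> * of_int n * of_real h)) ^ m / of_real (japanese_bracket n powr s)"

lemma norm_fdiff_symbol:
  "(cmod (fdiff_symbol m s h n))\<^sup>2 = (cmod (1 - exp (\<i> * of_int n * of_real h)))\<^sup>2 ^ m * japanese_bracket n powr (- (2 * s))"
proof -
  have "(japanese_bracket n powr s)\<^sup>2 = japanese_bracket n powr (2 * s)"
    by (simp add: power2_eq_square powr_add[symmetric])
  moreover have "(cmod (X ^ m / of_real r))\<^sup>2 = (cmod X)\<^sup>2 ^ m / r\<^sup>2" for X :: complex and r :: real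
    by (simp add: norm_divide norm_power power_divide mult.commute flip: power_mult)
  ultimately show ?thesis
    unfolding fdiff_symbol_def by (simp add: powr_minus divide_inverse)
qed

text \<open>The bound for high frequencies: uniform in h, and summable in n once 2 s > 1.\<close>

lemma norm_fdiff_symbol_le: "(cmod (fdiff_symbol m s h n))\<^sup>2 \<le> 4 ^ m * japanese_bracket n powr (- (2 * s))"
proof -
  have "cmod (1 - exp (\<i> * of_int n * of_real h)) \<le> 2"
    using norm_triangle_ineq4[of 1 "exp (\<i> * of_int n * of_real h)"] by (simp add: norm_exp_eq_Re)
  then have "(cmod (1 - exp (\<i> * of_int n * of_real h)))\<^sup>2 \<le> 2\<^sup>2" by (intro power_mono) auto
  then show ?thesis unfolding norm_fdiff_symbol by (intro mult_right_mono power_mono) auto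
qed

text \<open>The bound for low frequencies: at a fixed frequency the contribution is of order h^(2m),
  negligible against the variance h^(2s-1) when m > s.\<close>

lemma norm_fdiff_symbol_le_low:
  assumes "0 \<le> s"
  shows "(cmod (fdiff_symbol m s h n))\<^sup>2 \<le> (of_int n * h)\<^sup>2 ^ m"
proof -
  have "cmod (1 - exp (\<i> * of_int n * of_real h)) \<le> \<bar>of_int n * h\<bar>"
    using norm_exp_i_diff_le[of n 0 h] by (simp add: abs_mult)
  then have 1: "(cmod (1 - exp (\<i> * of_int n * of_real h)))\<^sup>2 \<le> (of_int n * h)\<^sup>2"
    using power_mono[of "cmod (1 - exp (\<i> * of_int n * of_real h))" "\<bar>of_int n * h\<bar>" 2] by simp
  have "japanese_bracket n powr (- (2 * s)) \<le> 1"
    using assms powr_mono[of "- (2 * s)" 0 "japanese_bracket n"] japanese_bracket_ge_1[of n] by simp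
  then have "(cmod (fdiff_symbol m s h n))\<^sup>2 \<le> (cmod (1 - exp (\<i> * of_int n * of_real h)))\<^sup>2 ^ m * 1"
    unfolding norm_fdiff_symbol by (intro mult_left_mono) auto
  also have "\<dots> \<le> (of_int n * h)\<^sup>2 ^ m" using 1 by (simp add: power_mono)
  finally show ?thesis .
qed

lemma norm_one_minus_iexp: "(cmod (1 - exp (\<i> * of_int n * of_real h)))\<^sup>2 = 2 - 2 * cos (of_int n * h)"
proof -
  have "exp (\<i> * of_int n * of_real h) = cis (of_int n * h)" by (simp add: cis_conv_exp mult.assoc)
  then have "(cmod (1 - exp (\<i> * of_int n * of_real h)))\<^sup>2 = (1 - cos (of_int n * h))\<^sup>2 + (sin (of_int n * h))\<^sup>2"
    by (simp add: cmod_power2)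
  also have "(sin (of_int n * h))\<^sup>2 = 1 - (cos (of_int n * h))\<^sup>2" by (rule sin_squared_eq)
  finally show ?thesis by (simp add: power2_diff)
qed

text \<open>With h = 1/N the frequencies from N to 2N have n h in [1, 2], away from the zeros of 1 -
  e^(inh), and <n> \<le> 3 N. At least N terms of size N^(-2s) add up to the order N^(1-2s) =
  h^(2s-1).\<close>

lemma fdiff_symbol_lower_bound:
  assumes "0 < s"
  shows "\<exists>c>0. \<forall>N\<ge>1. c * (1 / real N) powr (2 * s - 1)
    \<le> (\<Sum>n\<in>{int N..2 * int N}. (cmod (fdiff_symbol m s (1 / real N) n))\<^sup>2)"
proof -
  let ?c = "(2 - 2 * cos 1) ^ m * 3 powr (- (2 * s))"
  have "cos 1 < (1 :: real)" using cos_monotone_0_pi[of 0 1] pi_gt3 by simp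
  then have c: "?c > 0" by simp
  have "?c * (1 / real N) powr (2 * s - 1)
    \<le> (\<Sum>n\<in>{int N..2 * int N}. (cmod (fdiff_symbol m s (1 / real N) n))\<^sup>2)" if N: "N \<ge> 1" for N
  proof -
    have le: "?c * real N powr (- (2 * s)) \<le> (cmod (fdiff_symbol m s (1 / real N) n))\<^sup>2" if n: "n \<in> {int N..2 * int N}" for n
    proof -
      have "real N \<le> of_int n" "of_int n \<le> 2 * real N" using n by auto
      then have "1 \<le> of_int n * (1 / real N)" "of_int n * (1 / real N) \<le> 2" using N by (simp_all add: field_simps)
      then have "cos (of_int n * (1 / real N)) \<le> cos 1"
        using pi_gt3 by (intro cos_monotone_0_pi_le) auto
      then have 1: "2 - 2 * cos 1 \<le> (cmod (1 - exp (\<i> * of_int n * of_real (1 / real N))))\<^sup>2"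
        unfolding norm_one_minus_iexp by simp
      have "japanese_bracket n \<le> 3 * real N"
        using japanese_bracket_le[of n] \<open>of_int n \<le> 2 * real N\<close> \<open>real N \<le> of_int n\<close> N by linarith
      then have 2: "(3 * real N) powr (- (2 * s)) \<le> japanese_bracket n powr (- (2 * s))"
        using assms by (intro powr_mono2') auto
      have "(2 - 2 * cos 1) ^ m * (3 * real N) powr (- (2 * s)) \<le> (cmod (fdiff_symbol m s (1 / real N) n))\<^sup>2"
        unfolding norm_fdiff_symbol using 1 2 \<open>cos 1 < 1\<close> by (intro mult_mono power_mono) auto
      then show ?thesis by (simp add: powr_mult mult.assoc)
    qed
    have "(1 / real N) powr (2 * s - 1) = real N * real N powr (- (2 * s))"
      using N by (simp add: powr_divide powr_diff powr_minus field_simps)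
    then have "?c * (1 / real N) powr (2 * s - 1) = real N * (?c * real N powr (- (2 * s)))"
      by simp
    also have "\<dots> \<le> real (card {int N..2 * int N}) * (?c * real N powr (- (2 * s)))"
      using c by (intro mult_right_mono) auto
    also have "\<dots> \<le> (\<Sum>n\<in>{int N..2 * int N}. (cmod (fdiff_symbol m s (1 / real N) n))\<^sup>2)"
      using le by (intro sum_bounded_below) auto
    finally show ?thesis .
  qed
  with c show ?thesis by blast
qed

lemma summable_on_tail:
  fixes f :: "'a \<Rightarrow> real"
  assumes f: "f summable_on UNIV" "\<And>x. 0 \<le> f x" and "0 < e"
  shows "\<exists>F. finite F \<and> (\<forall>I. finite I \<longrightarrow> I \<inter> F = {} \<longrightarrow> sum f I \<le> e)"
proof -
  have "(sum f \<longlongrightarrow> infsum f UNIV) (finite_subsets_at_top UNIV)"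
    using has_sum_infsum[OF f(1)] by (simp add: has_sum_def)
  then have "\<forall>\<^sub>F F in finite_subsets_at_top UNIV. infsum f UNIV - e < sum f F"
    using assms(3) by (intro order_tendstoD) auto
  then obtain F where F: "finite F" "infsum f UNIV - e < sum f F"
    by (auto simp: eventually_finite_subsets_at_top)
  have "sum f I \<le> e" if "finite I" "I \<inter> F = {}" for I
  proof -
    have "sum f I + sum f F = sum f (I \<union> F)" using that F by (simp add: sum.union_disjoint)
    also have "\<dots> \<le> infsum f UNIV" using that F f by (intro finite_sum_le_infsum) auto
    finally show ?thesis using F by simp
  qed
  then show ?thesis using F by blast
qed

text \<open>The order of choice matters: for given M the scale 1/N is taken so small that
  frequencies below M become negligible, and only then M' is taken so large that the tail is small
  for this fixed N.\<close>

lemma scale_step: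
  assumes s: "1/2 < s" "s < real m" and e: "0 < e"
  shows "\<exists>N M'. K \<le> N \<and> 1 \<le> N \<and> M < M' \<and>
    (\<forall>I. (\<forall>n\<in>I. \<bar>n\<bar> < int M) \<longrightarrow> (\<Sum>n\<in>I. (cmod (fdiff_symbol m s (1 / real N) n))\<^sup>2) \<le> e * (1 / real N) powr (2 * s - 1)) \<and>
    (\<forall>I. finite I \<longrightarrow> (\<forall>n\<in>I. int M' \<le> \<bar>n\<bar>) \<longrightarrow> (\<Sum>n\<in>I. (cmod (fdiff_symbol m s (1 / real N) n))\<^sup>2) \<le> e * (1 / real N) powr (2 * s - 1))"
proof -
  \<comment> \<open>The at most 2M+1 low frequencies contribute at most C N^(-2m), and comparison
    with N^(-(2s-1)) leaves the negative exponent -(2m - 2s + 1).\<close>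
  define C where "C = real (2 * M + 1) * (real M)\<^sup>2 ^ m"
  have "((\<lambda>N. C * real N powr (- (2 * real m - 2 * s + 1))) \<longlongrightarrow> C * 0) sequentially"
    using s by (intro tendsto_mult tendsto_const tendsto_neg_powr filterlim_real_sequentially) auto
  then have "\<forall>\<^sub>F N in sequentially. C * real N powr (- (2 * real m - 2 * s + 1)) < e"
    using e by (intro order_tendstoD) auto
  then have "\<forall>\<^sub>F N in sequentially. C * real N powr (- (2 * real m - 2 * s + 1)) < e \<and> max K 1 \<le> N"
    by (intro eventually_conj eventually_ge_at_top)
  then obtain N where N: "C * real N powr (- (2 * real m - 2 * s + 1)) < e" "max K 1 \<le> N"
    unfolding eventually_sequentially by blast
  have N1: "1 \<le> N" "0 < real N" using N(2) by auto
  have low: "(\<Sum>n\<in>I. (cmod (fdiff_symbol m s (1 / real N) n))\<^sup>2) \<le> e * (1 / real N) powr (2 * s - 1)"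
    if I: "\<forall>n\<in>I. \<bar>n\<bar> < int M" for I
  proof -
    have sub: "I \<subseteq> {- int M..int M}" using I by force
    have "(\<Sum>n\<in>I. (cmod (fdiff_symbol m s (1 / real N) n))\<^sup>2) \<le> (\<Sum>n\<in>{- int M..int M}. (cmod (fdiff_symbol m s (1 / real N) n))\<^sup>2)"
      by (intro sum_mono2 sub) auto
    also have "\<dots> \<le> (\<Sum>n\<in>{- int M..int M}. (real M * (1 / real N))\<^sup>2 ^ m)"
    proof (intro sum_mono order_trans[OF norm_fdiff_symbol_le_low])
      fix n assume "n \<in> {- int M..int M}"
      then have "\<bar>of_int n * (1 / real N)\<bar> \<le> real M * (1 / real N)"
        unfolding abs_mult by (intro mult_mono) auto
      then have "(of_int n * (1 / real N))\<^sup>2 \<le> (real M * (1 / real N))\<^sup>2"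
        by (rule power2_le_if_abs_le)
      then show "(of_int n * (1 / real N))\<^sup>2 ^ m \<le> (real M * (1 / real N))\<^sup>2 ^ m"
        by (rule power_mono) (rule zero_le_power2)
    qed (use s in auto)
    also have "\<dots> = C * real N powr (- (2 * real m))"
    proof -
      have "real N powr (- (2 * real m)) = (1 / real N)\<^sup>2 ^ m"
        using N1 powr_realpow[of "real N" "2 * m"] by (simp add: powr_minus divide_inverse power_mult power_inverse)
      then show ?thesis by (simp only: power_mult_distrib C_def) simp
    qed
    also have "\<dots> = (C * real N powr (- (2 * real m - 2 * s + 1))) * (1 / real N) powr (2 * s - 1)"
    proof -
      have "(1 / real N) powr (2 * s - 1) = real N powr (- (2 * s - 1))"
        using N1 by (simp add: powr_divide powr_minus_divide[symmetric])
      then show ?thesis by (simp add: powr_add[symmetric] mult.assoc)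
    qed
    also have "\<dots> \<le> e * (1 / real N) powr (2 * s - 1)"
      using N by (intro mult_right_mono) auto
    finally show ?thesis .
  qed
  define e' where "e' = e * (1 / real N) powr (2 * s - 1) / 4 ^ m"
  have e': "0 < e'" using e N1 by (simp add: e'_def)
  have "(\<lambda>n. japanese_bracket n powr (- (2 * s))) summable_on UNIV"
    using s by (intro summable_on_japanese_bracket) auto
  from summable_on_tail[OF this _ e']
  obtain F where F: "finite F" "\<And>I. finite I \<Longrightarrow> I \<inter> F = {} \<Longrightarrow> (\<Sum>n\<in>I. japanese_bracket n powr (- (2 * s))) \<le> e'"
    by auto
  obtain M0 where M0: "F \<subseteq> {- int M0..int M0}" using finite_int_subset_symmetric[OF F(1)] by blast
  define M' where "M' = Suc (max M M0)"
  have high: "(\<Sum>n\<in>I. (cmod (fdiff_symbol m s (1 / real N) n))\<^sup>2) \<le> e * (1 / real N) powr (2 * s - 1)"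
    if I: "finite I" "\<forall>n\<in>I. int M' \<le> \<bar>n\<bar>" for I
  proof -
    have "I \<inter> F = {}" using I M0 by (force simp: M'_def)
    have "(\<Sum>n\<in>I. (cmod (fdiff_symbol m s (1 / real N) n))\<^sup>2) \<le> (\<Sum>n\<in>I. 4 ^ m * japanese_bracket n powr (- (2 * s)))"
      by (intro sum_mono norm_fdiff_symbol_le)
    also have "\<dots> \<le> 4 ^ m * e'"
      using F(2)[OF I(1) \<open>I \<inter> F = {}\<close>] by (simp add: sum_distrib_left[symmetric])
    finally show ?thesis by (simp add: e'_def)
  qed
  have "K \<le> N \<and> 1 \<le> N \<and> M < M'" using N by (simp add: M'_def)
  with low high show ?thesis by blast
qed

text \<open>
  Gliding hump: the scales are so sparse that the \<open>k\<close>-th difference is carried, up to a relative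
  error \<open>(1/4)^k\<close>, by a frequency block \<open>B k\<close>, and disjoint blocks make these main parts independent.
\<close>

lemma scales_exist:
  assumes s: "1/2 < s" "s < real m"
  shows "\<exists>(N :: nat \<Rightarrow> nat) (B :: nat \<Rightarrow> int set) c. 0 < c \<and> (\<forall>k. 2 ^ k \<le> N k) \<and> (\<forall>k. finite (B k)) \<and>
    (\<forall>j k. j \<noteq> k \<longrightarrow> B j \<inter> B k = {}) \<and>
    (\<forall>k. c * (1 / real (N k)) powr (2 * s - 1) \<le> (\<Sum>n\<in>B k. (cmod (fdiff_symbol m s (1 / real (N k)) n))\<^sup>2)) \<and>
    (\<forall>k I. finite I \<longrightarrow> I \<inter> B k = {} \<longrightarrow> (\<Sum>n\<in>I. (cmod (fdiff_symbol m s (1 / real (N k)) n))\<^sup>2)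
      \<le> (1/4) ^ k * (\<Sum>n\<in>B k. (cmod (fdiff_symbol m s (1 / real (N k)) n))\<^sup>2))"
proof -
  obtain c where c: "0 < c" "\<And>N. N \<ge> 1 \<Longrightarrow> c * (1 / real N) powr (2 * s - 1)
    \<le> (\<Sum>n\<in>{int N..2 * int N}. (cmod (fdiff_symbol m s (1 / real N) n))\<^sup>2)"
    using fdiff_symbol_lower_bound[of s m] s by auto
  define q where "q N I = (\<Sum>n\<in>I. (cmod (fdiff_symbol m s (1 / real N) n))\<^sup>2)" for N :: nat and I
  \<comment> \<open>Low and high frequencies together then cost at most (1/4)^k c/2 in units of
    \<open>hh\<close>. This leaves at least c/2 for the block itself, so relative to the block the
    loss is at most (1/4)^k.\<close>
  define \<epsilon> where "\<epsilon> k = c * (1/4) ^ k / 4" for k :: nat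
  define hh where "hh N = (1 / real N) powr (2 * s - 1)" for N :: nat
  define Q where "Q k M M' N \<longleftrightarrow> 2 ^ k \<le> N \<and> 1 \<le> N \<and> M < M' \<and>
    (\<forall>I. (\<forall>n\<in>I. \<bar>n\<bar> < int M) \<longrightarrow> q N I \<le> \<epsilon> k * hh N) \<and>
    (\<forall>I. finite I \<longrightarrow> (\<forall>n\<in>I. int M' \<le> \<bar>n\<bar>) \<longrightarrow> q N I \<le> \<epsilon> k * hh N)" for k M M' N
  have step: "\<exists>M'. \<exists>N. Q k M M' N" for k M
    using scale_step[OF s, of "\<epsilon> k" "2 ^ k" M] c(1) unfolding Q_def q_def hh_def \<epsilon>_def by auto
  \<comment> \<open>Only the thresholds have to be chosen recursively, the upper end of one block
    being the lower end of the next; the scales are selected afterwards for each k.\<close>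
  then have "\<exists>Mb. \<forall>k. True \<and> (\<exists>N. Q k (Mb k) (Mb (Suc k)) N)"
    by (intro dependent_nat_choice) auto
  then obtain Mb where "\<forall>k. \<exists>N. Q k (Mb k) (Mb (Suc k)) N" by blast
  then obtain N where Q: "\<And>k. Q k (Mb k) (Mb (Suc k)) (N k)" by metis
  define B where "B k = {n. int (Mb k) \<le> \<bar>n\<bar> \<and> \<bar>n\<bar> < int (Mb (Suc k))}" for k
  have fin: "finite (B k)" for k
    by (rule finite_subset[of _ "{- int (Mb (Suc k))..int (Mb (Suc k))}"]) (auto simp: B_def)
  have "strict_mono Mb" using Q unfolding Q_def strict_mono_Suc_iff by blast
  then have mono: "Mb (Suc j) \<le> Mb k" if "j < k" for j k
    using that by (auto simp: strict_mono_less_eq)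
  have disj: "B j \<inter> B k = {}" if "j \<noteq> k" for j k
    using mono[of j k] mono[of k j] that by (cases j k rule: linorder_cases) (auto simp: B_def)
  have split: "q (N k) I \<le> 2 * \<epsilon> k * hh (N k)" if "finite I" "I \<inter> B k = {}" for k I
  proof -
    have "I = {n\<in>I. \<bar>n\<bar> < int (Mb k)} \<union> {n\<in>I. int (Mb (Suc k)) \<le> \<bar>n\<bar>}"
      using that by (auto simp: B_def)
    moreover have "q N (I1 \<union> I2) \<le> q N I1 + q N I2" if "finite I1" "finite I2" for N I1 I2
      unfolding q_def sum.union_inter[OF that, symmetric] by (simp add: sum_nonneg)
    ultimately have "q (N k) I \<le> q (N k) {n\<in>I. \<bar>n\<bar> < int (Mb k)} + q (N k) {n\<in>I. int (Mb (Suc k)) \<le> \<bar>n\<bar>}"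
      using that(1) by (metis (no_types, lifting) finite_Un)
    also have "\<dots> \<le> \<epsilon> k * hh (N k) + \<epsilon> k * hh (N k)"
      using Q[of k] that(1) unfolding Q_def by (intro add_mono) auto
    finally show ?thesis by simp
  qed
  have hh: "0 \<le> hh N" for N by (simp add: hh_def)
  have lower: "c / 2 * hh (N k) \<le> q (N k) (B k)" for k
  proof -
    have "c * hh (N k) \<le> q (N k) {int (N k)..2 * int (N k)}"
      using c(2)[of "N k"] Q[of k] unfolding Q_def q_def hh_def by auto
    also have "\<dots> \<le> q (N k) (B k \<union> ({int (N k)..2 * int (N k)} - B k))"
      unfolding q_def using fin[of k] by (intro sum_mono2) auto
    also have "\<dots> = q (N k) (B k) + q (N k) ({int (N k)..2 * int (N k)} - B k)"
      unfolding q_def using fin[of k] by (intro sum.union_disjoint) auto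
    also have "q (N k) ({int (N k)..2 * int (N k)} - B k) \<le> 2 * \<epsilon> k * hh (N k)"
      by (intro split) auto
    also have "\<dots> \<le> c / 2 * hh (N k)"
    proof (intro mult_right_mono hh)
      have "(1/4 :: real) ^ k \<le> 1" by (rule power_le_one) auto
      then show "2 * \<epsilon> k \<le> c / 2" using c(1) by (simp add: \<epsilon>_def)
    qed
    finally show ?thesis by simp
  qed
  have upper: "q (N k) I \<le> (1/4) ^ k * q (N k) (B k)" if "finite I" "I \<inter> B k = {}" for k I
  proof -
    have "q (N k) I \<le> 2 * \<epsilon> k * hh (N k)" by (rule split[OF that])
    also have "\<dots> = (1/4) ^ k * (c / 2 * hh (N k))" by (simp add: \<epsilon>_def)
    also have "\<dots> \<le> (1/4) ^ k * q (N k) (B k)" by (intro mult_left_mono lower) auto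
    finally show ?thesis .
  qed
  show ?thesis
    using c(1) Q fin disj lower upper unfolding q_def hh_def Q_def
    by (intro exI[of _ N] exI[of _ B] exI[of _ "c / 2"]) auto
qed

section \<open>Averages under vanishing perturbations\<close>

lemma Cesaro_tendsto_0:
  fixes f :: "nat \<Rightarrow> real"
  assumes nn: "\<And>k. 0 \<le> f k" and f: "f \<longlonglongrightarrow> 0"
  shows "(\<lambda>N. (\<Sum>k<N. f k) / real N) \<longlonglongrightarrow> 0"
proof (rule LIMSEQ_I)
  fix e :: real assume e: "0 < e"
  obtain K where K: "\<And>k. k \<ge> K \<Longrightarrow> f k < e / 2"
    using order_tendstoD(2)[OF f, of "e / 2"] e by (auto simp: eventually_sequentially)
  have "((\<lambda>N. (\<Sum>k<K. f k) / real N) \<longlongrightarrow> 0) sequentially"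
    by (intro tendsto_divide_0[OF tendsto_const] filterlim_at_top_imp_at_infinity filterlim_real_sequentially)
  from order_tendstoD(2)[OF this, of "e / 2"] e
  obtain N0 where N0: "\<And>N. N \<ge> N0 \<Longrightarrow> (\<Sum>k<K. f k) / real N < e / 2"
    by (auto simp: eventually_sequentially)
  have "norm ((\<Sum>k<N. f k) / real N - 0) < e" if N: "N \<ge> max 1 (max N0 K)" for N
  proof -
    have "(\<Sum>k<N. f k) = (\<Sum>k<K. f k) + (\<Sum>k=K..<N. f k)"
      using sum.atLeastLessThan_concat[of 0 K N f] N by (simp add: lessThan_atLeast0)
    also have "(\<Sum>k=K..<N. f k) \<le> (\<Sum>k=K..<N. e / 2)"
      using K by (intro sum_mono less_imp_le) auto
    also have "\<dots> \<le> real N * (e / 2)" using e by (simp add: mult_right_mono)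
    finally have "(\<Sum>k<N. f k) / real N \<le> ((\<Sum>k<K. f k) + real N * (e / 2)) / real N"
      by (intro divide_right_mono) auto
    also have "\<dots> = (\<Sum>k<K. f k) / real N + e / 2" using N by (simp add: field_simps)
    also have "\<dots> < e" using N0[of N] N by linarith
    finally show ?thesis using nn by (simp add: sum_nonneg)
  qed
  then show "\<exists>no. \<forall>n\<ge>no. norm ((\<Sum>k<n. f k) / real n - 0) < e" by blast
qed

text \<open>The root mean square is a seminorm, so adding \<open>e\<close> changes it by at most the
  root mean square of \<open>e\<close>, which tends to 0 by Cesaro averaging. No pointwise bound on
  \<open>y\<close> enters.\<close>

lemma mean_square_perturbation:
  fixes y e :: "nat \<Rightarrow> complex" and n :: "nat \<Rightarrow> nat"
  assumes lim: "(\<lambda>J. (\<Sum>k<n J. (cmod (y k))\<^sup>2) / real (n J)) \<longlonglongrightarrow> L"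
    and n: "filterlim n at_top sequentially" and e: "e \<longlonglongrightarrow> 0"
  shows "(\<lambda>J. (\<Sum>k<n J. (cmod (y k + e k))\<^sup>2) / real (n J)) \<longlonglongrightarrow> L"
proof -
  define T where "T f J = L2_set f {..<n J} / sqrt (real (n J))" for f J
  have T2: "(T f J)\<^sup>2 = (\<Sum>k<n J. (f k)\<^sup>2) / real (n J)" for f J
    by (simp add: T_def L2_set_def power_divide sum_nonneg)
  have Tnn: "0 \<le> T f J" for f J by (simp add: T_def)
  have "(\<lambda>k. (cmod (e k))\<^sup>2) \<longlonglongrightarrow> 0\<^sup>2" using e by (intro tendsto_power tendsto_norm_zero)
  then have "(\<lambda>N. (\<Sum>k<N. (cmod (e k))\<^sup>2) / real N) \<longlonglongrightarrow> 0"
    by (intro Cesaro_tendsto_0) auto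
  then have "(\<lambda>J. (T (\<lambda>k. cmod (e k)) J)\<^sup>2) \<longlonglongrightarrow> 0"
    unfolding T2 using n by (rule filterlim_compose)
  then have "(\<lambda>J. sqrt ((T (\<lambda>k. cmod (e k)) J)\<^sup>2)) \<longlonglongrightarrow> sqrt 0" by (intro tendsto_real_sqrt)
  then have Te: "(\<lambda>J. T (\<lambda>k. cmod (e k)) J) \<longlonglongrightarrow> 0" by (simp add: Tnn)
  have "(\<lambda>J. sqrt ((T (\<lambda>k. cmod (y k)) J)\<^sup>2)) \<longlonglongrightarrow> sqrt L"
    unfolding T2 using lim by (intro tendsto_real_sqrt)
  then have Ty: "(\<lambda>J. T (\<lambda>k. cmod (y k)) J) \<longlonglongrightarrow> sqrt L" by (simp add: Tnn)
  have L: "0 \<le> L" by (rule LIMSEQ_le_const[OF lim]) (auto intro!: exI[of _ 0] divide_nonneg_nonneg sum_nonneg)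
  have tri: "T (\<lambda>k. cmod (a k + b k)) J \<le> T (\<lambda>k. cmod (a k)) J + T (\<lambda>k. cmod (b k)) J" for a b :: "nat \<Rightarrow> complex" and J
  proof -
    have "L2_set (\<lambda>k. cmod (a k + b k)) {..<n J} \<le> L2_set (\<lambda>k. cmod (a k) + cmod (b k)) {..<n J}"
      by (intro L2_set_mono norm_triangle_ineq) auto
    also have "\<dots> \<le> L2_set (\<lambda>k. cmod (a k)) {..<n J} + L2_set (\<lambda>k. cmod (b k)) {..<n J}"
      by (rule L2_set_triangle_ineq)
    finally show ?thesis unfolding T_def add_divide_distrib[symmetric] by (rule divide_right_mono) simp
  qed
  have "\<bar>T (\<lambda>k. cmod (y k + e k)) J - T (\<lambda>k. cmod (y k)) J\<bar> \<le> T (\<lambda>k. cmod (e k)) J" for J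
    using tri[of y e J] tri[of "\<lambda>k. y k + e k" "\<lambda>k. - e k" J] by simp
  then have "(\<lambda>J. T (\<lambda>k. cmod (y k + e k)) J - T (\<lambda>k. cmod (y k)) J) \<longlonglongrightarrow> 0"
    by (intro Lim_null_comparison[OF _ Te] always_eventually) auto
  from tendsto_add[OF this Ty] have "(\<lambda>J. (T (\<lambda>k. cmod (y k + e k)) J)\<^sup>2) \<longlonglongrightarrow> (sqrt L)\<^sup>2"
    by (intro tendsto_power) simp
  then show ?thesis unfolding T2 using L by simp
qed

section \<open>Measurability\<close>

lemma phase_rotation_apply: "apply_bcontfun (phase_rotation t u) x = rotF t (u x)"
  by (simp add: phase_rotation.rep_eq rotF_def)

lemma continuous_on_phase_rotation: "continuous_on UNIV (phase_rotation t)"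
proof (rule continuous_at_imp_continuous_on, safe)
  fix u :: "real \<Rightarrow>\<^sub>C complex"
  \<comment> \<open>Bounds all values of functions within distance 1 of \<open>u\<close>; on this
    ball the pointwise Lipschitz estimate gives a single constant in the supremum norm.\<close>
  define R where "R = norm u + 1"
  define L where "L = 1 + 2 * \<bar>t\<bar> * R\<^sup>2"
  have "dist (phase_rotation t v) (phase_rotation t u) \<le> L * dist v u" if "dist v u < 1" for v
  proof (rule dist_bound)
    fix x
    have "norm v \<le> R" using norm_triangle_sub[of v u] that by (simp add: R_def dist_norm)
    then have "cmod (v x) \<le> R" "cmod (u x) \<le> R"
      using norm_bounded[of v x] norm_bounded[of u x] by (auto simp: R_def)
    from rotF_lipschitz[OF this, of t]
    have "dist (rotF t (v x)) (rotF t (u x)) \<le> L * dist (v x) (u x)" by (simp add: L_def dist_norm)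
    also have "\<dots> \<le> L * dist v u" by (intro mult_left_mono dist_bounded) (simp add: L_def)
    finally show "dist (phase_rotation t v x) (phase_rotation t u x) \<le> L * dist v u"
      by (simp only: phase_rotation_apply)
  qed
  then have le: "\<forall>\<^sub>F v in at u. dist (phase_rotation t v) (phase_rotation t u) \<le> L * dist v u"
    by (auto simp: eventually_at intro: exI[of _ 1])
  have "((\<lambda>v. L * dist v u) \<longlongrightarrow> L * dist u u) (at u)" by (intro tendsto_intros)
  then have lim: "((\<lambda>v. L * dist v u) \<longlongrightarrow> 0) (at u)" by simp
  show "isCont (phase_rotation t) u"
    unfolding isCont_def tendsto_dist_iff[of "phase_rotation t"]
    by (rule tendsto_sandwich[OF _ le tendsto_const lim]) simp
qed

lemma measurable_dispersionless_flow: "dispersionless_flow t \<in> measurable CT CT"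
proof -
  have "dispersionless_flow t = phase_rotation t" by (simp add: fun_eq_iff dispersionless_flow_eq)
  moreover have "phase_rotation t \<in> measurable borel borel"
    by (rule borel_measurable_continuous_onI[OF continuous_on_phase_rotation])
  moreover have "phase_rotation t \<in> periodic_functions \<rightarrow> periodic_functions"
    using dispersionless_flow_periodic[where t = t] by (simp add: dispersionless_flow_eq)
  ultimately show ?thesis
    unfolding CT_def
    by (simp only:, intro measurable_restrict_space2 measurable_restrict_space1) (simp add: space_restrict_space)
qed

text \<open>Only the finitely many coordinates with |n| \<le> N enter, each continuous for the
  product topology, and they enter as real coefficients of fixed functions.\<close>

lemma continuous_on_fourier_partial_sum: "continuous_on UNIV (\<lambda>a. fourier_partial_sum s a N)"
proof -
  define E where "E n = fourier_partial_sum s (\<lambda>k. if k = n then 1 else 0) N" for n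
  define E' where "E' n = fourier_partial_sum s (\<lambda>k. if k = n then \<i> else 0) N" for n
  have "fourier_partial_sum s a N = (\<Sum>n\<in>{- int N..int N}. Re (a n) *\<^sub>R E n + Im (a n) *\<^sub>R E' n)" for a
  proof (rule bcontfun_eqI)
    fix x
    have apply_sum: "apply_bcontfun (\<Sum>n\<in>I. f n) x = (\<Sum>n\<in>I. f n x)" for I :: "int set" and f :: "int \<Rightarrow> (real \<Rightarrow>\<^sub>C complex)"
      by (induction I rule: infinite_finite_induct) (simp_all add: zero_bcontfun.rep_eq plus_bcontfun.rep_eq)
    have E: "E n x = 1 / of_real (japanese_bracket n powr s) * exp (\<i> * of_int n * of_real x)"
      "E' n x = \<i> / of_real (japanese_bracket n powr s) * exp (\<i> * of_int n * of_real x)" if "n \<in> {- int N..int N}" for n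
      using that unfolding E_def E'_def fourier_partial_sum.rep_eq
      by (simp_all add: if_distrib[of "\<lambda>y. y / _"] if_distrib[of "\<lambda>y. y * _"] cong: if_cong)
    have "a n = of_real (Re (a n)) + of_real (Im (a n)) * \<i>" for n by (simp add: complex_eq_iff)
    then have a: "a n / z * w = Re (a n) *\<^sub>R (1 / z * w) + Im (a n) *\<^sub>R (\<i> / z * w)" for n z w
      by (metis (no_types, lifting) add_divide_distrib distrib_right mult.assoc mult.right_neutral scaleR_conv_of_real times_divide_eq_right)
    show "apply_bcontfun (fourier_partial_sum s a N) x
      = apply_bcontfun (\<Sum>n\<in>{- int N..int N}. Re (a n) *\<^sub>R E n + Im (a n) *\<^sub>R E' n) x"
      unfolding apply_sum fourier_partial_sum.rep_eq plus_bcontfun.rep_eq scaleR_bcontfun.rep_eq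
      by (intro sum.cong refl) (simp only: E a[symmetric])
  qed
  then show ?thesis
    by (simp only:) (intro continuous_intros continuous_on_product_coordinates)
qed

text \<open>\<open>fourier_series\<close> is defined by cases, so its convergence set must be
  measurable. By completeness this is the Cauchy condition, which involves only countably many
  distances.\<close>

lemma borel_measurable_fourier_series: "fourier_series s \<in> borel_measurable borel"
proof -
  let ?f = "\<lambda>N a. fourier_partial_sum s a N"
  have [measurable]: "?f N \<in> borel_measurable borel" for N
    by (rule borel_measurable_continuous_onI[OF continuous_on_fourier_partial_sum])
  \<comment> \<open>Bounded continuous functions on the line do not form a separable space, so this
    is derived from continuity in the coefficients and not from measurability of the two
    arguments.\<close>
  have [measurable]: "(\<lambda>a. dist (?f m a) (?f n a)) \<in> borel_measurable borel" for m n
    by (intro borel_measurable_continuous_onI continuous_on_dist continuous_on_fourier_partial_sum)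
  define P where "P a \<longleftrightarrow> (\<forall>k::nat. \<exists>N. \<forall>m\<ge>N. \<forall>n\<ge>N. dist (?f m a) (?f n a) < 1 / real (Suc k))" for a
  have [measurable]: "Measurable.pred borel P" unfolding P_def by measurable
  have P: "P a \<longleftrightarrow> convergent (fourier_partial_sum s a)" for a
  proof -
    have "P a \<longleftrightarrow> Cauchy (fourier_partial_sum s a)"
      unfolding P_def Cauchy_def
    proof safe
      fix e :: real assume 1: "\<forall>k. \<exists>N. \<forall>m\<ge>N. \<forall>n\<ge>N. dist (?f m a) (?f n a) < 1 / real (Suc k)" and "0 < e"
      from nat_approx_posE[OF this(2)] obtain k where "1 / real (Suc k) < e" .
      with 1 show "\<exists>M. \<forall>m\<ge>M. \<forall>n\<ge>M. dist (?f m a) (?f n a) < e"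
        by (meson order_less_trans)
    qed simp
    then show ?thesis by (simp add: Cauchy_convergent_iff)
  qed
  have "(\<lambda>a. if P a then ?f N a else 0) \<in> borel_measurable borel" for N by measurable
  moreover have "(\<lambda>N. if P a then ?f N a else 0) \<longlonglongrightarrow> fourier_series s a" for a
    using fourier_series_LIMSEQ[of s a] by (auto simp: P fourier_series_def)
  ultimately show ?thesis by (rule borel_measurable_LIMSEQ_metric)
qed

context complex_gaussian_family
begin

lemma measurable_fourier_series_g: "(\<lambda>\<omega>. fourier_series s (\<lambda>n. g n \<omega>)) \<in> measurable M CT"
proof -
  have "(\<lambda>\<omega> n. g n \<omega>) \<in> borel_measurable M"
    by (rule measurable_coordinatewise_then_product) simp
  from measurable_compose[OF this borel_measurable_fourier_series]
  show ?thesis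
    unfolding CT_def by (intro measurable_restrict_space2) (auto simp: fourier_series_periodic)
qed

end

lemma borel_measurable_apply_CT: "(\<lambda>f. apply_bcontfun f x) \<in> borel_measurable CT"
  unfolding CT_def
  by (intro measurable_restrict_space1 borel_measurable_continuous_onI continuous_on_apply_bcontfun)

lemma borel_measurable_fdiff_CT: "(\<lambda>f. fdiff m h (apply_bcontfun f)) \<in> borel_measurable CT"
  unfolding CT_def
proof (intro measurable_restrict_space1 borel_measurable_continuous_onI)
  show "continuous_on UNIV (\<lambda>f :: real \<Rightarrow>\<^sub>C complex. fdiff m h (apply_bcontfun f))"
    unfolding continuous_on_def
    by (auto intro!: fdiff_tendsto tendsto_apply_bcontfun tendsto_ident_at)
qed

section \<open>Local behaviour of the random series and singularity\<close>

context complex_gaussian_family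
begin

lemma AE_convergent_series:
  assumes "1/2 < \<sigma>" "\<And>n. cmod (c n) \<le> C * japanese_bracket n powr (- \<sigma>)"
  shows "AE \<omega> in M. convergent (\<lambda>N. \<Sum>n\<in>{- int N..int N}. c n * g n \<omega>)"
  using AE_uniformly_convergent[OF assms]
proof eventually_elim
  case (elim \<omega>)
  from uniformly_convergent_imp_convergent[OF this, of 0] show ?case by simp
qed

lemma AE_fourier_partial_sum_tendsto:
  assumes "1/2 < s"
  shows "AE \<omega> in M. \<forall>x. (\<lambda>N. apply_bcontfun (fourier_partial_sum s (\<lambda>n. g n \<omega>) N) x)
    \<longlonglongrightarrow> apply_bcontfun (fourier_series s (\<lambda>n. g n \<omega>)) x"
proof -
  have "cmod (1 / of_real (japanese_bracket n powr s)) \<le> 1 * japanese_bracket n powr (- s)" for n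
    by (simp add: norm_divide powr_minus_divide)
  from AE_uniformly_convergent[OF assms this] show ?thesis
  proof eventually_elim
    case (elim \<omega>)
    then have "uniformly_convergent_on UNIV (\<lambda>N x. apply_bcontfun (fourier_partial_sum s (\<lambda>n. g n \<omega>) N) x)"
      by (simp add: fourier_partial_sum.rep_eq)
    from tendsto_apply_bcontfun[OF fourier_series_LIMSEQ[OF convergent_fourier_partial_sum[OF this]]]
    show ?case by blast
  qed
qed

lemma borel_measurable_fourier_series_apply:
  "(\<lambda>\<omega>. apply_bcontfun (fourier_series s (\<lambda>n. g n \<omega>)) x) \<in> borel_measurable M"
  by (rule measurable_compose[OF measurable_fourier_series_g borel_measurable_apply_CT])

lemma borel_measurable_fdiff_fourier_series:
  "(\<lambda>\<omega>. fdiff m h (apply_bcontfun (fourier_series s (\<lambda>n. g n \<omega>)))) \<in> borel_measurable M"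
  by (rule measurable_compose[OF measurable_fourier_series_g borel_measurable_fdiff_CT])

text \<open>The formal i-th derivative of the random series at 0, divided by i!. The limit is
  meaningful almost surely for i < s - 1/2.\<close>

definition taylor_coeff :: "real \<Rightarrow> nat \<Rightarrow> 'w \<Rightarrow> complex" where
  "taylor_coeff s i \<omega> = lim (\<lambda>N. \<Sum>n\<in>{- int N..int N}.
    (\<i> * of_int n) ^ i / fact i / of_real (japanese_bracket n powr s) * g n \<omega>)"

lemma borel_measurable_taylor_coeff [measurable]: "taylor_coeff s i \<in> borel_measurable M"
  unfolding taylor_coeff_def by measurable

lemma AE_taylor_coeff:
  assumes "real d < s - 1/2"
  shows "AE \<omega> in M. \<forall>i\<le>d. (\<lambda>N. \<Sum>n\<in>{- int N..int N}.
    (\<i> * of_int n) ^ i / fact i / of_real (japanese_bracket n powr s) * g n \<omega>) \<longlonglongrightarrow> taylor_coeff s i \<omega>"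
proof -
  have "AE \<omega> in M. (\<lambda>N. \<Sum>n\<in>{- int N..int N}.
    (\<i> * of_int n) ^ i / fact i / of_real (japanese_bracket n powr s) * g n \<omega>) \<longlonglongrightarrow> taylor_coeff s i \<omega>"
    if "i \<le> d" for i
  proof -
    have \<sigma>: "1/2 < s - real i" using that assms by simp
    have "cmod ((\<i> * of_int n) ^ i / fact i / of_real (japanese_bracket n powr s)) \<le> 1 * japanese_bracket n powr (- (s - real i))" for n
    proof -
      have "cmod ((\<i> * of_int n) ^ i / fact i / of_real (japanese_bracket n powr s))
        = \<bar>real_of_int n\<bar> ^ i / fact i / japanese_bracket n powr s"
        by (simp add: norm_divide norm_mult norm_power)
      also have "\<dots> \<le> japanese_bracket n ^ i / 1 / japanese_bracket n powr s"
        by (intro divide_right_mono frac_le power_mono japanese_bracket_ge_abs) (auto simp: fact_ge_1 less_imp_le)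
      also have "\<dots> = japanese_bracket n powr (- (s - real i))"
        by (simp add: powr_diff powr_realpow)
      finally show ?thesis by simp
    qed
    from AE_convergent_series[OF \<sigma> this] show ?thesis
      by eventually_elim (simp add: taylor_coeff_def convergent_LIMSEQ_iff)
  qed
  then have "AE \<omega> in M. \<forall>i\<in>{..d}. (\<lambda>N. \<Sum>n\<in>{- int N..int N}.
    (\<i> * of_int n) ^ i / fact i / of_real (japanese_bracket n powr s) * g n \<omega>) \<longlonglongrightarrow> taylor_coeff s i \<omega>"
    by (intro AE_finite_allI) auto
  then show ?thesis by (simp only: Ball_def atMost_iff)
qed

lemma AE_taylor_coeff_0:
  assumes "1/2 < s"
  shows "AE \<omega> in M. taylor_coeff s 0 \<omega> = apply_bcontfun (fourier_series s (\<lambda>n. g n \<omega>)) 0"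
proof -
  have "real 0 < s - 1/2" using assms by simp
  from AE_taylor_coeff[OF this] AE_fourier_partial_sum_tendsto[OF assms] show ?thesis
  proof eventually_elim
    case (elim \<omega>)
    have "(\<lambda>N. apply_bcontfun (fourier_partial_sum s (\<lambda>n. g n \<omega>) N) 0) \<longlonglongrightarrow> taylor_coeff s 0 \<omega>"
      using elim(1) by (simp add: fourier_partial_sum.rep_eq)
    with elim(2) show ?case using LIMSEQ_unique by blast
  qed
qed

text \<open>The remainder is the random series with e^(inx) replaced by its own Taylor remainder R(n
  x). Since |R(n x)|^2 \<le> 4 |n x|^(2\<tau>), the variance is |x|^(2\<tau>) times the sum of
  <n>^(-2(s-\<tau>)), finite because \<tau> < s - 1/2.\<close>

lemma taylor_remainder_moment:
  assumes d: "real d \<le> \<tau>" "\<tau> \<le> real (Suc d)" and s: "0 \<le> \<tau>" "\<tau> < s - 1/2"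
  shows "\<exists>C\<ge>0. \<forall>x. (\<integral>\<^sup>+\<omega>. ennreal ((cmod (apply_bcontfun (fourier_series s (\<lambda>n. g n \<omega>)) x
      - (\<Sum>i\<le>d. taylor_coeff s i \<omega> * of_real x ^ i)))\<^sup>2) \<partial>M) \<le> ennreal (C * \<bar>x\<bar> powr (2 * \<tau>))"
proof -
  define R where "R \<theta> = exp (\<i> * of_real \<theta>) - (\<Sum>i\<le>d. (\<i> * of_real \<theta>) ^ i / fact i)" for \<theta> :: real
  \<comment> \<open>Interpolation between two classical bounds: order d+1 is used for |\<theta>|
    \<le> 1 and order d beyond, with d \<le> \<tau> \<le> d+1.\<close>
  have R: "cmod (R \<theta>) \<le> 2 * \<bar>\<theta>\<bar> powr \<tau>" for \<theta>
  proof (cases "\<theta> = 0")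
    case True
    then show ?thesis using iexp_approx1[of \<theta> d] by (simp add: R_def)
  next
    case False
    show ?thesis
    proof (cases "\<bar>\<theta>\<bar> \<le> 1")
      case True
      have "cmod (R \<theta>) \<le> \<bar>\<theta>\<bar> ^ Suc d / fact (Suc d)" unfolding R_def by (rule iexp_approx1)
      also have "\<dots> \<le> \<bar>\<theta>\<bar> ^ Suc d / 1" by (intro divide_left_mono) (auto simp: fact_ge_1 simp del: fact_Suc)
      also have "\<dots> = \<bar>\<theta>\<bar> powr real (Suc d)" using False by (subst powr_realpow) simp_all
      also have "\<dots> \<le> \<bar>\<theta>\<bar> powr \<tau>" using d True by (intro powr_mono') auto
      also have "\<dots> \<le> 2 * \<bar>\<theta>\<bar> powr \<tau>" by simp
      finally show ?thesis .
    next
      case 2: False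
      have "cmod (R \<theta>) \<le> 2 * \<bar>\<theta>\<bar> ^ d / fact d" unfolding R_def by (rule iexp_approx2)
      also have "\<dots> \<le> 2 * \<bar>\<theta>\<bar> ^ d / 1" by (intro divide_left_mono) (auto simp: fact_ge_1)
      also have "\<dots> = 2 * \<bar>\<theta>\<bar> powr real d" using False by (simp add: powr_realpow[symmetric])
      also have "\<dots> \<le> 2 * \<bar>\<theta>\<bar> powr \<tau>" using d 2 by (intro mult_left_mono powr_mono) auto
      finally show ?thesis .
    qed
  qed
  have p: "1 < 2 * (s - \<tau>)" using s by simp
  obtain V where V: "0 < V" "\<And>I. finite I \<Longrightarrow> (\<Sum>n\<in>I. japanese_bracket n powr (- (2 * (s - \<tau>)))) \<le> V"
    using sum_powr_japanese_bracket_bounded[OF p] by blast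
  have half: "1/2 < s" "real d < s - 1/2" using s d by linarith+
  have "(\<integral>\<^sup>+\<omega>. ennreal ((cmod (apply_bcontfun (fourier_series s (\<lambda>n. g n \<omega>)) x
      - (\<Sum>i\<le>d. taylor_coeff s i \<omega> * of_real x ^ i)))\<^sup>2) \<partial>M) \<le> ennreal (2 * (4 * V * \<bar>x\<bar> powr (2 * \<tau>)))" for x
  proof (rule nn_integral_norm_limit_le)
    define c where "c n = R (of_int n * x) / of_real (japanese_bracket n powr s)" for n
    show "AE \<omega> in M. (\<lambda>N. \<Sum>n\<in>{- int N..int N}. c n * g n \<omega>) \<longlonglongrightarrow>
      apply_bcontfun (fourier_series s (\<lambda>n. g n \<omega>)) x - (\<Sum>i\<le>d. taylor_coeff s i \<omega> * of_real x ^ i)"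
      using AE_fourier_partial_sum_tendsto[OF half(1)] AE_taylor_coeff[OF half(2)]
    proof eventually_elim
      case (elim \<omega>)
      have "(\<lambda>N. apply_bcontfun (fourier_partial_sum s (\<lambda>n. g n \<omega>) N) x
          - (\<Sum>i\<le>d. (\<Sum>n\<in>{- int N..int N}. (\<i> * of_int n) ^ i / fact i / of_real (japanese_bracket n powr s) * g n \<omega>) * of_real x ^ i))
        \<longlonglongrightarrow> apply_bcontfun (fourier_series s (\<lambda>n. g n \<omega>)) x - (\<Sum>i\<le>d. taylor_coeff s i \<omega> * of_real x ^ i)"
        using elim by (intro tendsto_intros) auto
      also have "(\<lambda>N. apply_bcontfun (fourier_partial_sum s (\<lambda>n. g n \<omega>) N) x
          - (\<Sum>i\<le>d. (\<Sum>n\<in>{- int N..int N}. (\<i> * of_int n) ^ i / fact i / of_real (japanese_bracket n powr s) * g n \<omega>) * of_real x ^ i))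
        = (\<lambda>N. \<Sum>n\<in>{- int N..int N}. c n * g n \<omega>)"
      proof
        fix N
        have "(\<Sum>i\<le>d. (\<Sum>n\<in>{- int N..int N}. (\<i> * of_int n) ^ i / fact i / of_real (japanese_bracket n powr s) * g n \<omega>) * of_real x ^ i)
          = (\<Sum>n\<in>{- int N..int N}. \<Sum>i\<le>d. (\<i> * of_int n) ^ i / fact i / of_real (japanese_bracket n powr s) * g n \<omega> * of_real x ^ i)"
          unfolding sum_distrib_right by (rule sum.swap)
        also have "\<dots> = (\<Sum>n\<in>{- int N..int N}. (\<Sum>i\<le>d. (\<i> * of_real (of_int n * x)) ^ i / fact i) / of_real (japanese_bracket n powr s) * g n \<omega>)"
          unfolding sum_distrib_right sum_divide_distrib
          by (simp add: power_mult_distrib mult_ac)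
        finally have eq: "(\<Sum>i\<le>d. (\<Sum>n\<in>{- int N..int N}. (\<i> * of_int n) ^ i / fact i / of_real (japanese_bracket n powr s) * g n \<omega>) * of_real x ^ i) = \<dots>" .
        show "apply_bcontfun (fourier_partial_sum s (\<lambda>n. g n \<omega>) N) x
          - (\<Sum>i\<le>d. (\<Sum>n\<in>{- int N..int N}. (\<i> * of_int n) ^ i / fact i / of_real (japanese_bracket n powr s) * g n \<omega>) * of_real x ^ i)
          = (\<Sum>n\<in>{- int N..int N}. c n * g n \<omega>)"
          unfolding eq fourier_partial_sum.rep_eq sum_subtractf[symmetric]
          by (intro sum.cong refl) (simp add: c_def R_def diff_divide_distrib algebra_simps)
      qed
      finally show ?case .
    qed
    fix N
    have "(cmod (c n))\<^sup>2 \<le> 4 * \<bar>x\<bar> powr (2 * \<tau>) * japanese_bracket n powr (- (2 * (s - \<tau>)))" for n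
    proof -
      have "cmod (c n) \<le> 2 * \<bar>of_int n * x\<bar> powr \<tau> / japanese_bracket n powr s"
        unfolding c_def norm_divide using R[of "of_int n * x"] by (simp add: divide_right_mono)
      also have "\<dots> \<le> 2 * (japanese_bracket n powr \<tau> * \<bar>x\<bar> powr \<tau>) / japanese_bracket n powr s"
        unfolding abs_mult using s by (intro divide_right_mono mult_left_mono)
          (auto simp: powr_mult intro!: mult_right_mono powr_mono2 japanese_bracket_ge_abs)
      also have "\<dots> = 2 * \<bar>x\<bar> powr \<tau> * japanese_bracket n powr (- (s - \<tau>))"
        by (simp add: powr_diff powr_minus divide_inverse mult_ac)
      finally have "(cmod (c n))\<^sup>2 \<le> (2 * \<bar>x\<bar> powr \<tau> * japanese_bracket n powr (- (s - \<tau>)))\<^sup>2"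
        by (intro power_mono) auto
      also have "\<dots> = 4 * \<bar>x\<bar> powr (2 * \<tau>) * japanese_bracket n powr (- (2 * (s - \<tau>)))"
      proof -
        have sq: "(z powr a)\<^sup>2 = z powr (2 * a)" for z a :: real
          by (simp add: power2_eq_square powr_add[symmetric])
        show ?thesis unfolding power_mult_distrib sq by simp
      qed
      finally show ?thesis .
    qed
    then have "(\<Sum>n\<in>{- int N..int N}. (cmod (c n))\<^sup>2)
      \<le> (\<Sum>n\<in>{- int N..int N}. 4 * \<bar>x\<bar> powr (2 * \<tau>) * japanese_bracket n powr (- (2 * (s - \<tau>))))"
      by (rule sum_mono)
    also have "\<dots> \<le> 4 * \<bar>x\<bar> powr (2 * \<tau>) * V"
      unfolding sum_distrib_left[symmetric] by (intro mult_left_mono V) auto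
    finally show "(\<Sum>n\<in>{- int N..int N}. (cmod (c n))\<^sup>2) \<le> 4 * V * \<bar>x\<bar> powr (2 * \<tau>)" by (simp add: mult_ac)
  qed simp
  with V(1) show ?thesis by (intro exI[of _ "8 * V"]) (simp add: mult.assoc)
qed

lemma fdiff_fourier_partial_sum:
  "fdiff m h (apply_bcontfun (fourier_partial_sum s a N))
    = (\<Sum>n\<in>{- int N..int N}. fdiff_symbol m s h n * a n)"
proof -
  have "apply_bcontfun (fourier_partial_sum s a N)
    = (\<lambda>x. \<Sum>n\<in>{- int N..int N}. a n / of_real (japanese_bracket n powr s) * exp (\<i> * of_int n * of_real x))"
    by (simp add: fun_eq_iff fourier_partial_sum.rep_eq)
  then show ?thesis
    by (simp only: fdiff_sum fdiff_cmult fdiff_exp) (simp add: fdiff_symbol_def mult_ac)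
qed

text \<open>What is left after removing the block is the limit of sums over frequencies outside
  \<open>B\<close>, so the Fatou bound applies with the variance of any finite part of the
  complement.\<close>

lemma fdiff_block_moment:
  assumes s: "1/2 < s" and B: "finite B"
    and tail: "\<And>I. finite I \<Longrightarrow> I \<inter> B = {} \<Longrightarrow> (\<Sum>n\<in>I. (cmod (fdiff_symbol m s h n))\<^sup>2) \<le> V"
  shows "(\<integral>\<^sup>+\<omega>. ennreal ((cmod (fdiff m h (apply_bcontfun (fourier_series s (\<lambda>n. g n \<omega>)))
      - (\<Sum>n\<in>B. fdiff_symbol m s h n * g n \<omega>)))\<^sup>2) \<partial>M) \<le> ennreal (2 * V)"
proof (rule nn_integral_norm_limit_le)
  obtain N0 where N0: "B \<subseteq> {- int N0..int N0}" using finite_int_subset_symmetric[OF B] by blast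
  show "AE \<omega> in M. (\<lambda>N. \<Sum>n\<in>{- int N..int N} - B. fdiff_symbol m s h n * g n \<omega>) \<longlonglongrightarrow>
    fdiff m h (apply_bcontfun (fourier_series s (\<lambda>n. g n \<omega>))) - (\<Sum>n\<in>B. fdiff_symbol m s h n * g n \<omega>)"
    using AE_fourier_partial_sum_tendsto[OF s]
  proof eventually_elim
    case (elim \<omega>)
    have "(\<lambda>N. fdiff m h (apply_bcontfun (fourier_partial_sum s (\<lambda>n. g n \<omega>) N)) - (\<Sum>n\<in>B. fdiff_symbol m s h n * g n \<omega>))
      \<longlonglongrightarrow> fdiff m h (apply_bcontfun (fourier_series s (\<lambda>n. g n \<omega>))) - (\<Sum>n\<in>B. fdiff_symbol m s h n * g n \<omega>)"
      using elim by (intro tendsto_intros fdiff_tendsto) auto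
    moreover have "\<forall>\<^sub>F N in sequentially. fdiff m h (apply_bcontfun (fourier_partial_sum s (\<lambda>n. g n \<omega>) N)) - (\<Sum>n\<in>B. fdiff_symbol m s h n * g n \<omega>)
      = (\<Sum>n\<in>{- int N..int N} - B. fdiff_symbol m s h n * g n \<omega>)"
      using eventually_ge_at_top[of N0]
    proof eventually_elim
      case (elim N)
      have "B \<subseteq> {- int N..int N}" using N0 elim by force
      then show ?case by (simp add: fdiff_fourier_partial_sum sum_diff B)
    qed
    ultimately show ?case by (rule Lim_transform_eventually)
  qed
  show "(\<Sum>n\<in>{- int N..int N} - B. (cmod (fdiff_symbol m s h n))\<^sup>2) \<le> V" for N
    by (rule tail) auto
qed simp

text \<open>If u(0) vanished almost surely, a finite partial sum would be minus its tail. With the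
  frequency 0 included its second moment is at least 2, while the frequencies are chosen so that the
  tail has at most 1. Evaluation at 0 is treated as the difference of order 0.\<close>

lemma fourier_series_0_not_AE_0:
  assumes s: "1/2 < s"
  shows "\<not> (AE \<omega> in M. apply_bcontfun (fourier_series s (\<lambda>n. g n \<omega>)) 0 = 0)"
proof
  assume zero: "AE \<omega> in M. apply_bcontfun (fourier_series s (\<lambda>n. g n \<omega>)) 0 = 0"
  have "(\<lambda>n. japanese_bracket n powr (- (2 * s))) summable_on UNIV"
    using s by (intro summable_on_japanese_bracket) auto
  from summable_on_tail[OF this, of "1/2"]
  obtain F where F: "finite F" "\<And>I. finite I \<Longrightarrow> I \<inter> F = {} \<Longrightarrow> (\<Sum>n\<in>I. japanese_bracket n powr (- (2 * s))) \<le> 1/2"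
    by auto
  define B where "B = insert 0 F"
  have B: "finite B" using F by (simp add: B_def)
  have sym: "(cmod (fdiff_symbol 0 s h n))\<^sup>2 = japanese_bracket n powr (- (2 * s))" for h n
    by (simp add: norm_fdiff_symbol)
  have "(\<integral>\<^sup>+\<omega>. ennreal ((cmod (\<Sum>n\<in>B. fdiff_symbol 0 s 0 n * g n \<omega>))\<^sup>2) \<partial>M)
    = (\<integral>\<^sup>+\<omega>. ennreal ((cmod (fdiff 0 0 (apply_bcontfun (fourier_series s (\<lambda>n. g n \<omega>)))
      - (\<Sum>n\<in>B. fdiff_symbol 0 s 0 n * g n \<omega>)))\<^sup>2) \<partial>M)"
    using zero by (intro nn_integral_cong_AE) (auto simp: norm_minus_commute)
  also have "\<dots> \<le> ennreal (2 * (1/2))"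
  proof (rule fdiff_block_moment[OF s B])
    fix I :: "int set" assume I: "finite I" "I \<inter> B = {}"
    then have "I \<inter> F = {}" by (auto simp: B_def)
    with I F(2)[of I] show "(\<Sum>n\<in>I. (cmod (fdiff_symbol 0 s 0 n))\<^sup>2) \<le> 1/2" by (simp only: sym)
  qed
  finally have "2 * (\<Sum>n\<in>B. japanese_bracket n powr (- (2 * s))) \<le> 1"
    unfolding nn_integral_norm_sum[OF B] sym by (simp add: ennreal_le_iff)
  moreover have "japanese_bracket 0 powr (- (2 * s)) \<le> (\<Sum>n\<in>B. japanese_bracket n powr (- (2 * s)))"
    using B by (intro member_le_sum) (auto simp: B_def)
  moreover have "japanese_bracket 0 powr (- (2 * s)) = 1" by (simp add: japanese_bracket_def)
  ultimately show False by simp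
qed

end

section \<open>The statistic that separates the two measures\<close>

lemma cmod_real_linear_square:
  "(cmod (a * y + b * cnj y))\<^sup>2 = ((cmod a)\<^sup>2 + (cmod b)\<^sup>2) * (cmod y)\<^sup>2 + 2 * Re (a * cnj b * y\<^sup>2)"
  unfolding cmod_power2 by (simp add: power2_eq_square algebra_simps)

text \<open>The number of scales runs through squares because the law of large numbers is available
  along them. The \<open>v k\<close> are the normalising deviations; both \<open>h\<close> and
  \<open>v\<close> are deterministic, so this is a functional of the path alone.\<close>

definition mean_square_fdiff :: "nat \<Rightarrow> (nat \<Rightarrow> real) \<Rightarrow> (nat \<Rightarrow> real) \<Rightarrow> (real \<Rightarrow> complex) \<Rightarrow> nat \<Rightarrow> real" where
  "mean_square_fdiff m h v f J = (\<Sum>k<(Suc J)\<^sup>2. (cmod (fdiff m (h k) f / of_real (v k)))\<^sup>2) / real ((Suc J)\<^sup>2)"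

context complex_gaussian_family
begin

text \<open>Giving up \<tau>' - \<tau> in the exponent makes the normalised second moments
  geometrically summable along scales below 2^(-k). The bound is asserted only at the sample points
  j h_k, so no uniform control in x is needed.\<close>

lemma AE_remainder_bound:
  assumes s: "0 < \<tau>" "\<tau> < \<tau>'" "\<tau>' < s - 1/2" and d: "real d \<le> \<tau>'" "\<tau>' \<le> real (Suc d)"
    and h: "\<And>k. 0 < h k" "\<And>k. h k \<le> (1/2) ^ k"
  shows "AE \<omega> in M. \<exists>K. \<forall>k. \<forall>j\<le>m. cmod (apply_bcontfun (fourier_series s (\<lambda>n. g n \<omega>)) (real j * h k)
      - (\<Sum>i\<le>d. taylor_coeff s i \<omega> * of_real (real j * h k) ^ i)) \<le> K * h k powr \<tau>"
proof -
  define r where "r x \<omega> = apply_bcontfun (fourier_series s (\<lambda>n. g n \<omega>)) x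
      - (\<Sum>i\<le>d. taylor_coeff s i \<omega> * of_real x ^ i)" for x \<omega>
  have [measurable]: "r x \<in> borel_measurable M" for x
    unfolding r_def using borel_measurable_fourier_series_apply by measurable
  have "0 \<le> \<tau>'" using s by simp
  from taylor_remainder_moment[OF d this s(3)]
  obtain C where C: "C \<ge> 0" "\<And>x. (\<integral>\<^sup>+\<omega>. ennreal ((cmod (r x \<omega>))\<^sup>2) \<partial>M) \<le> ennreal (C * \<bar>x\<bar> powr (2 * \<tau>'))"
    unfolding r_def by blast
  define q where "q = (1/2 :: real) powr (2 * (\<tau>' - \<tau>))"
  have q: "0 \<le> q" "q < 1" using s powr01_less_one[of "1/2" "2 * (\<tau>' - \<tau>)"] by (simp_all add: q_def)
  have "AE \<omega> in M. summable (\<lambda>k. (cmod (r (real j * h k) \<omega>))\<^sup>2 * (1 / h k powr (2 * \<tau>)))" for j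
  proof (rule AE_summable_if_nn_integral_le)
    show "summable (\<lambda>k. C * real j powr (2 * \<tau>') * q ^ k)"
      using q by (intro summable_mult summable_geometric) auto
    fix k
    have "(\<integral>\<^sup>+\<omega>. ennreal ((cmod (r (real j * h k) \<omega>))\<^sup>2 * (1 / h k powr (2 * \<tau>))) \<partial>M)
      = (\<integral>\<^sup>+\<omega>. ennreal ((cmod (r (real j * h k) \<omega>))\<^sup>2) \<partial>M) * ennreal (1 / h k powr (2 * \<tau>))"
      by (subst ennreal_mult) (auto intro!: nn_integral_multc)
    also have "\<dots> \<le> ennreal (C * \<bar>real j * h k\<bar> powr (2 * \<tau>')) * ennreal (1 / h k powr (2 * \<tau>))"
      by (intro mult_right_mono C) auto
    also have "\<dots> = ennreal (C * \<bar>real j * h k\<bar> powr (2 * \<tau>') * (1 / h k powr (2 * \<tau>)))"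
      using C(1) by (intro ennreal_mult[symmetric]) auto
    also have "\<bar>real j * h k\<bar> powr (2 * \<tau>') = real j powr (2 * \<tau>') * h k powr (2 * \<tau>')"
      using h(1)[of k] by (simp add: powr_mult abs_mult)
    also have "C * (real j powr (2 * \<tau>') * h k powr (2 * \<tau>')) * (1 / h k powr (2 * \<tau>))
      = C * real j powr (2 * \<tau>') * h k powr (2 * (\<tau>' - \<tau>))"
      by (simp add: powr_diff right_diff_distrib)
    also have "\<dots> \<le> C * real j powr (2 * \<tau>') * q ^ k"
    proof -
      have "h k powr (2 * (\<tau>' - \<tau>)) \<le> ((1/2) ^ k) powr (2 * (\<tau>' - \<tau>))"
        using h s by (intro powr_mono2) (auto intro: less_imp_le)
      also have "\<dots> = q ^ k"
        unfolding q_def by (simp add: powr_realpow[symmetric] powr_powr mult.commute)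
      finally show ?thesis using C(1) by (intro mult_left_mono) auto
    qed
    finally show "(\<integral>\<^sup>+\<omega>. ennreal ((cmod (r (real j * h k) \<omega>))\<^sup>2 * (1 / h k powr (2 * \<tau>))) \<partial>M)
      \<le> ennreal (C * real j powr (2 * \<tau>') * q ^ k)" by (simp add: ennreal_leI)
  qed (use C q in auto)
  then have "AE \<omega> in M. \<forall>j\<in>{..m}. summable (\<lambda>k. (cmod (r (real j * h k) \<omega>))\<^sup>2 * (1 / h k powr (2 * \<tau>)))"
    by (intro AE_finite_allI) auto
  then show ?thesis
  proof eventually_elim
    case (elim \<omega>)
    then have "\<forall>j\<in>{..m}. \<exists>K>0. \<forall>k. (cmod (r (real j * h k) \<omega>))\<^sup>2 * (1 / h k powr (2 * \<tau>)) \<le> K"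
      using summable_imp_bounded_above by blast
    then obtain K where K: "\<And>j. j \<le> m \<Longrightarrow> 0 < K j" "\<And>j k. j \<le> m \<Longrightarrow> (cmod (r (real j * h k) \<omega>))\<^sup>2 * (1 / h k powr (2 * \<tau>)) \<le> K j"
      by (metis atMost_iff)
    have "cmod (r (real j * h k) \<omega>) \<le> (\<Sum>j\<le>m. sqrt (K j)) * h k powr \<tau>" if j: "j \<le> m" for j k
    proof -
      have hp: "h k powr (2 * \<tau>) = (h k powr \<tau>)\<^sup>2"
        by (simp add: power2_eq_square powr_add[symmetric])
      have "(cmod (r (real j * h k) \<omega>))\<^sup>2 \<le> K j * (h k powr \<tau>)\<^sup>2"
        using K(2)[OF j, of k] h(1)[of k] unfolding hp[symmetric] by (simp add: field_simps)
      then have "cmod (r (real j * h k) \<omega>) \<le> sqrt (K j * (h k powr \<tau>)\<^sup>2)"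
        by (intro real_le_rsqrt)
      also have "\<dots> = sqrt (K j) * h k powr \<tau>" by (simp add: real_sqrt_mult)
      also have "\<dots> \<le> (\<Sum>j\<le>m. sqrt (K j)) * h k powr \<tau>"
        using j K(1) by (intro mult_right_mono member_le_sum) (auto intro: less_imp_le)
      finally show ?thesis .
    qed
    then show ?case unfolding r_def by blast
  qed
qed

text \<open>The quantifier order is essential: \<open>m\<close>, \<open>h\<close> and
  \<open>v\<close> are chosen before t, so the same statistic is available at time 0 and at time
  t.\<close>

lemma AE_mean_square_fdiff_rotF:
  assumes s: "1/2 < s"
  shows "\<exists>m h v. \<forall>t. AE \<omega> in M. mean_square_fdiff m h v (\<lambda>x. rotF t (apply_bcontfun (fourier_series s (\<lambda>n. g n \<omega>)) x))
    \<longlonglongrightarrow> 2 * (1 + 2 * t\<^sup>2 * cmod (apply_bcontfun (fourier_series s (\<lambda>n. g n \<omega>)) 0) ^ 4)"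
proof -
  define \<kappa> where "\<kappa> = s - 1/2"
  \<comment> \<open>Any \<tau> above \<open>lo\<close> satisfies 2\<tau> > \<kappa> and 1 + \<tau> >
    \<kappa>. The midpoints leave room for \<tau> < \<tau>' < \<kappa>, the loss between moment
    bound and pathwise bound.\<close>
  define lo where "lo = max (\<kappa> / 2) (\<kappa> - 1)"
  define \<tau>' where "\<tau>' = (lo + \<kappa>) / 2"
  define \<tau> where "\<tau> = (lo + \<tau>') / 2"
  define d where "d = nat \<lfloor>\<tau>'\<rfloor>"
  define m where "m = nat \<lceil>s\<rceil> + 1"
  have \<kappa>: "0 < \<kappa>" using s by (simp add: \<kappa>_def)
  then have lo: "0 < lo" "lo < \<kappa>" "\<kappa> / 2 \<le> lo" "\<kappa> - 1 \<le> lo" by (auto simp: lo_def)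
  have \<tau>': "lo < \<tau>'" "\<tau>' < \<kappa>" using lo by (auto simp: \<tau>'_def)
  have "lo < \<tau>" "\<tau> < \<tau>'" using \<tau>' by (auto simp: \<tau>_def)
  then have \<tau>: "0 < \<tau>" "\<tau> < \<tau>'" "\<kappa> < 2 * \<tau>" "\<kappa> < 1 + \<tau>" using lo by linarith+
  have d: "real d \<le> \<tau>'" "\<tau>' \<le> real (Suc d)" using \<tau>' lo by (auto simp: d_def) linarith+
  have ms: "s < real m" unfolding m_def by linarith
  have dm: "d < m" "\<kappa> < real m" using d \<tau>' ms by (auto simp: \<kappa>_def)
  obtain N B c where c: "0 < c" and N: "\<And>k. 2 ^ k \<le> (N k :: nat)" and B: "\<And>k. finite (B k)"
      "\<And>j k. j \<noteq> k \<Longrightarrow> B j \<inter> B k = {}"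
    and low: "\<And>k. c * (1 / real (N k)) powr (2 * s - 1) \<le> (\<Sum>n\<in>B k. (cmod (fdiff_symbol m s (1 / real (N k)) n))\<^sup>2)"
    and tail: "\<And>k I. finite I \<Longrightarrow> I \<inter> B k = {} \<Longrightarrow> (\<Sum>n\<in>I. (cmod (fdiff_symbol m s (1 / real (N k)) n))\<^sup>2)
      \<le> (1/4) ^ k * (\<Sum>n\<in>B k. (cmod (fdiff_symbol m s (1 / real (N k)) n))\<^sup>2)"
    using scales_exist[OF s ms] by metis
  define h where "h k = 1 / real (N k)" for k
  define V where "V k = (\<Sum>n\<in>B k. (cmod (fdiff_symbol m s (h k) n))\<^sup>2)" for k
  \<comment> \<open>The block coefficients divided by \<open>v k\<close> have unit square sum, so E
    |Y_k|^2 = 2 and not 1.\<close>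
  define v where "v k = sqrt (V k)" for k
  have h: "0 < h k" "h k \<le> (1/2) ^ k" for k
  proof -
    have N2: "2 ^ k \<le> real (N k)" using N[of k] by (metis of_nat_le_iff of_nat_numeral of_nat_power)
    have "(0 :: real) < 2 ^ k" by simp
    with N2 have "0 < real (N k)" by linarith
    with N2 show "0 < h k" "h k \<le> (1/2) ^ k" unfolding h_def by (auto simp: power_divide field_simps)
  qed
  have h1: "h k \<le> 1" for k using h(2)[of k] power_le_one[of "1/2 :: real" k] by linarith
  have h0: "h \<longlonglongrightarrow> 0"
    by (rule tendsto_sandwich[OF _ _ tendsto_const LIMSEQ_realpow_zero[of "1/2"]])
       (auto intro!: always_eventually h less_imp_le[OF h(1)])
  have V: "c * h k powr (2 * \<kappa>) \<le> V k" for k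
    using low[of k] by (simp add: h_def V_def \<kappa>_def)
  have Vpos: "0 < V k" for k
  proof -
    have "0 < c * h k powr (2 * \<kappa>)" using c h(1)[of k] by simp
    with V[of k] show ?thesis by linarith
  qed
  then have v: "0 < v k" "(v k)\<^sup>2 = V k" for k by (auto simp: v_def less_imp_le)
  have vlow: "sqrt c * h k powr \<kappa> \<le> v k" for k
  proof -
    have "(h k powr \<kappa>)\<^sup>2 = h k powr (2 * \<kappa>)" by (simp add: power2_eq_square powr_add[symmetric])
    then have "sqrt c * h k powr \<kappa> = sqrt (c * h k powr (2 * \<kappa>))"
      by (simp add: real_sqrt_mult flip: \<open>(h k powr \<kappa>)\<^sup>2 = h k powr (2 * \<kappa>)\<close>)
    also have "\<dots> \<le> v k" unfolding v_def by (rule real_sqrt_le_mono[OF V])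
    finally show ?thesis .
  qed
  define U where "U \<omega> = apply_bcontfun (fourier_series s (\<lambda>n. g n \<omega>))" for \<omega>
  define Y where "Y k \<omega> = (\<Sum>n\<in>B k. (fdiff_symbol m s (h k) n / of_real (v k)) * g n \<omega>)" for k \<omega>
  have YB: "Y k \<omega> = (\<Sum>n\<in>B k. fdiff_symbol m s (h k) n * g n \<omega>) / of_real (v k)" for k \<omega>
    by (simp add: Y_def sum_divide_distrib)
  \<comment> \<open>The part of the normalised difference not carried by the block; its second
    moment is at most 2 (1/4)^k, so it tends to 0 almost surely.\<close>
  define D where "D k \<omega> = fdiff m (h k) (U \<omega>) / of_real (v k) - Y k \<omega>" for k \<omega>
  have [measurable]: "Y k \<in> borel_measurable M" "D k \<in> borel_measurable M" for k
    unfolding D_def Y_def U_def using borel_measurable_fdiff_fourier_series by measurable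
  have norm1: "(\<Sum>n\<in>B k. (cmod (fdiff_symbol m s (h k) n / of_real (v k)))\<^sup>2) = 1" for k
  proof -
    have "(\<Sum>n\<in>B k. (cmod (fdiff_symbol m s (h k) n / of_real (v k)))\<^sup>2) = V k / V k"
      unfolding norm_divide power_divide norm_of_real power2_abs v(2) sum_divide_distrib[symmetric] V_def ..
    then show ?thesis using Vpos[of k] by simp
  qed
  have "AE \<omega> in M. summable (\<lambda>k. (cmod (D k \<omega>))\<^sup>2)"
  proof (rule AE_summable_if_nn_integral_le)
    show "summable (\<lambda>k. 2 * (1/4 :: real) ^ k)" by (intro summable_mult summable_geometric) auto
    fix k
    have D2: "(cmod (D k \<omega>))\<^sup>2 = (cmod (fdiff m (h k) (U \<omega>) - (\<Sum>n\<in>B k. fdiff_symbol m s (h k) n * g n \<omega>)))\<^sup>2 * (1 / V k)" for \<omega>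
      unfolding D_def YB diff_divide_distrib[symmetric] norm_divide power_divide norm_of_real power2_abs v(2) by simp
    have m': "(\<lambda>\<omega>. fdiff m (h k) (U \<omega>) - (\<Sum>n\<in>B k. fdiff_symbol m s (h k) n * g n \<omega>)) \<in> borel_measurable M"
      unfolding U_def using borel_measurable_fdiff_fourier_series by measurable
    have "(\<integral>\<^sup>+\<omega>. ennreal ((cmod (D k \<omega>))\<^sup>2) \<partial>M)
      = (\<integral>\<^sup>+\<omega>. ennreal ((cmod (fdiff m (h k) (U \<omega>) - (\<Sum>n\<in>B k. fdiff_symbol m s (h k) n * g n \<omega>)))\<^sup>2) \<partial>M) * ennreal (1 / V k)"
      unfolding D2 using m' Vpos[of k] by (subst ennreal_mult) (auto intro!: nn_integral_multc)
    also have "\<dots> \<le> ennreal (2 * ((1/4) ^ k * V k)) * ennreal (1 / V k)"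
      unfolding U_def
      by (intro mult_right_mono fdiff_block_moment[OF s B(1)]) (use tail in \<open>auto simp: h_def V_def\<close>)
    also have "\<dots> = ennreal (2 * (1/4) ^ k)"
      using Vpos[of k] by (subst ennreal_mult'[symmetric]) auto
    finally show "(\<integral>\<^sup>+\<omega>. ennreal ((cmod (D k \<omega>))\<^sup>2) \<partial>M) \<le> ennreal (2 * (1/4) ^ k)" .
  qed auto
  then have AE_D: "AE \<omega> in M. (\<lambda>k. D k \<omega>) \<longlonglongrightarrow> 0"
  proof eventually_elim
    case (elim \<omega>)
    then have "(\<lambda>k. sqrt ((cmod (D k \<omega>))\<^sup>2)) \<longlonglongrightarrow> sqrt 0"
      by (intro tendsto_real_sqrt summable_LIMSEQ_zero)
    then show ?case by (simp add: tendsto_norm_zero_iff)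
  qed
  have AE_avg: "AE \<omega> in M. (\<lambda>J. (\<Sum>k<(Suc J)\<^sup>2. (cmod (Y k \<omega>))\<^sup>2) / real ((Suc J)\<^sup>2)) \<longlonglongrightarrow> 2"
    "AE \<omega> in M. (\<lambda>J. (\<Sum>k<(Suc J)\<^sup>2. (Y k \<omega>)\<^sup>2) / of_nat ((Suc J)\<^sup>2)) \<longlonglongrightarrow> 0"
    unfolding Y_def by (rule AE_block_averages[OF B(1) B(2) norm1]; assumption)+
  have AE_r: "AE \<omega> in M. \<exists>K. \<forall>k. \<forall>j\<le>m. cmod (U \<omega> (real j * h k)
      - (\<Sum>i\<le>d. taylor_coeff s i \<omega> * of_real (real j * h k) ^ i)) \<le> K * h k powr \<tau>"
    unfolding U_def using \<tau> \<tau>' by (intro AE_remainder_bound[OF \<tau>(1,2) _ d h]) (simp add: \<kappa>_def)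
  have AE_0: "AE \<omega> in M. taylor_coeff s 0 \<omega> = U \<omega> 0"
    unfolding U_def by (rule AE_taylor_coeff_0[OF s])
  have "AE \<omega> in M. mean_square_fdiff m h v (\<lambda>x. rotF t (U \<omega> x)) \<longlonglongrightarrow> 2 * (1 + 2 * t\<^sup>2 * cmod (U \<omega> 0) ^ 4)" for t
    using AE_D AE_avg AE_r AE_0
  proof eventually_elim
    case (elim \<omega>)
    define a b where "a = rotA t (U \<omega> 0)" and "b = rotB t (U \<omega> 0)"
    define y where "y k = a * Y k \<omega> + b * cnj (Y k \<omega>)" for k
    \<comment> \<open>The linearisation error. Division by v_k \<ge> sqrt c h_k^\<kappa> leaves the
      exponents m - \<kappa>, 2\<tau> - \<kappa> and 1 + \<tau> - \<kappa>, all positive.\<close>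
    define E where "E k = fdiff m (h k) (\<lambda>x. rotF t (U \<omega> x)) - (a * fdiff m (h k) (U \<omega>) + b * cnj (fdiff m (h k) (U \<omega>)))" for k
    define e where "e k = E k / of_real (v k) + (a * D k \<omega> + b * cnj (D k \<omega>))" for k
    obtain K where K: "\<And>k j. j \<le> m \<Longrightarrow> cmod (U \<omega> (real j * h k) - (\<Sum>i\<le>d. taylor_coeff s i \<omega> * of_real (real j * h k) ^ i)) \<le> K * h k powr \<tau>"
      using elim(4) by blast
    have "\<exists>C. \<forall>k. cmod (E k) \<le> C * (h k ^ m + h k powr (2 * \<tau>) + h k powr (1 + \<tau>))"
      unfolding E_def a_def b_def elim(5)[symmetric]
      by (rule rotF_fdiff_expansion[OF dm(1) h(1) h1 \<tau>(1) K])
    then obtain C where C: "\<And>k. cmod (E k) \<le> C * (h k ^ m + h k powr (2 * \<tau>) + h k powr (1 + \<tau>))"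
      by blast
    have pow0: "(\<lambda>k. h k powr p) \<longlonglongrightarrow> 0" if "0 < p" for p
      using that by (intro tendsto_zero_powrI[OF h0 tendsto_const])
        (auto intro!: always_eventually less_imp_le[OF h(1)])
    have "(\<lambda>k. \<bar>C\<bar> / sqrt c * (h k powr (real m - \<kappa>) + h k powr (2 * \<tau> - \<kappa>) + h k powr (1 + \<tau> - \<kappa>))) \<longlonglongrightarrow> \<bar>C\<bar> / sqrt c * (0 + 0 + 0)"
      using dm \<tau> by (intro tendsto_intros pow0) auto
    then have lim: "(\<lambda>k. \<bar>C\<bar> / sqrt c * (h k powr (real m - \<kappa>) + h k powr (2 * \<tau> - \<kappa>) + h k powr (1 + \<tau> - \<kappa>))) \<longlonglongrightarrow> 0"
      by simp
    have "(\<lambda>k. E k / of_real (v k)) \<longlonglongrightarrow> 0"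
    proof (rule Lim_null_comparison[OF _ lim], intro always_eventually allI)
      fix k
      have "cmod (E k) \<le> \<bar>C\<bar> * (h k ^ m + h k powr (2 * \<tau>) + h k powr (1 + \<tau>))"
        using h(1)[of k] by (intro order_trans[OF C] mult_right_mono) (auto intro!: add_nonneg_nonneg)
      then have "cmod (E k / of_real (v k)) \<le> \<bar>C\<bar> * (h k ^ m + h k powr (2 * \<tau>) + h k powr (1 + \<tau>)) / (sqrt c * h k powr \<kappa>)"
        unfolding norm_divide using v(1)[of k] vlow[of k] c h(1)[of k]
        by (intro frac_le) (auto intro!: add_nonneg_nonneg)
      also have "\<dots> = \<bar>C\<bar> / sqrt c * (h k powr (real m - \<kappa>) + h k powr (2 * \<tau> - \<kappa>) + h k powr (1 + \<tau> - \<kappa>))"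
        using h(1)[of k] by (simp add: powr_diff powr_realpow add_divide_distrib distrib_left mult.commute)
      finally show "cmod (E k / of_real (v k)) \<le> \<dots>" .
    qed
    moreover have "(\<lambda>k. a * D k \<omega> + b * cnj (D k \<omega>)) \<longlonglongrightarrow> a * 0 + b * cnj 0"
      by (intro tendsto_intros elim(1))
    ultimately have "e \<longlonglongrightarrow> 0 + (a * 0 + b * cnj 0)"
      unfolding e_def by (rule tendsto_add)
    then have e0: "e \<longlonglongrightarrow> 0" by simp
    have n: "filterlim (\<lambda>J. (Suc J)\<^sup>2) at_top sequentially"
      by (rule filterlim_at_top_mono[OF filterlim_Suc]) (auto intro!: always_eventually simp: power2_eq_square)
    have avg: "(\<lambda>J. (\<Sum>k<(Suc J)\<^sup>2. (cmod (y k))\<^sup>2) / real ((Suc J)\<^sup>2)) \<longlonglongrightarrow> 2 * ((cmod a)\<^sup>2 + (cmod b)\<^sup>2)"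
    proof -
      have "(\<lambda>J. ((cmod a)\<^sup>2 + (cmod b)\<^sup>2) * ((\<Sum>k<(Suc J)\<^sup>2. (cmod (Y k \<omega>))\<^sup>2) / real ((Suc J)\<^sup>2))
          + 2 * Re (a * cnj b * ((\<Sum>k<(Suc J)\<^sup>2. (Y k \<omega>)\<^sup>2) / of_nat ((Suc J)\<^sup>2))))
        \<longlonglongrightarrow> ((cmod a)\<^sup>2 + (cmod b)\<^sup>2) * 2 + 2 * Re (a * cnj b * 0)"
        by (intro tendsto_intros elim(2,3))
      moreover have "(\<Sum>k<n. (cmod (y k))\<^sup>2) / real n
         = ((cmod a)\<^sup>2 + (cmod b)\<^sup>2) * ((\<Sum>k<n. (cmod (Y k \<omega>))\<^sup>2) / real n)
          + 2 * Re (a * cnj b * ((\<Sum>k<n. (Y k \<omega>)\<^sup>2) / of_nat n))" for n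
      proof -
        have "(\<Sum>k<n. (cmod (y k))\<^sup>2) = ((cmod a)\<^sup>2 + (cmod b)\<^sup>2) * (\<Sum>k<n. (cmod (Y k \<omega>))\<^sup>2)
          + 2 * Re (a * cnj b * (\<Sum>k<n. (Y k \<omega>)\<^sup>2))"
          unfolding y_def cmod_real_linear_square sum.distrib sum_distrib_left Re_sum ..
        moreover have "Re (z / of_nat n) = Re z / real n" for z
          by (metis Re_divide_of_real of_real_of_nat_eq)
        ultimately show ?thesis by (simp only: add_divide_distrib times_divide_eq_right)
      qed
      ultimately show ?thesis by (simp only:) (simp add: mult.commute)
    qed
    have "fdiff m (h k) (\<lambda>x. rotF t (U \<omega> x)) / of_real (v k) = y k + e k" for k
      by (simp add: e_def E_def y_def D_def diff_divide_distrib add_divide_distrib algebra_simps)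
    with mean_square_perturbation[OF avg n e0] show ?case
      unfolding mean_square_fdiff_def a_def b_def rotA_rotB_norm by (simp only:)
  qed
  then show ?thesis unfolding U_def by blast
qed

end

theorem theorem1p6:
  fixes M :: "'w measure" and g :: "int \<Rightarrow> 'w \<Rightarrow> complex" and s t :: real
  assumes "prob_space M"
    and "iid_complex_gaussians M g"
    and "s > 1/2"
    and "t \<noteq> 0"
  shows "\<not> absolutely_continuous (gaussian_law M g s)
             (distr (gaussian_law M g s) CT (dispersionless_flow t)) \<and>
         \<not> quasi_invariant (gaussian_law M g s) (dispersionless_flow t)"
proof -
  interpret complex_gaussian_family M g
    using assms by (simp add: complex_gaussian_family_def complex_gaussian_family_axioms_def)
  define X where "X \<omega> = fourier_series s (\<lambda>n. g n \<omega>)" for \<omega>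
  define \<mu> where "\<mu> = gaussian_law M g s"
  have X [measurable]: "X \<in> measurable M CT"
    unfolding X_def by (rule measurable_fourier_series_g)
  have \<mu>: "\<mu> = distr M CT X" by (simp add: \<mu>_def gaussian_law_def X_def[abs_def])
  note [measurable] = measurable_dispersionless_flow
  obtain m h v where lim: "\<And>t. AE \<omega> in M. mean_square_fdiff m h v (\<lambda>x. rotF t (apply_bcontfun (X \<omega>) x))
      \<longlonglongrightarrow> 2 * (1 + 2 * t\<^sup>2 * cmod (apply_bcontfun (X \<omega>) 0) ^ 4)"
    using AE_mean_square_fdiff_rotF[OF assms(3)] unfolding X_def by blast
  \<comment> \<open>This event has full measure because the flow at time 0 is the identity. Absolute
    continuity would transfer it to the image measure, and uniqueness of the limit would then force
    t^2 |u(0)|^4 = 0 almost surely.\<close>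
  define A where "A f \<longleftrightarrow> mean_square_fdiff m h v (apply_bcontfun f) \<longlonglongrightarrow> 2" for f
  have [measurable]: "Measurable.pred CT A"
  proof -
    have "(\<lambda>f. mean_square_fdiff m h v (apply_bcontfun f) J) \<in> borel_measurable CT" for J
      unfolding mean_square_fdiff_def using borel_measurable_fdiff_CT by measurable
    then show ?thesis unfolding A_def by (rule measurable_limit)
  qed
  have "\<not> absolutely_continuous \<mu> (distr \<mu> CT (dispersionless_flow t))"
  proof
    assume ac: "absolutely_continuous \<mu> (distr \<mu> CT (dispersionless_flow t))"
    have "rotF 0 w = w" for w by (simp add: rotF_def)
    then have "AE \<omega> in M. A (X \<omega>)" using lim[of 0] by (simp add: A_def)
    then have "AE f in \<mu>. A f" unfolding \<mu> by (subst AE_distr_iff) auto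
    then have "AE f in distr \<mu> CT (dispersionless_flow t). A f"
      by (rule absolutely_continuous_AE[OF _ ac, rotated]) (simp add: \<mu>)
    then have "AE f in \<mu>. A (dispersionless_flow t f)"
      by (subst (asm) AE_distr_iff) (auto simp: \<mu>)
    then have "AE \<omega> in M. A (dispersionless_flow t (X \<omega>))"
      unfolding \<mu> by (subst (asm) AE_distr_iff) auto
    with lim[of t] have "AE \<omega> in M. apply_bcontfun (X \<omega>) 0 = 0"
    proof eventually_elim
      case (elim \<omega>)
      have "apply_bcontfun (dispersionless_flow t (X \<omega>)) = (\<lambda>x. rotF t (apply_bcontfun (X \<omega>) x))"
        by (simp add: fun_eq_iff dispersionless_flow_eq phase_rotation_apply)
      with elim(2) have "mean_square_fdiff m h v (\<lambda>x. rotF t (apply_bcontfun (X \<omega>) x)) \<longlonglongrightarrow> 2"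
        by (simp add: A_def)
      with elim(1) have "2 * (1 + 2 * t\<^sup>2 * cmod (apply_bcontfun (X \<omega>) 0) ^ 4) = 2"
        by (rule LIMSEQ_unique)
      with assms(4) show ?case by simp
    qed
    then show False using fourier_series_0_not_AE_0[OF assms(3)] by (simp add: X_def)
  qed
  moreover have "distr \<mu> \<mu> (dispersionless_flow t) = distr \<mu> CT (dispersionless_flow t)"
    by (rule distr_cong) (auto simp: \<mu>)
  ultimately show ?thesis by (simp add: quasi_invariant_def \<mu>_def)
qed

end
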